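(* There is no fixed-parameter algorithm for \textsc{ConsCheck: Independent Set[degree]} even when the number $t^-$ of negative samples is taken as an additional parameter (i.e., parameterized by $k+d+t^-$), unless $\mathsf{FPT}=\mathsf{W}[1]$.
   Context: \textsc{ConsCheck: Independent Set[degree]}: Input: integers $k,d$ and $\mathcal{I}=\{V,(E_i,\lambda_i)_{i\in[t]}\}$ where $V$ is a finite vertex set, each $G_i=(V,E_i)$ is a graph of maximum degree at most $d$, and $\lambda_i\in\{0,1\}$. Task: compute $X\subseteq V$ with $|X|=k$ such that for each $i\in[t]$, $X$ is an independent set in $G_i$ iff $\lambda_i=1$, or report that none exists. $t^-=|\{i:\lambda_i=0\}|$. A fixed-parameter algorithm runs in time $f(k+d+t^-)\cdot|\mathcal{I}|^{\mathcal{O}(1)}$ for a computable $f$. *)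

theory Defs
  imports Complex_Main
begin

section \<open>Model of computation\<close>

text \<open>
  Algorithms are WHILE programs in the sense of N. D. Jones: a program has finitely many
  registers, each holding a finite binary tree (an S-expression, equivalently a word of balanced
  parentheses).  Every elementary operation is charged the sizes of all trees it touches, not unit
  cost, so that a computation of length \<open>t\<close> only ever touches trees of size at most
  \<open>t\<close>, and the model simulates, and is simulated by, multitape Turing
  machines with polynomial overhead.
\<close>

datatype dat = Leaf | Node dat dat

primrec dsize :: "dat \<Rightarrow> nat" where
  "dsize Leaf = 1"
| "dsize (Node a b) = Suc (dsize a + dsize b)"

primrec dfst :: "dat \<Rightarrow> dat" where
  "dfst Leaf = Leaf"
| "dfst (Node a b) = a"

primrec dsnd :: "dat \<Rightarrow> dat" where
  "dsnd Leaf = Leaf"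
| "dsnd (Node a b) = b"

primrec enc_bool :: "bool \<Rightarrow> dat" where
  "enc_bool False = Leaf"
| "enc_bool True = Node Leaf Leaf"

text \<open>Numbers are coded in unary.\<close>

primrec enc_nat :: "nat \<Rightarrow> dat" where
  "enc_nat 0 = Leaf"
| "enc_nat (Suc n) = Node Leaf (enc_nat n)"

primrec enc_list :: "('a \<Rightarrow> dat) \<Rightarrow> 'a list \<Rightarrow> dat" where
  "enc_list e [] = Leaf"
| "enc_list e (x # xs) = Node (e x) (enc_list e xs)"

type_synonym state = "nat \<Rightarrow> dat"

datatype expr = EVar nat | ELeaf | ENode expr expr | EFst expr | ESnd expr | EEq expr expr

primrec eval :: "expr \<Rightarrow> state \<Rightarrow> dat" where
  "eval (EVar x) s = s x"
| "eval ELeaf s = Leaf"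
| "eval (ENode a b) s = Node (eval a s) (eval b s)"
| "eval (EFst a) s = dfst (eval a s)"
| "eval (ESnd a) s = dsnd (eval a s)"
| "eval (EEq a b) s = enc_bool (eval a s = eval b s)"

text \<open>The cost of evaluating an expression is the total size of the values of its
  subexpressions.\<close>

primrec ecost :: "expr \<Rightarrow> state \<Rightarrow> nat" where
  "ecost (EVar x) s = dsize (s x)"
| "ecost ELeaf s = dsize Leaf"
| "ecost (ENode a b) s = ecost a s + ecost b s + dsize (eval (ENode a b) s)"
| "ecost (EFst a) s = ecost a s + dsize (eval (EFst a) s)"
| "ecost (ESnd a) s = ecost a s + dsize (eval (ESnd a) s)"
| "ecost (EEq a b) s = ecost a s + ecost b s + dsize (eval (EEq a b) s)"

datatype com = Skip | Assign nat expr | Seq com com | Cond expr com com | While expr com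

text \<open>\<open>exec c s t s'\<close>: started in state \<open>s\<close>, the command \<open>c\<close>
  halts in state \<open>s'\<close> after time exactly \<open>t\<close>.  A test succeeds iff its value
  is not \<open>Leaf\<close>.\<close>

inductive exec :: "com \<Rightarrow> state \<Rightarrow> nat \<Rightarrow> state \<Rightarrow> bool" where
  Skip: "exec Skip s 1 s"
| Assign: "exec (Assign x e) s (1 + ecost e s) (s(x := eval e s))"
| Seq: "\<lbrakk>exec c1 s t1 s1; exec c2 s1 t2 s2\<rbrakk> \<Longrightarrow> exec (Seq c1 c2) s (t1 + t2) s2"
| CondTrue: "\<lbrakk>eval e s \<noteq> Leaf; exec c1 s t s1\<rbrakk> \<Longrightarrow> exec (Cond e c1 c2) s (1 + ecost e s + t) s1"
| CondFalse: "\<lbrakk>eval e s = Leaf; exec c2 s t s1\<rbrakk> \<Longrightarrow> exec (Cond e c1 c2) s (1 + ecost e s + t) s1"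
| WhileFalse: "eval e s = Leaf \<Longrightarrow> exec (While e c) s (1 + ecost e s) s"
| WhileTrue: "\<lbrakk>eval e s \<noteq> Leaf; exec c s t1 s1; exec (While e c) s1 t2 s2\<rbrakk>
    \<Longrightarrow> exec (While e c) s (1 + ecost e s + t1 + t2) s2"

inductive_cases SkipE: "exec Skip s t s'"
inductive_cases AssignE: "exec (Assign x e) s t s'"
inductive_cases SeqE: "exec (Seq c1 c2) s t s'"
inductive_cases CondE: "exec (Cond e c1 c2) s t s'"
inductive_cases WhileE: "exec (While e c) s t s'"

lemma exec_deterministic:
  "exec c s t s' \<Longrightarrow> exec c s u s'' \<Longrightarrow> t = u \<and> s' = s''"
proof (induction arbitrary: u s'' rule: exec.induct)
  case (Skip s)
  then show ?case by (rule SkipE) simp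
next
  case (Assign x e s)
  then show ?case by (rule AssignE) simp
next
  case (Seq c1 s t1 s1 c2 t2 s2)
  show ?case by (rule SeqE[OF Seq.prems]) (metis Seq.IH)
next
  case (CondTrue e s c1 t s1 c2)
  show ?case by (rule CondE[OF CondTrue.prems]) (use CondTrue.hyps in \<open>auto dest: CondTrue.IH\<close>)
next
  case (CondFalse e s c2 t s1 c1)
  show ?case by (rule CondE[OF CondFalse.prems]) (use CondFalse.hyps in \<open>auto dest: CondFalse.IH\<close>)
next
  case (WhileFalse e s c)
  show ?case by (rule WhileE[OF WhileFalse.prems]) (use WhileFalse.hyps in auto)
next
  case (WhileTrue e s c t1 s1 t2 s2)
  show ?case
  proof (rule WhileE[OF WhileTrue.prems])
    assume "eval e s = Leaf"
    with WhileTrue.hyps show ?thesis by simp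
  next
    fix t1' s1' t2'
    assume u: "u = Suc (ecost e s + t1' + t2')" and "exec c s t1' s1'"
      and w: "exec (While e c) s1' t2' s''"
    then have "t1 = t1'" "s1 = s1'" using WhileTrue.IH(1) by auto
    with u w WhileTrue.IH(2)[of t2' s''] show ?thesis by simp
  qed
qed

text \<open>Input and output are passed in register 0; the other registers are initially
  \<open>Leaf\<close>.\<close>

definition runs :: "com \<Rightarrow> dat \<Rightarrow> nat \<Rightarrow> dat \<Rightarrow> bool" where
  "runs P x t y \<longleftrightarrow> (\<exists>s. exec P ((\<lambda>_. Leaf)(0 := x)) t s \<and> s 0 = y)"

definition computable :: "(nat \<Rightarrow> nat) \<Rightarrow> bool" where
  "computable f \<longleftrightarrow> (\<exists>P. \<forall>n. \<exists>t. runs P (enc_nat n) t (enc_nat (f n)))"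


section \<open>Parameterized problems, FPT and the W-hierarchy\<close>

type_synonym param_problem = "(dat \<times> nat) set"

definition enc_param :: "dat \<Rightarrow> nat \<Rightarrow> dat" where
  "enc_param x k = Node x (enc_nat k)"

definition FPT :: "param_problem set" where
  "FPT = {L. \<exists>P f c. computable f \<and>
     (\<forall>x k. \<exists>t y. runs P (enc_param x k) t y
        \<and> t \<le> f k * dsize (enc_param x k) ^ c
        \<and> (y \<noteq> Leaf \<longleftrightarrow> (x, k) \<in> L))}"

definition fpt_reducible :: "param_problem \<Rightarrow> param_problem \<Rightarrow> bool" where
  "fpt_reducible L M \<longleftrightarrow> (\<exists>P f g c. computable f \<and> computable g \<and>
     (\<forall>x k. \<exists>t x' k'. runs P (enc_param x k) t (enc_param x' k')
        \<and> t \<le> f k * dsize (enc_param x k) ^ c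
        \<and> k' \<le> g k
        \<and> ((x, k) \<in> L \<longleftrightarrow> (x', k') \<in> M)))"

text \<open>A Boolean circuit is a directed acyclic graph listed in topological order: gate number
  \<open>i\<close> refers to its in-neighbours by their positions, which are smaller than \<open>i\<close>.
  The last gate is the output gate.  Parallel wires are allowed and count towards the in-degree.\<close>

datatype gate = Input | NotG nat | AndG "nat list" | OrG "nat list"

primrec preds :: "gate \<Rightarrow> nat list" where
  "preds Input = []"
| "preds (NotG j) = [j]"
| "preds (AndG js) = js"
| "preds (OrG js) = js"

definition circuit :: "gate list \<Rightarrow> bool" where
  "circuit C \<longleftrightarrow> C \<noteq> [] \<and>
     (\<forall>i<length C. (C ! i \<noteq> Input \<longrightarrow> preds (C ! i) \<noteq> []) \<and> (\<forall>j\<in>set (preds (C ! i)). j < i))"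

definition inputs :: "gate list \<Rightarrow> nat set" where
  "inputs C = {i. i < length C \<and> C ! i = Input}"

text \<open>\<open>scan_gates step C\<close> lists a quantity defined gate by gate, where
  \<open>step\<close> receives the list of the results for all earlier gates.\<close>

definition scan_gates :: "('a list \<Rightarrow> gate \<Rightarrow> 'a) \<Rightarrow> gate list \<Rightarrow> 'a list" where
  "scan_gates step C = foldl (\<lambda>rs g. rs @ [step rs g]) [] C"

primrec gate_value :: "nat set \<Rightarrow> bool list \<Rightarrow> gate \<Rightarrow> bool" where
  "gate_value S vs Input \<longleftrightarrow> length vs \<in> S"
| "gate_value S vs (NotG j) \<longleftrightarrow> \<not> vs ! j"
| "gate_value S vs (AndG js) \<longleftrightarrow> (\<forall>j\<in>set js. vs ! j)"
| "gate_value S vs (OrG js) \<longleftrightarrow> (\<exists>j\<in>set js. vs ! j)"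

text \<open>The value of the circuit when exactly the input gates in \<open>S\<close> are set to true.\<close>

definition circuit_value :: "gate list \<Rightarrow> nat set \<Rightarrow> bool" where
  "circuit_value C S \<longleftrightarrow> last (scan_gates (gate_value S) C)"

text \<open>Depth is the maximal length of a path from an input gate to the output gate; weft is the
  maximal number of large gates, i.e. gates of in-degree more than two, on such a path.\<close>

definition gate_depth :: "nat list \<Rightarrow> gate \<Rightarrow> nat" where
  "gate_depth ds g = (if preds g = [] then 0 else Suc (Max ((\<lambda>j. ds ! j) ` set (preds g))))"

definition circuit_depth :: "gate list \<Rightarrow> nat" where
  "circuit_depth C = last (scan_gates gate_depth C)"

definition gate_weft :: "nat list \<Rightarrow> gate \<Rightarrow> nat" where
  "gate_weft ws g = (if preds g = [] then 0
     else (if length (preds g) > 2 then 1 else 0) + Max ((\<lambda>j. ws ! j) ` set (preds g)))"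

definition circuit_weft :: "gate list \<Rightarrow> nat" where
  "circuit_weft C = last (scan_gates gate_weft C)"

primrec enc_gate :: "gate \<Rightarrow> dat" where
  "enc_gate Input = Node (enc_nat 0) Leaf"
| "enc_gate (NotG j) = Node (enc_nat 1) (enc_nat j)"
| "enc_gate (AndG js) = Node (enc_nat 2) (enc_list enc_nat js)"
| "enc_gate (OrG js) = Node (enc_nat 3) (enc_list enc_nat js)"

text \<open>Weighted Circuit Satisfiability for circuits of weft at most \<open>w\<close> and depth at most
  \<open>h\<close>: is there a satisfying assignment of weight exactly \<open>k\<close>?\<close>

definition WCS :: "nat \<Rightarrow> nat \<Rightarrow> param_problem" where
  "WCS w h = {(x, k). \<exists>C. x = enc_list enc_gate C \<and> circuit C
     \<and> circuit_weft C \<le> w \<and> circuit_depth C \<le> h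
     \<and> (\<exists>S \<subseteq> inputs C. card S = k \<and> circuit_value C S)}"

definition W :: "nat \<Rightarrow> param_problem set" where
  "W w = {L. \<exists>h. fpt_reducible L (WCS w h)}"


section \<open>Consistency checking for Independent Set with bounded degree\<close>

text \<open>An instance lists the vertices and, for each sample, the edges of its graph together
  with its label.\<close>

type_synonym instance_is = "nat list \<times> ((nat \<times> nat) list \<times> bool) list"

definition vertices :: "instance_is \<Rightarrow> nat set" where
  "vertices I = set (fst I)"

definition samples :: "instance_is \<Rightarrow> ((nat \<times> nat) list \<times> bool) list" where
  "samples I = snd I"

definition edges :: "(nat \<times> nat) list \<Rightarrow> nat set set" where
  "edges es = (\<lambda>(u, v). {u, v}) ` set es"

definition simple_graph :: "nat set \<Rightarrow> nat set set \<Rightarrow> bool" where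
  "simple_graph V E \<longleftrightarrow> finite V \<and> (\<forall>e\<in>E. e \<subseteq> V \<and> card e = 2)"

definition degree :: "nat set set \<Rightarrow> nat \<Rightarrow> nat" where
  "degree E v = card {e \<in> E. v \<in> e}"

definition independent_set :: "nat set \<Rightarrow> nat set set \<Rightarrow> nat set \<Rightarrow> bool" where
  "independent_set V E X \<longleftrightarrow> X \<subseteq> V \<and> (\<forall>u\<in>X. \<forall>v\<in>X. {u, v} \<notin> E)"

definition valid_instance :: "nat \<Rightarrow> instance_is \<Rightarrow> bool" where
  "valid_instance d I \<longleftrightarrow> distinct (fst I) \<and>
     (\<forall>(es, l)\<in>set (samples I). simple_graph (vertices I) (edges es)
        \<and> (\<forall>v\<in>vertices I. degree (edges es) v \<le> d))"

definition consistent :: "nat \<Rightarrow> instance_is \<Rightarrow> nat set \<Rightarrow> bool" where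
  "consistent k I X \<longleftrightarrow> X \<subseteq> vertices I \<and> card X = k \<and>
     (\<forall>(es, l)\<in>set (samples I). independent_set (vertices I) (edges es) X \<longleftrightarrow> l)"

definition num_negative :: "instance_is \<Rightarrow> nat" where
  "num_negative I = length (filter (\<lambda>(es, l). \<not> l) (samples I))"

definition enc_edge :: "nat \<times> nat \<Rightarrow> dat" where
  "enc_edge = (\<lambda>(u, v). Node (enc_nat u) (enc_nat v))"

definition enc_sample :: "(nat \<times> nat) list \<times> bool \<Rightarrow> dat" where
  "enc_sample = (\<lambda>(es, l). Node (enc_list enc_edge es) (enc_bool l))"

definition enc_instance :: "instance_is \<Rightarrow> dat" where
  "enc_instance I = Node (enc_list enc_nat (fst I)) (enc_list enc_sample (samples I))"

text \<open>The output \<open>Leaf\<close> reports that there is no solution; a solution \<open>X\<close> is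
  output as \<open>Node Leaf xs\<close> with \<open>xs\<close> the code of a list of the elements of
  \<open>X\<close>.\<close>

definition correct_output :: "nat \<Rightarrow> instance_is \<Rightarrow> dat \<Rightarrow> bool" where
  "correct_output k I y \<longleftrightarrow>
     (\<exists>xs. y = Node Leaf (enc_list enc_nat xs) \<and> consistent k I (set xs))
     \<or> (y = Leaf \<and> (\<nexists>X. consistent k I X))"

definition fpt_algorithm_ConsCheck_IS :: "com \<Rightarrow> bool" where
  "fpt_algorithm_ConsCheck_IS P \<longleftrightarrow> (\<exists>f c. computable f \<and>
     (\<forall>k d I. valid_instance d I \<longrightarrow>
        (\<exists>t y. runs P (Node (enc_nat k) (Node (enc_nat d) (enc_instance I))) t y
           \<and> t \<le> f (k + d + num_negative I) * dsize (enc_instance I) ^ c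
           \<and> correct_output k I y)))"

end

theory Submission
  imports Defs
begin

text \<open>
  One inclusion is trivial. For the other, a weighted circuit satisfiability instance of weft one and
  depth \<open>h\<close> is turned in polynomial time into an independent set instance, each edge of which becomes a
  positive sample of degree one. Distributing the small gates above the large ones, the circuit becomes a
  polynomial disjunction of conjunctions of claims ``gate \<open>g\<close> has value \<open>b\<close>'', where \<open>g\<close> depends on at
  most \<open>2^h\<close> inputs. Write an assignment of weight \<open>k\<close> as an increasing sequence \<open>0 = s_0 < \<dots> < s_(k+1)\<close>;
  two consecutive entries certify that everything in between is false, so that a violated claim is
  already visible on \<open>r = 2^(h+1)\<close> entries of the sequence. The vertices are therefore the \<open>r\<close>-tuples of
  entries (together with a disjunct) on which no violation is visible, and inconsistent tuples are
  adjacent. Independent sets of size \<open>(k+2)^r\<close> correspond to sequences, hence to satisfying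
  assignments.
\<close>

section \<open>Programs as subroutines\<close>

text \<open>Being independent in every one-edge graph is the same as being independent in their
  union, so degree and number of negative samples stay constant and the parameter of the produced
  instance depends on \<open>k\<close> and \<open>h\<close> alone. An edge compares two vertices
  only, whereas refuting a claim about a gate needs several entries of the sequence at once; this is
  why the vertices are tuples and not single entries. The factor two in \<open>r\<close> comes from
  negative inputs, each of which takes two neighbouring entries. Since \<open>h\<close> is fixed by
  the problem, the list of tuples is polynomially long and \<open>(k+2)^r\<close> is bounded in
  \<open>k\<close>. Conjunctions of unbounded length are harmless, because a conjunction fails at
  one conjunct. The other obstacle is the concrete machine model. No program is written for the
  reduction itself: time-bounded functions are shown to be closed under composition, pairing,
  branching and folds, and the reduction is phrased with these operations on total functions. Inputs
  are arbitrary trees, so codes of circuits have to be recognised as well.\<close>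

primrec expr_regs_below :: "nat \<Rightarrow> expr \<Rightarrow> bool" where
  "expr_regs_below N (EVar x) \<longleftrightarrow> x < N"
| "expr_regs_below N ELeaf \<longleftrightarrow> True"
| "expr_regs_below N (ENode a b) \<longleftrightarrow> expr_regs_below N a \<and> expr_regs_below N b"
| "expr_regs_below N (EFst a) \<longleftrightarrow> expr_regs_below N a"
| "expr_regs_below N (ESnd a) \<longleftrightarrow> expr_regs_below N a"
| "expr_regs_below N (EEq a b) \<longleftrightarrow> expr_regs_below N a \<and> expr_regs_below N b"

primrec com_regs_below :: "nat \<Rightarrow> com \<Rightarrow> bool" where
  "com_regs_below N Skip \<longleftrightarrow> True"
| "com_regs_below N (Assign x e) \<longleftrightarrow> x < N \<and> expr_regs_below N e"
| "com_regs_below N (Seq c1 c2) \<longleftrightarrow> com_regs_below N c1 \<and> com_regs_below N c2"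
| "com_regs_below N (Cond e c1 c2) \<longleftrightarrow> expr_regs_below N e \<and> com_regs_below N c1 \<and> com_regs_below N c2"
| "com_regs_below N (While e c) \<longleftrightarrow> expr_regs_below N e \<and> com_regs_below N c"

lemma expr_regs_below_mono: "expr_regs_below N e \<Longrightarrow> N \<le> N' \<Longrightarrow> expr_regs_below N' e"
  by (induction e) auto

lemma com_regs_below_mono: "com_regs_below N c \<Longrightarrow> N \<le> N' \<Longrightarrow> com_regs_below N' c"
  by (induction c) (auto intro: expr_regs_below_mono)

lemma ex_expr_regs_below: "\<exists>N. expr_regs_below N e"
proof (induction e)
  case (ENode a b)
  then obtain N M where "expr_regs_below N a" "expr_regs_below M b" by blast
  then have "expr_regs_below (max N M) (ENode a b)" by (auto intro: expr_regs_below_mono)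
  then show ?case by blast
next
  case (EEq a b)
  then obtain N M where "expr_regs_below N a" "expr_regs_below M b" by blast
  then have "expr_regs_below (max N M) (EEq a b)" by (auto intro: expr_regs_below_mono)
  then show ?case by blast
qed auto

lemma ex_com_regs_below: "\<exists>N. com_regs_below N c"
proof (induction c)
  case (Assign x e)
  obtain N where "expr_regs_below N e" using ex_expr_regs_below by blast
  then have "com_regs_below (max N (Suc x)) (Assign x e)" by (auto intro: expr_regs_below_mono)
  then show ?case by blast
next
  case (Seq c1 c2)
  then obtain N M where "com_regs_below N c1" "com_regs_below M c2" by blast
  then have "com_regs_below (max N M) (Seq c1 c2)" by (auto intro: com_regs_below_mono)
  then show ?case by blast
next
  case (Cond e c1 c2)
  then obtain N M L where "com_regs_below N c1" "com_regs_below M c2" "expr_regs_below L e" using ex_expr_regs_below by blast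
  then have "com_regs_below (max L (max N M)) (Cond e c1 c2)" by (auto intro: com_regs_below_mono expr_regs_below_mono)
  then show ?case by blast
next
  case (While e c)
  then obtain N L where "com_regs_below N c" "expr_regs_below L e" using ex_expr_regs_below by blast
  then have "com_regs_below (max L N) (While e c)" by (auto intro: com_regs_below_mono expr_regs_below_mono)
  then show ?case by blast
qed auto

lemma ex_cbnd2: "\<exists>n. com_regs_below (Suc n) P \<and> com_regs_below (Suc n) Q"
proof -
  obtain N M where "com_regs_below N P" "com_regs_below M Q" using ex_com_regs_below by blast
  then have "com_regs_below (Suc (max N M)) P" "com_regs_below (Suc (max N M)) Q" by (auto intro: com_regs_below_mono)
  then show ?thesis by blast
qed

lemma ex_cbnd3: "\<exists>n. com_regs_below (Suc n) P \<and> com_regs_below (Suc n) Q \<and> com_regs_below (Suc n) R"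
  using ex_cbnd2[of "Seq P Q" R] by auto

section \<open>Frame property, growth of register contents and calls\<close>

lemma eval_ecost_cong:
  "expr_regs_below N e \<Longrightarrow> (\<And>i. i < N \<Longrightarrow> s i = s' i) \<Longrightarrow> eval e s = eval e s' \<and> ecost e s = ecost e s'"
  by (induction e) auto

text \<open>A command reads and writes only the registers that it mentions. Hence it runs in the
  same time from any state that agrees on these, and the remaining registers can hold the data of a
  caller.\<close>

lemma exec_frame:
  "exec c s t s' \<Longrightarrow> com_regs_below N c \<Longrightarrow> (\<And>i. i < N \<Longrightarrow> r i = s i) \<Longrightarrow>
   exec c r t (\<lambda>i. if i < N then s' i else r i)"
proof (induction arbitrary: r rule: exec.induct)
  case (Skip s)
  then have "(\<lambda>i. if i < N then s i else r i) = r" by auto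
  then show ?case using exec.Skip by simp
next
  case (Assign x e s)
  then have e: "eval e r = eval e s" "ecost e r = ecost e s"
    using eval_ecost_cong[of N e r s] by auto
  have "(\<lambda>i. if i < N then (s(x := eval e s)) i else r i) = r(x := eval e r)"
    using Assign e by (auto simp: fun_eq_iff)
  then show ?case using exec.Assign[of x e r] e by simp
next
  case (Seq c1 s t1 s1 c2 t2 s2)
  let ?r = "\<lambda>i. if i < N then s1 i else r i"
  have 1: "exec c1 r t1 ?r" using Seq by simp
  have 2: "exec c2 ?r t2 (\<lambda>i. if i < N then s2 i else ?r i)"
    using Seq.prems by (intro Seq.IH(2)) auto
  have "(\<lambda>i. if i < N then s2 i else ?r i) = (\<lambda>i. if i < N then s2 i else r i)" by auto
  then show ?case using exec.Seq[OF 1 2] by simp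
next
  case (CondTrue e s c1 t s1 c2)
  then have "eval e r = eval e s" "ecost e r = ecost e s"
    using eval_ecost_cong[of N e r s] by auto
  then show ?case using CondTrue exec.CondTrue[of e r c1 t _ c2] by simp
next
  case (CondFalse e s c2 t s1 c1)
  then have "eval e r = eval e s" "ecost e r = ecost e s"
    using eval_ecost_cong[of N e r s] by auto
  then show ?case using CondFalse exec.CondFalse[of e r c2 t _ c1] by simp
next
  case (WhileFalse e s c)
  then have e: "eval e r = eval e s" "ecost e r = ecost e s"
    using eval_ecost_cong[of N e r s] by auto
  have "(\<lambda>i. if i < N then s i else r i) = r" using WhileFalse by auto
  then show ?case using e WhileFalse exec.WhileFalse[of e r c] by simp
next
  case (WhileTrue e s c t1 s1 t2 s2)
  then have e: "eval e r = eval e s" "ecost e r = ecost e s"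
    using eval_ecost_cong[of N e r s] by auto
  let ?r = "\<lambda>i. if i < N then s1 i else r i"
  have 1: "exec c r t1 ?r" using WhileTrue by simp
  have 2: "exec (While e c) ?r t2 (\<lambda>i. if i < N then s2 i else ?r i)"
    using WhileTrue.prems by (intro WhileTrue.IH(2)) auto
  have "(\<lambda>i. if i < N then s2 i else ?r i) = (\<lambda>i. if i < N then s2 i else r i)" by auto
  then show ?case using exec.WhileTrue[OF _ 1 2] e WhileTrue.hyps by simp
qed

lemma dsize_pos: "1 \<le> dsize d"
  by (cases d) auto

lemma dsize_eval_le: "dsize (eval e s) \<le> ecost e s"
  by (cases e) auto

text \<open>An assignment is charged the size of the value that it writes, so contents grow by at
  most the elapsed time. All later bounds on the size of intermediate results come from
  this.\<close>

lemma exec_size: "exec c s t s' \<Longrightarrow> dsize (s' x) \<le> dsize (s x) + t"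
proof (induction rule: exec.induct)
  case (Assign y e s)
  then show ?case using dsize_eval_le[of e s] by simp
next
  case (Seq c1 s t1 s1 c2 t2 s2)
  then show ?case by linarith
next
  case (WhileTrue e s c t1 s1 t2 s2)
  then show ?case by linarith
qed auto

lemma runsI: "exec P ((\<lambda>_. Leaf)(0 := x)) t s \<Longrightarrow> s 0 = y \<Longrightarrow> runs P x t y"
  unfolding runs_def by blast

lemma runs_size: "runs P x t y \<Longrightarrow> dsize y \<le> dsize x + t"
  unfolding runs_def using exec_size[of P _ t _ 0] by fastforce

primrec clear_regs :: "nat \<Rightarrow> com" where
  "clear_regs 0 = Skip"
| "clear_regs (Suc n) = Seq (clear_regs n) (Assign (Suc n) ELeaf)"

lemma exec_clear_regs:
  "exec (clear_regs n) s (1 + 2 * n) (\<lambda>i. if 0 < i \<and> i \<le> n then Leaf else s i)"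
proof (induction n)
  case 0
  have "(\<lambda>i. if 0 < i \<and> i \<le> 0 then Leaf else s i) = s" by auto
  then show ?case using exec.Skip[of s] by simp
next
  case (Suc n)
  let ?r = "\<lambda>i. if 0 < i \<and> i \<le> n then Leaf else s i"
  have "exec (Assign (Suc n) ELeaf) ?r 2 (?r(Suc n := Leaf))"
    using exec.Assign[of "Suc n" ELeaf ?r] by (simp add: numeral_2_eq_2)
  moreover have "?r(Suc n := Leaf) = (\<lambda>i. if 0 < i \<and> i \<le> Suc n then Leaf else s i)"
    by (auto simp: fun_eq_iff)
  ultimately show ?case using exec.Seq[OF Suc, of "Assign (Suc n) ELeaf" 2] by simp
qed

definition call :: "nat \<Rightarrow> com \<Rightarrow> com" where
  "call n P = Seq (clear_regs n) P"

text \<open>Clearing restores the initial state on the registers \<open>0\<close> to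
  \<open>n\<close> with the argument in register 0, so what \<open>runs\<close> guarantees about
  \<open>P\<close> applies; the registers above \<open>n\<close> survive the call.\<close>

lemma exec_call:
  assumes "runs P x t y" "com_regs_below (Suc n) P" "s 0 = x"
  shows "\<exists>s'. exec (call n P) s (1 + 2 * n + t) s' \<and> s' 0 = y \<and> (\<forall>i>n. s' i = s i)"
proof -
  let ?r = "\<lambda>i. if 0 < i \<and> i \<le> n then Leaf else s i"
  obtain s' where s': "exec P ((\<lambda>_. Leaf)(0 := x)) t s'" "s' 0 = y"
    using assms unfolding runs_def by blast
  let ?s' = "\<lambda>i. if i < Suc n then s' i else ?r i"
  have "exec P ?r t ?s'"
    by (rule exec_frame[OF s'(1) assms(2)]) (use assms(3) in auto)
  then have "exec (call n P) s (1 + 2 * n + t) ?s'"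
    unfolding call_def by (rule exec.Seq[OF exec_clear_regs])
  moreover have "?s' 0 = y" "\<forall>i>n. ?s' i = s i" using s'(2) by auto
  ultimately show ?thesis by blast
qed

section \<open>Computing typed functions\<close>

text \<open>A function is computed relative to encodings of its arguments and values. Since an encoding
  need not be injective, it also serves to restrict the inputs on which a program has to halt.\<close>

definition computed_in :: "('a \<Rightarrow> dat) \<Rightarrow> ('b \<Rightarrow> dat) \<Rightarrow> ('a \<Rightarrow> 'b) \<Rightarrow> ('a \<Rightarrow> nat) \<Rightarrow> bool" where
  "computed_in A B f T \<longleftrightarrow> (\<exists>P. \<forall>x. \<exists>t\<le>T x. runs P (A x) t (B (f x)))"

definition enc_pair :: "('a \<Rightarrow> dat) \<Rightarrow> ('b \<Rightarrow> dat) \<Rightarrow> 'a \<times> 'b \<Rightarrow> dat" (infixr "\<otimes>" 75) where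
  "(A \<otimes> B) p = Node (A (fst p)) (B (snd p))"

lemma computed_in_mono: "computed_in A B f T \<Longrightarrow> (\<And>x. T x \<le> T' x) \<Longrightarrow> computed_in A B f T'"
  unfolding computed_in_def using order_trans by meson

lemma computed_in_recode: "computed_in A B f T \<Longrightarrow> (\<And>x. B (f x) = C (g x)) \<Longrightarrow> computed_in A C g T"
  unfolding computed_in_def by simp

lemma computed_in_size:
  assumes "computed_in A B f T"
  shows "dsize (B (f x)) \<le> dsize (A x) + T x"
proof -
  obtain P where "\<forall>x. \<exists>t\<le>T x. runs P (A x) t (B (f x))" using assms unfolding computed_in_def by blast
  then obtain t where "t \<le> T x" "runs P (A x) t (B (f x))" by blast
  then show ?thesis using runs_size[of P "A x" t] by fastforce
qed

lemma computed_in_expr: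
  assumes "\<And>x. eval e ((\<lambda>_. Leaf)(0 := A x)) = B (f x)"
  shows "computed_in A B f (\<lambda>x. 1 + ecost e ((\<lambda>_. Leaf)(0 := A x)))"
  unfolding computed_in_def runs_def
proof (intro exI allI conjI)
  fix x
  let ?s = "(\<lambda>_. Leaf)(0 := A x)"
  show "exec (Assign 0 e) ?s (1 + ecost e ?s) (?s(0 := eval e ?s))" by (rule exec.Assign)
qed (use assms in auto)

section \<open>Sequencing, pairing, branching and folding with explicit running times\<close>

lemma computed_in_comp:
  assumes "computed_in A B f Tf" "computed_in B C g Tg"
  shows "\<exists>c. computed_in A C (\<lambda>x. g (f x)) (\<lambda>x. Tf x + Tg (f x) + c)"
proof -
  obtain P Q where P: "\<forall>x. \<exists>t\<le>Tf x. runs P (A x) t (B (f x))"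
    and Q: "\<forall>x. \<exists>t\<le>Tg x. runs Q (B x) t (C (g x))" using assms unfolding computed_in_def by blast
  obtain n where n: "com_regs_below (Suc n) P" "com_regs_below (Suc n) Q" using ex_cbnd2 by blast
  have "\<exists>t\<le>Tf x + Tg (f x) + (1 + 2 * n). runs (Seq P (call n Q)) (A x) t (C (g (f x)))" for x
  proof -
    obtain t where t: "t \<le> Tf x" "runs P (A x) t (B (f x))" using P by blast
    obtain u where u: "u \<le> Tg (f x)" "runs Q (B (f x)) u (C (g (f x)))" using Q by blast
    from t obtain s where s: "exec P ((\<lambda>_. Leaf)(0 := A x)) t s" "s 0 = B (f x)"
      unfolding runs_def by blast
    obtain s' where
      s': "exec (call n Q) s (1 + 2 * n + u) s'" "s' 0 = C (g (f x))"
      using exec_call[OF u(2) n(2), of s] s(2) by blast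
    have "runs (Seq P (call n Q)) (A x) (t + (1 + 2 * n + u)) (C (g (f x)))"
      unfolding runs_def using exec.Seq[OF s(1) s'(1)] s'(2) by blast
    moreover have "t + (1 + 2 * n + u) \<le> Tf x + Tg (f x) + (1 + 2 * n)" using t u by simp
    ultimately show ?thesis by blast
  qed
  then show ?thesis unfolding computed_in_def by blast
qed

lemma computed_in_pair:
  assumes "computed_in A B f Tf" "computed_in A C g Tg"
  shows "\<exists>c. computed_in A (B \<otimes> C) (\<lambda>x. (f x, g x)) (\<lambda>x. c * (dsize (A x) + Tf x + Tg x))"
proof -
  obtain P Q where P: "\<forall>x. \<exists>t\<le>Tf x. runs P (A x) t (B (f x))"
    and Q: "\<forall>x. \<exists>t\<le>Tg x. runs Q (A x) t (C (g x))" using assms unfolding computed_in_def by blast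
  obtain n where n: "com_regs_below (Suc n) P" "com_regs_below (Suc n) Q" using ex_cbnd2 by blast
  define R where "R = Seq (Assign (n+1) (EVar 0)) (Seq (call n P) (Seq (Assign (n+2) (EVar 0))
    (Seq (Assign 0 (EVar (n+1))) (Seq (call n Q) (Assign 0 (ENode (EVar (n+2)) (EVar 0)))))))"
  have "\<exists>t\<le>(4 * n + 20) * (dsize (A x) + Tf x + Tg x). runs R (A x) t ((B \<otimes> C) (f x, g x))" for x
  proof -
    obtain t where t: "t \<le> Tf x" "runs P (A x) t (B (f x))" using P by blast
    obtain u where u: "u \<le> Tg x" "runs Q (A x) u (C (g x))" using Q by blast
    let ?s = "(\<lambda>_. Leaf)(0 := A x)"
    have 1: "exec (Assign (n+1) (EVar 0)) ?s (1 + dsize (A x)) (?s(n+1 := A x))"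
      using exec.Assign[of "n+1" "EVar 0" ?s] by simp
    obtain s2 where 2: "exec (call n P) (?s(n+1 := A x)) (1 + 2 * n + t) s2"
      and s2: "s2 0 = B (f x)" "\<forall>i>n. s2 i = (?s(n+1 := A x)) i"
      using exec_call[OF t(2) n(1), of "?s(n+1 := A x)"] by auto
    let ?s3 = "s2(n+2 := B (f x))"
    have 3: "exec (Assign (n+2) (EVar 0)) s2 (1 + dsize (B (f x))) ?s3"
      using exec.Assign[of "n+2" "EVar 0" s2] s2 by simp
    let ?s4 = "?s3(0 := A x)"
    have 4: "exec (Assign 0 (EVar (n+1))) ?s3 (1 + dsize (A x)) ?s4"
      using exec.Assign[of 0 "EVar (n+1)" ?s3] s2 by simp
    obtain s5 where 5: "exec (call n Q) ?s4 (1 + 2 * n + u) s5"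
      and s5: "s5 0 = C (g x)" "\<forall>i>n. s5 i = ?s4 i"
      using exec_call[OF u(2) n(2), of ?s4] by auto
    let ?y = "dsize (B (f x))" and ?z = "dsize (C (g x))"
    have 6: "exec (Assign 0 (ENode (EVar (n+2)) (EVar 0))) s5 (2 + 2 * ?y + 2 * ?z)
        (s5(0 := (B \<otimes> C) (f x, g x)))"
      using exec.Assign[of 0 "ENode (EVar (n+2)) (EVar 0)" s5] s5
      by (simp add: enc_pair_def mult_2 ac_simps)
    have "exec R ?s ((1 + dsize (A x)) + ((1 + 2 * n + t) + ((1 + ?y) + ((1 + dsize (A x)) +
        ((1 + 2 * n + u) + (2 + 2 * ?y + 2 * ?z)))))) (s5(0 := (B \<otimes> C) (f x, g x)))" (is "exec R ?s ?t _")
      unfolding R_def by (intro exec.Seq[OF 1] exec.Seq[OF 2] exec.Seq[OF 3] exec.Seq[OF 4] exec.Seq[OF 5] 6)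
    then have "runs R (A x) ?t ((B \<otimes> C) (f x, g x))" by (rule runsI) simp
    moreover have "?t \<le> (4 * n + 20) * (dsize (A x) + Tf x + Tg x)"
    proof -
      \<comment> \<open>Copying the two results costs their sizes, and these are bounded by the
        input size plus the time spent on producing them.\<close>
      have "?y \<le> dsize (A x) + t" "?z \<le> dsize (A x) + u"
        using runs_size t u by blast+
      then have "?t \<le> 4 * n + (7 + 7 * dsize (A x) + 4 * t + 3 * u)" by simp
      also have "\<dots> \<le> 4 * n * dsize (A x) + 20 * (dsize (A x) + Tf x + Tg x)"
        using t u dsize_pos[of "A x"] by (intro add_mono) auto
      also have "\<dots> \<le> (4 * n + 20) * (dsize (A x) + Tf x + Tg x)" by (simp add: algebra_simps)
      finally show ?thesis .
    qed
    ultimately show ?thesis by blast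
  qed
  then show ?thesis unfolding computed_in_def by blast
qed

lemma computed_in_if:
  assumes "computed_in A enc_bool b Tb" "computed_in A B f Tf" "computed_in A B g Tg"
  shows "\<exists>c. computed_in A B (\<lambda>x. if b x then f x else g x) (\<lambda>x. c * (dsize (A x) + Tb x + Tf x + Tg x))"
proof -
  obtain P Q R where P: "\<forall>x. \<exists>t\<le>Tb x. runs P (A x) t (enc_bool (b x))"
    and Q: "\<forall>x. \<exists>t\<le>Tf x. runs Q (A x) t (B (f x))"
    and R: "\<forall>x. \<exists>t\<le>Tg x. runs R (A x) t (B (g x))" using assms unfolding computed_in_def by blast
  obtain n where n: "com_regs_below (Suc n) P" "com_regs_below (Suc n) Q" "com_regs_below (Suc n) R" using ex_cbnd3 by blast
  define D where "D = Seq (Assign (n+1) (EVar 0)) (Seq (call n P) (Cond (EVar 0)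
    (Seq (Assign 0 (EVar (n+1))) (call n Q)) (Seq (Assign 0 (EVar (n+1))) (call n R))))"
  have "\<exists>t\<le>(4 * n + 20) * (dsize (A x) + Tb x + Tf x + Tg x).
      runs D (A x) t (B (if b x then f x else g x))" for x
  proof -
    obtain t where t: "t \<le> Tb x" "runs P (A x) t (enc_bool (b x))" using P by blast
    obtain u where u: "u \<le> Tf x" "runs Q (A x) u (B (f x))" using Q by blast
    obtain v where v: "v \<le> Tg x" "runs R (A x) v (B (g x))" using R by blast
    let ?s = "(\<lambda>_. Leaf)(0 := A x)"
    have 1: "exec (Assign (n+1) (EVar 0)) ?s (1 + dsize (A x)) (?s(n+1 := A x))"
      using exec.Assign[of "n+1" "EVar 0" ?s] by simp
    obtain s2 where 2: "exec (call n P) (?s(n+1 := A x)) (1 + 2 * n + t) s2"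
      and s2: "s2 0 = enc_bool (b x)" "\<forall>i>n. s2 i = (?s(n+1 := A x)) i"
      using exec_call[OF t(2) n(1), of "?s(n+1 := A x)"] by auto
    let ?s3 = "s2(0 := A x)"
    have 3: "exec (Assign 0 (EVar (n+1))) s2 (1 + dsize (A x)) ?s3"
      using exec.Assign[of 0 "EVar (n+1)" s2] s2 by simp
    obtain s4 where 4: "exec (call n Q) ?s3 (1 + 2 * n + u) s4" "s4 0 = B (f x)"
      using exec_call[OF u(2) n(2), of ?s3] by auto
    obtain s5 where 5: "exec (call n R) ?s3 (1 + 2 * n + v) s5" "s5 0 = B (g x)"
      using exec_call[OF v(2) n(3), of ?s3] by auto
    obtain w s6 where 6: "exec (Cond (EVar 0) (Seq (Assign 0 (EVar (n+1))) (call n Q))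
        (Seq (Assign 0 (EVar (n+1))) (call n R))) s2 w s6" "s6 0 = B (if b x then f x else g x)"
      "w \<le> 6 + dsize (A x) + 2 * n + u + v"
    proof (cases "b x")
      case True
      have "exec (Cond (EVar 0) (Seq (Assign 0 (EVar (n+1))) (call n Q))
        (Seq (Assign 0 (EVar (n+1))) (call n R))) s2 (1 + 3 + ((1 + dsize (A x)) + (1 + 2 * n + u))) s4"
        using exec.CondTrue[of "EVar 0" s2, OF _ exec.Seq[OF 3 4(1)]] s2 True by (simp add: eval_nat_numeral)
      then show ?thesis using that 4 True by simp
    next
      case False
      have "exec (Cond (EVar 0) (Seq (Assign 0 (EVar (n+1))) (call n Q))
        (Seq (Assign 0 (EVar (n+1))) (call n R))) s2 (1 + 1 + ((1 + dsize (A x)) + (1 + 2 * n + v))) s5"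
        using exec.CondFalse[of "EVar 0" s2, OF _ exec.Seq[OF 3 5(1)]] s2 False by (simp add: eval_nat_numeral)
      then show ?thesis using that 5 False by simp
    qed
    have "exec D ?s ((1 + dsize (A x)) + ((1 + 2 * n + t) + w)) s6" (is "exec D ?s ?t _")
      unfolding D_def by (intro exec.Seq[OF 1] exec.Seq[OF 2] 6)
    then have "runs D (A x) ?t (B (if b x then f x else g x))"
      using 6(2) by (rule runsI)
    moreover have "?t \<le> (4 * n + 20) * (dsize (A x) + Tb x + Tf x + Tg x)"
    proof -
      have "?t \<le> 4 * n + (8 + 2 * dsize (A x) + t + u + v)" using 6(3) by simp
      also have "\<dots> \<le> 4 * n * dsize (A x) + 20 * (dsize (A x) + Tb x + Tf x + Tg x)"
        using t u v dsize_pos[of "A x"] by (intro add_mono) auto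
      also have "\<dots> \<le> (4 * n + 20) * (dsize (A x) + Tb x + Tf x + Tg x)" by (simp add: algebra_simps)
      finally show ?thesis .
    qed
    ultimately show ?thesis by blast
  qed
  then show ?thesis unfolding computed_in_def by blast
qed

text \<open>Register \<open>n+1\<close> keeps the parameter, \<open>n+2\<close> the unread part of
  the list and \<open>n+3\<close> the accumulator; each round packs them into register 0 for a call.
  The bounds \<open>M\<close> and \<open>\<tau>\<close> are required only for the accumulators that
  really occur, namely those of the prefixes \<open>take i l\<close>.\<close>

lemma fold_loop:
  assumes P: "\<forall>x. \<exists>t\<le>Tg x. runs P ((E \<otimes> A \<otimes> B) x) t (B (g (fst x) (snd (snd x)) (fst (snd x))))"
    and n: "com_regs_below (Suc n) P"
    and bnd: "\<forall>i\<le>length l. dsize (B (foldl (g e) b (take i l))) \<le> M"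
      "\<forall>i<length l. Tg (e, l ! i, foldl (g e) b (take i l)) \<le> \<tau>"
      "dsize (E e) \<le> M" "dsize (enc_list A l) \<le> M"
    and s: "s (n+1) = E e" "s (n+2) = enc_list A l" "s (n+3) = B b"
  shows "\<exists>t s'. t \<le> (length l + 1) * ((2 * n + 30) * (M + \<tau>)) \<and> s' (n+3) = B (foldl (g e) b l) \<and>
    exec (While (EVar (n+2)) (Seq (Assign 0 (ENode (EVar (n+1)) (ENode (EFst (EVar (n+2))) (EVar (n+3)))))
      (Seq (call n P) (Seq (Assign (n+3) (EVar 0)) (Assign (n+2) (ESnd (EVar (n+2)))))))) s t s'"
    (is "\<exists>t s'. _ \<and> _ \<and> exec (While _ (Seq ?c1 (Seq _ (Seq ?c3 ?c4)))) s t s'")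
  using bnd s
proof (induction l arbitrary: b s)
  case Nil
  let ?W = "While (EVar (n+2)) (Seq ?c1 (Seq (call n P) (Seq ?c3 ?c4)))"
  have "exec ?W s 2 s"
    using exec.WhileFalse[of "EVar (n+2)" s] Nil by (simp add: eval_nat_numeral)
  moreover have "2 \<le> (length [] + 1) * ((2 * n + 30) * (M + \<tau>))"
  proof -
    have "1 \<le> M" using Nil dsize_pos order_trans by blast
    then have "2 * 1 \<le> (2 * n + 30) * (M + \<tau>)" by (intro mult_mono) auto
    then show ?thesis by simp
  qed
  ultimately show ?case using Nil by (intro exI conjI) auto
next
  case (Cons a l)
  let ?W = "While (EVar (n+2)) (Seq ?c1 (Seq (call n P) (Seq ?c3 ?c4)))"
  let ?x = "(e, a, b)"
  \<comment> \<open>The triple for the call lists the parameter, the next element and the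
    accumulator in this order, matching the projections in the assumption on
    \<open>P\<close>.\<close>
  obtain t where t: "t \<le> Tg ?x" "runs P ((E \<otimes> A \<otimes> B) ?x) t (B (g e b a))"
    using P[rule_format, of ?x] by auto
  have t\<tau>: "t \<le> \<tau>" using t Cons.prems(2)[rule_format, of 0] by simp
  have M1: "1 \<le> M" using Cons.prems(3) dsize_pos order_trans by blast
  have sz: "dsize (B b) \<le> M" "dsize (B (g e b a)) \<le> M" "dsize (A a) + dsize (enc_list A l) < M"
    using Cons.prems(1)[rule_format, of 0] Cons.prems(1)[rule_format, of 1] Cons.prems(4) by auto
  let ?s1 = "s(0 := (E \<otimes> A \<otimes> B) ?x)"
  let ?t1 = "1 + ecost (ENode (EVar (n+1)) (ENode (EFst (EVar (n+2))) (EVar (n+3)))) s"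
  have 1: "exec ?c1 s ?t1 ?s1"
    using exec.Assign[of 0 "ENode (EVar (n+1)) (ENode (EFst (EVar (n+2))) (EVar (n+3)))" s] Cons.prems
    by (simp add: enc_pair_def del: ecost.simps)
  have t1: "?t1 \<le> 12 * M" using Cons.prems(3-7) sz M1 by simp
  obtain s2 where 2: "exec (call n P) ?s1 (1 + 2 * n + t) s2"
      and s2: "s2 0 = B (g e b a)" "\<forall>i>n. s2 i = ?s1 i"
    using exec_call[OF t(2) n, of ?s1] by auto
  let ?s3 = "s2(n+3 := B (g e b a))"
  have 3: "exec ?c3 s2 (1 + dsize (B (g e b a))) ?s3"
    using exec.Assign[of "n+3" "EVar 0" s2] s2 by simp
  let ?s4 = "?s3(n+2 := enc_list A l)"
  let ?t4 = "1 + ecost (ESnd (EVar (n+2))) ?s3"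
  have s3: "?s3 (n+2) = Node (A a) (enc_list A l)" using s2 Cons.prems by simp
  have 4: "exec ?c4 ?s3 ?t4 ?s4"
    using exec.Assign[of "n+2" "ESnd (EVar (n+2))" ?s3] s3 by (simp del: ecost.simps)
  have t4: "?t4 \<le> 3 * M" using Cons.prems(4) sz s3 M1 by simp
  have body: "exec (Seq ?c1 (Seq (call n P) (Seq ?c3 ?c4))) s
      (?t1 + ((1 + 2 * n + t) + ((1 + dsize (B (g e b a))) + ?t4))) ?s4" (is "exec _ s ?tb _")
    by (intro exec.Seq[OF 1] exec.Seq[OF 2] exec.Seq[OF 3] 4)
  have "\<exists>t s'. t \<le> (length l + 1) * ((2 * n + 30) * (M + \<tau>)) \<and>
      s' (n+3) = B (foldl (g e) (g e b a) l) \<and> exec ?W ?s4 t s'"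
  proof (rule Cons.IH)
    show "\<forall>i\<le>length l. dsize (B (foldl (g e) (g e b a) (take i l))) \<le> M"
      using Cons.prems(1) by (auto dest: spec[of _ "Suc _"])
    show "\<forall>i<length l. Tg (e, l ! i, foldl (g e) (g e b a) (take i l)) \<le> \<tau>"
      using Cons.prems(2) by (auto dest: spec[of _ "Suc _"])
  qed (use Cons.prems s2 sz in auto)
  then obtain u s' where u: "u \<le> (length l + 1) * ((2 * n + 30) * (M + \<tau>))"
    "s' (n+3) = B (foldl (g e) (g e b a) l)" "exec ?W ?s4 u s'" by blast
  have "exec ?W s (1 + ecost (EVar (n+2)) s + ?tb + u) s'"
    by (rule exec.WhileTrue[OF _ body u(3)]) (use Cons.prems in simp)
  moreover have "1 + ecost (EVar (n+2)) s + ?tb + u \<le> (length (a # l) + 1) * ((2 * n + 30) * (M + \<tau>))"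
  proof -
    have "ecost (EVar (n+2)) s \<le> M" using Cons.prems by simp
    then have "1 + ecost (EVar (n+2)) s + ?tb \<le> 3 + 2 * n + 17 * M + \<tau>"
      using t1 t4 t\<tau> sz by linarith
    also have "\<dots> \<le> (2 * n) * (M + \<tau>) + 30 * (M + \<tau>)"
    proof -
      have "2 * n * 1 \<le> 2 * n * (M + \<tau>)" using M1 by (intro mult_mono) auto
      moreover have "3 + 17 * M + \<tau> \<le> 30 * (M + \<tau>)" using M1 by simp
      ultimately show ?thesis by linarith
    qed
    also have "\<dots> = (2 * n + 30) * (M + \<tau>)" by (simp add: algebra_simps)
    finally show ?thesis using u(1) by simp
  qed
  ultimately show ?case using u(2) by (intro exI conjI) auto
qed

text \<open>The program and the constant are chosen before the data and before the bounds. This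
  uniform form serves both versions of the fold rule: with polynomial \<open>M\<close> and
  \<open>\<tau>\<close>, and with bounds read off from the run when only termination
  matters.\<close>

lemma computed_in_foldl:
  assumes "computed_in (E \<otimes> A \<otimes> B) B (\<lambda>p. g (fst p) (snd (snd p)) (fst (snd p))) Tg"
  shows "\<exists>P c. \<forall>e l b M \<tau>. (\<forall>i\<le>length l. dsize (B (foldl (g e) b (take i l))) \<le> M) \<longrightarrow>
      (\<forall>i<length l. Tg (e, l ! i, foldl (g e) b (take i l)) \<le> \<tau>) \<longrightarrow>
      dsize (E e) \<le> M \<longrightarrow> dsize (enc_list A l) \<le> M \<longrightarrow>
      (\<exists>t \<le> c * ((length l + 1) * (M + \<tau>)).
         runs P ((E \<otimes> enc_list A \<otimes> B) (e, l, b)) t (B (foldl (g e) b l)))"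
proof -
  obtain P where P: "\<forall>x. \<exists>t\<le>Tg x. runs P ((E \<otimes> A \<otimes> B) x) t (B (g (fst x) (snd (snd x)) (fst (snd x))))"
    using assms unfolding computed_in_def by blast
  obtain n where n: "com_regs_below (Suc n) P" using ex_cbnd2 by blast
  define W where "W = While (EVar (n+2)) (Seq (Assign 0 (ENode (EVar (n+1)) (ENode (EFst (EVar (n+2))) (EVar (n+3)))))
      (Seq (call n P) (Seq (Assign (n+3) (EVar 0)) (Assign (n+2) (ESnd (EVar (n+2)))))))"
  define R where "R = Seq (Assign (n+1) (EFst (EVar 0))) (Seq (Assign (n+2) (EFst (ESnd (EVar 0))))
    (Seq (Assign (n+3) (ESnd (ESnd (EVar 0)))) (Seq W (Assign 0 (EVar (n+3))))))"
  have "\<exists>t \<le> (2 * n + 60) * ((length l + 1) * (M + \<tau>)).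
         runs R ((E \<otimes> enc_list A \<otimes> B) (e, l, b)) t (B (foldl (g e) b l))"
    if bnd: "\<forall>i\<le>length l. dsize (B (foldl (g e) b (take i l))) \<le> M"
      "\<forall>i<length l. Tg (e, l ! i, foldl (g e) b (take i l)) \<le> \<tau>"
      "dsize (E e) \<le> M" "dsize (enc_list A l) \<le> M" for e l b M \<tau>
  proof -
    define x where "x = (E \<otimes> enc_list A \<otimes> B) (e, l, b)"
    have x: "x = Node (E e) (Node (enc_list A l) (B b))" by (simp add: x_def enc_pair_def)
    let ?s = "(\<lambda>_. Leaf)(0 := x)"
    let ?s1 = "?s(n+1 := E e)"
    let ?s2 = "?s1(n+2 := enc_list A l)"
    let ?s3 = "?s2(n+3 := B b)"
    let ?t1 = "1 + ecost (EFst (EVar 0)) ?s"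
    let ?t2 = "1 + ecost (EFst (ESnd (EVar 0))) ?s1"
    let ?t3 = "1 + ecost (ESnd (ESnd (EVar 0))) ?s2"
    have 1: "exec (Assign (n+1) (EFst (EVar 0))) ?s ?t1 ?s1"
      using exec.Assign[of "n+1" "EFst (EVar 0)" ?s] x by (simp del: ecost.simps)
    have 2: "exec (Assign (n+2) (EFst (ESnd (EVar 0)))) ?s1 ?t2 ?s2"
      using exec.Assign[of "n+2" "EFst (ESnd (EVar 0))" ?s1] x by (simp del: ecost.simps)
    have 3: "exec (Assign (n+3) (ESnd (ESnd (EVar 0)))) ?s2 ?t3 ?s3"
      using exec.Assign[of "n+3" "ESnd (ESnd (EVar 0))" ?s2] x by (simp del: ecost.simps)
    obtain t s' where t: "t \<le> (length l + 1) * ((2 * n + 30) * (M + \<tau>))"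
      "s' (n+3) = B (foldl (g e) b l)" and 4: "exec W ?s3 t s'"
      using fold_loop[OF P n bnd, of ?s3] unfolding W_def by auto
    have 5: "exec (Assign 0 (EVar (n+3))) s' (1 + dsize (B (foldl (g e) b l))) (s'(0 := B (foldl (g e) b l)))"
      using exec.Assign[of 0 "EVar (n+3)" s'] t(2) by simp
    have "exec R ?s (?t1 + (?t2 + (?t3 + (t + (1 + dsize (B (foldl (g e) b l))))))) (s'(0 := B (foldl (g e) b l)))"
      (is "exec R ?s ?t _")
      unfolding R_def by (intro exec.Seq[OF 1] exec.Seq[OF 2] exec.Seq[OF 3] exec.Seq[OF 4] 5)
    then have "runs R x ?t (B (foldl (g e) b l))" by (rule runsI) simp
    moreover have "?t \<le> (2 * n + 60) * ((length l + 1) * (M + \<tau>))"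
    proof -
      have M1: "1 \<le> M" using bnd(3) dsize_pos order_trans by blast
      have "dsize (B b) \<le> M" "dsize (B (foldl (g e) b l)) \<le> M"
        using bnd(1)[rule_format, of 0] bnd(1)[rule_format, of "length l"] by auto
      then have "?t \<le> 30 * M + t" using bnd(3,4) M1 x by simp
      also have "\<dots> \<le> 30 * ((length l + 1) * (M + \<tau>)) + (length l + 1) * ((2 * n + 30) * (M + \<tau>))"
        using t(1) by (intro add_mono mult_left_mono) auto
      also have "\<dots> = (2 * n + 60) * ((length l + 1) * (M + \<tau>))" by (simp add: algebra_simps)
      finally show ?thesis .
    qed
    ultimately show ?thesis unfolding x_def by blast
  qed
  then show ?thesis by blast
qed

section \<open>Polynomial time\<close>

text \<open>One number serves as coefficient and as exponent, which loses no generality because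
  every code has size at least one.\<close>

definition poly_bounded :: "('a \<Rightarrow> dat) \<Rightarrow> ('a \<Rightarrow> nat) \<Rightarrow> bool" where
  "poly_bounded A T \<longleftrightarrow> (\<exists>c. \<forall>x. T x \<le> c * dsize (A x) ^ c)"

definition polytime :: "('a \<Rightarrow> dat) \<Rightarrow> ('b \<Rightarrow> dat) \<Rightarrow> ('a \<Rightarrow> 'b) \<Rightarrow> bool" where
  "polytime A B f \<longleftrightarrow> (\<exists>T. poly_bounded A T \<and> computed_in A B f T)"

lemma poly_bounded_mono: "poly_bounded A T \<Longrightarrow> (\<And>x. T' x \<le> T x) \<Longrightarrow> poly_bounded A T'"
  unfolding poly_bounded_def using order_trans by meson

lemma poly_bounded_const: "poly_bounded A (\<lambda>_. n)"
  unfolding poly_bounded_def using dsize_pos by (intro exI[of _ n]) auto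

lemma poly_bounded_size: "poly_bounded A (\<lambda>x. dsize (A x))"
  unfolding poly_bounded_def by (intro exI[of _ 1]) auto

lemma poly_bounded_add:
  assumes "poly_bounded A S" "poly_bounded A T"
  shows "poly_bounded A (\<lambda>x. S x + T x)"
proof -
  obtain c d where c: "\<forall>x. S x \<le> c * dsize (A x) ^ c" and d: "\<forall>x. T x \<le> d * dsize (A x) ^ d"
    using assms unfolding poly_bounded_def by blast
  have "S x + T x \<le> (c + d) * dsize (A x) ^ (c + d)" for x
  proof -
    have "S x + T x \<le> c * dsize (A x) ^ c + d * dsize (A x) ^ d" using c d add_mono by blast
    also have "\<dots> \<le> c * dsize (A x) ^ (c + d) + d * dsize (A x) ^ (c + d)"
      using dsize_pos[of "A x"] by (intro add_mono mult_left_mono power_increasing) auto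
    finally show ?thesis by (simp add: algebra_simps)
  qed
  then show ?thesis unfolding poly_bounded_def by blast
qed

lemma poly_bounded_mult:
  assumes "poly_bounded A S" "poly_bounded A T"
  shows "poly_bounded A (\<lambda>x. S x * T x)"
proof -
  obtain c d where c: "\<forall>x. S x \<le> c * dsize (A x) ^ c" and d: "\<forall>x. T x \<le> d * dsize (A x) ^ d"
    using assms unfolding poly_bounded_def by blast
  have "S x * T x \<le> (c * d + c + d) * dsize (A x) ^ (c * d + c + d)" for x
  proof -
    have "S x * T x \<le> (c * dsize (A x) ^ c) * (d * dsize (A x) ^ d)" using c d mult_mono by blast
    also have "\<dots> = c * d * dsize (A x) ^ (c + d)" by (simp add: power_add)
    also have "\<dots> \<le> (c * d + c + d) * dsize (A x) ^ (c * d + c + d)"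
      using dsize_pos[of "A x"] by (intro mult_mono power_increasing) auto
    finally show ?thesis .
  qed
  then show ?thesis unfolding poly_bounded_def by blast
qed

lemma poly_bounded_power: "poly_bounded A S \<Longrightarrow> poly_bounded A (\<lambda>x. S x ^ n)"
  by (induction n) (auto intro: poly_bounded_const poly_bounded_mult)

lemma poly_bounded_comp:
  assumes "poly_bounded B T" "poly_bounded A (\<lambda>x. dsize (B (f x)))"
  shows "poly_bounded A (\<lambda>x. T (f x))"
proof -
  obtain c where c: "\<forall>x. T x \<le> c * dsize (B x) ^ c" using assms unfolding poly_bounded_def by blast
  show ?thesis
    by (rule poly_bounded_mono[of _ "\<lambda>x. c * dsize (B (f x)) ^ c"])
      (use c assms in \<open>auto intro!: poly_bounded_mult poly_bounded_const poly_bounded_power\<close>)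
qed

text \<open>Passing to a code that carries additional data only enlarges the input against which the
  bound is measured.\<close>

lemma poly_bounded_dom: "poly_bounded A T \<Longrightarrow> (\<And>x. dsize (A x) \<le> dsize (B x)) \<Longrightarrow> poly_bounded B T"
  unfolding poly_bounded_def
proof (elim exE, intro exI allI)
  fix c x
  assume "\<forall>x. T x \<le> c * dsize (A x) ^ c" and le: "\<And>x. dsize (A x) \<le> dsize (B x)"
  then have "T x \<le> c * dsize (A x) ^ c" by blast
  also have "\<dots> \<le> c * dsize (B x) ^ c" using le by (intro mult_left_mono power_mono) auto
  finally show "T x \<le> c * dsize (B x) ^ c" .
qed

lemmas poly_bounded_intros = poly_bounded_add poly_bounded_mult poly_bounded_const poly_bounded_size poly_bounded_power

lemma polytime_size: "polytime A B f \<Longrightarrow> poly_bounded A (\<lambda>x. dsize (B (f x)))"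
  unfolding polytime_def by (elim exE conjE, rule poly_bounded_mono[rotated], erule computed_in_size) (intro poly_bounded_intros)

lemma polytime_recode: "polytime A B f \<Longrightarrow> (\<And>x. B (f x) = C (g x)) \<Longrightarrow> polytime A C g"
  unfolding polytime_def using computed_in_recode by metis

lemma polytime_comp:
  assumes "polytime A B f" "polytime B C g"
  shows "polytime A C (\<lambda>x. g (f x))"
proof -
  obtain S T where S: "poly_bounded A S" "computed_in A B f S" and T: "poly_bounded B T" "computed_in B C g T"
    using assms unfolding polytime_def by blast
  from computed_in_comp[OF S(2) T(2)] obtain c where
    c: "computed_in A C (\<lambda>x. g (f x)) (\<lambda>x. S x + T (f x) + c)" by blast
  have "poly_bounded A (\<lambda>x. S x + T (f x) + c)"
    by (intro poly_bounded_intros S poly_bounded_comp[OF T(1)] polytime_size[OF assms(1)])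
  then show ?thesis unfolding polytime_def using c by blast
qed

lemma polytime_pair:
  assumes "polytime A B f" "polytime A C g"
  shows "polytime A (B \<otimes> C) (\<lambda>x. (f x, g x))"
proof -
  obtain S T where S: "poly_bounded A S" "computed_in A B f S" and T: "poly_bounded A T" "computed_in A C g T"
    using assms unfolding polytime_def by blast
  from computed_in_pair[OF S(2) T(2)] obtain c where
    c: "computed_in A (B \<otimes> C) (\<lambda>x. (f x, g x)) (\<lambda>x. c * (dsize (A x) + S x + T x))" by blast
  have "poly_bounded A (\<lambda>x. c * (dsize (A x) + S x + T x))" by (intro poly_bounded_intros S T)
  then show ?thesis unfolding polytime_def using c by blast
qed

lemma polytime_if:
  assumes "polytime A enc_bool b" "polytime A B f" "polytime A B g"
  shows "polytime A B (\<lambda>x. if b x then f x else g x)"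
proof -
  obtain R S T where R: "poly_bounded A R" "computed_in A enc_bool b R" and S: "poly_bounded A S" "computed_in A B f S"
    and T: "poly_bounded A T" "computed_in A B g T"
    using assms unfolding polytime_def by blast
  from computed_in_if[OF R(2) S(2) T(2)] obtain c where
    c: "computed_in A B (\<lambda>x. if b x then f x else g x) (\<lambda>x. c * (dsize (A x) + R x + S x + T x))" by blast
  have "poly_bounded A (\<lambda>x. c * (dsize (A x) + R x + S x + T x))" by (intro poly_bounded_intros R S T)
  then show ?thesis unfolding polytime_def using c by blast
qed

text \<open>Each constructor enlarges the cost bound by at most a constant factor, so the final
  constant depends on the expression only; it is independent of the state.\<close>

lemma ecost_linear: "\<exists>c. \<forall>s M. (\<forall>i. dsize (s i) \<le> M) \<longrightarrow> ecost e s \<le> c * M"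
proof (induction e)
  case (EVar x)
  then show ?case by (intro exI[of _ 1]) auto
next
  case ELeaf
  then show ?case using dsize_pos order_trans by (intro exI[of _ 1]) fastforce
next
  case (ENode a b)
  then obtain c d where c: "\<forall>s M. (\<forall>i. dsize (s i) \<le> M) \<longrightarrow> ecost a s \<le> c * M"
    and d: "\<forall>s M. (\<forall>i. dsize (s i) \<le> M) \<longrightarrow> ecost b s \<le> d * M" by blast
  have "ecost (ENode a b) s \<le> (2 * c + 2 * d + 1) * M" if "\<forall>i. dsize (s i) \<le> M" for s M
  proof -
    have "ecost a s \<le> c * M" "ecost b s \<le> d * M" using c d that by auto
    moreover have "1 \<le> M" using that dsize_pos order_trans by blast
    ultimately show ?thesis using dsize_eval_le[of a s] dsize_eval_le[of b s]
      by (simp add: algebra_simps)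
  qed
  then show ?case by blast
next
  case (EFst a)
  then obtain c where c: "\<forall>s M. (\<forall>i. dsize (s i) \<le> M) \<longrightarrow> ecost a s \<le> c * M" by blast
  have "ecost (EFst a) s \<le> (2 * c + 1) * M" if "\<forall>i. dsize (s i) \<le> M" for s M
  proof -
    have "ecost a s \<le> c * M" using c that by auto
    moreover have "1 \<le> M" using that dsize_pos order_trans by blast
    ultimately show ?thesis using dsize_eval_le[of a s]
      by (cases "eval a s") (simp_all add: algebra_simps)
  qed
  then show ?case by blast
next
  case (ESnd a)
  then obtain c where c: "\<forall>s M. (\<forall>i. dsize (s i) \<le> M) \<longrightarrow> ecost a s \<le> c * M" by blast
  have "ecost (ESnd a) s \<le> (2 * c + 1) * M" if "\<forall>i. dsize (s i) \<le> M" for s M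
  proof -
    have "ecost a s \<le> c * M" using c that by auto
    moreover have "1 \<le> M" using that dsize_pos order_trans by blast
    ultimately show ?thesis using dsize_eval_le[of a s]
      by (cases "eval a s") (simp_all add: algebra_simps)
  qed
  then show ?case by blast
next
  case (EEq a b)
  then obtain c d where c: "\<forall>s M. (\<forall>i. dsize (s i) \<le> M) \<longrightarrow> ecost a s \<le> c * M"
    and d: "\<forall>s M. (\<forall>i. dsize (s i) \<le> M) \<longrightarrow> ecost b s \<le> d * M" by blast
  have "ecost (EEq a b) s \<le> (c + d + 3) * M" if "\<forall>i. dsize (s i) \<le> M" for s M
  proof -
    have "ecost a s \<le> c * M" "ecost b s \<le> d * M" using c d that by auto
    moreover have "1 \<le> M" using that dsize_pos order_trans by blast
    ultimately show ?thesis by (cases "eval a s = eval b s") (simp_all add: algebra_simps)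
  qed
  then show ?case by blast
qed

section \<open>Programs for basic operations on codes\<close>

lemma polytime_expr:
  assumes "\<And>x. eval e ((\<lambda>_. Leaf)(0 := A x)) = B (f x)"
  shows "polytime A B f"
proof -
  obtain c where c: "\<forall>s M. (\<forall>i. dsize (s i) \<le> M) \<longrightarrow> ecost e s \<le> c * M"
    using ecost_linear by blast
  have "poly_bounded A (\<lambda>x. 1 + ecost e ((\<lambda>_. Leaf)(0 := A x)))"
    by (rule poly_bounded_mono[of _ "\<lambda>x. 1 + c * dsize (A x)"], intro poly_bounded_intros)
      (use c dsize_pos[unfolded One_nat_def] in auto)
  then show ?thesis unfolding polytime_def using computed_in_expr[of e A B f] assms by blast
qed

lemma polytime_id: "polytime A A (\<lambda>x. x)"
  by (rule polytime_expr[of "EVar 0"]) simp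

lemma polytime_const: "polytime A B (\<lambda>_. b)"
proof -
  have "\<exists>e. \<forall>s. eval e s = d" for d
  proof (induction d)
    case Leaf
    then show ?case by (intro exI[of _ ELeaf]) simp
  next
    case (Node a b)
    then obtain e f where "\<forall>s. eval e s = a" "\<forall>s. eval f s = b" by blast
    then show ?case by (intro exI[of _ "ENode e f"]) simp
  qed
  then obtain e where "\<forall>s. eval e s = B b" by blast
  then show ?thesis by (intro polytime_expr) auto
qed

lemma polytime_fst:
  assumes "polytime E (A \<otimes> B) f"
  shows "polytime E A (\<lambda>x. fst (f x))"
  using assms by (rule polytime_comp[where g = fst]) (rule polytime_expr[of "EFst (EVar 0)"], simp add: enc_pair_def)

lemma polytime_snd:
  assumes "polytime E (A \<otimes> B) f"
  shows "polytime E B (\<lambda>x. snd (f x))"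
  using assms by (rule polytime_comp[where g = snd]) (rule polytime_expr[of "ESnd (EVar 0)"], simp add: enc_pair_def)

text \<open>Turns a result about an uncurried function into an introduction rule for its calls with
  computed arguments, so that defined functions can be used like the primitive operations.\<close>

lemma polytime_call2:
  assumes "polytime (A \<otimes> B) R (\<lambda>p. F (fst p) (snd p))" "polytime E A a" "polytime E B b"
  shows "polytime E R (\<lambda>e. F (a e) (b e))"
  using polytime_comp[OF polytime_pair[OF assms(2,3)] assms(1)] by simp

lemma polytime_call3:
  assumes "polytime (A \<otimes> B \<otimes> C) R (\<lambda>p. F (fst p) (fst (snd p)) (snd (snd p)))" "polytime E A a" "polytime E B b" "polytime E C c"
  shows "polytime E R (\<lambda>e. F (a e) (b e) (c e))"
  using polytime_comp[OF polytime_pair[OF assms(2) polytime_pair[OF assms(3,4)]] assms(1)] by simp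

lemma polytime_call4:
  assumes "polytime (A \<otimes> B \<otimes> C \<otimes> D) R (\<lambda>p. F (fst p) (fst (snd p)) (fst (snd (snd p))) (snd (snd (snd p))))"
    "polytime E A a" "polytime E B b" "polytime E C c" "polytime E D d"
  shows "polytime E R (\<lambda>e. F (a e) (b e) (c e) (d e))"
  using polytime_comp[OF polytime_pair[OF assms(2) polytime_pair[OF assms(3) polytime_pair[OF assms(4,5)]]] assms(1)] by simp

text \<open>The machine compares codes, which decides equality of the values because the code is
  injective.\<close>

lemma polytime_eq:
  assumes "inj A" "polytime E A f" "polytime E A g"
  shows "polytime E enc_bool (\<lambda>e. f e = g e)"
proof -
  have "polytime (A \<otimes> A) enc_bool (\<lambda>p. fst p = snd p)"
    by (rule polytime_expr[of "EEq (EFst (EVar 0)) (ESnd (EVar 0))"])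
      (simp add: enc_pair_def inj_eq[OF assms(1)])
  from polytime_call2[OF this assms(2,3)] show ?thesis .
qed

lemma inj_enc_nat: "inj enc_nat"
proof (rule injI)
  fix m n show "enc_nat m = enc_nat n \<Longrightarrow> m = n"
    by (induction m arbitrary: n; case_tac n) auto
qed

lemma inj_enc_bool: "inj enc_bool"
proof (rule injI)
  fix m n show "enc_bool m = enc_bool n \<Longrightarrow> m = n"
    by (cases m; cases n) auto
qed

lemma inj_enc_list:
  assumes "inj A"
  shows "inj (enc_list A)"
proof (rule injI)
  fix xs ys show "enc_list A xs = enc_list A ys \<Longrightarrow> xs = ys"
    by (induction xs arbitrary: ys; case_tac ys) (auto simp: inj_eq[OF assms])
qed

lemma inj_enc_pair: "inj A \<Longrightarrow> inj B \<Longrightarrow> inj (A \<otimes> B)"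
  by (rule injI) (simp add: enc_pair_def prod_eq_iff inj_eq)

lemmas polytime_eq_nat = polytime_eq[OF inj_enc_nat]
lemmas polytime_eq_bool = polytime_eq[OF inj_enc_bool]
lemmas polytime_eq_dat = polytime_eq[OF inj_on_id, unfolded id_def]

lemma polytime_not:
  assumes "polytime E enc_bool f"
  shows "polytime E enc_bool (\<lambda>e. \<not> f e)"
  using polytime_if[OF assms polytime_const[of E enc_bool False] polytime_const[of E enc_bool True]] by (rule polytime_recode) simp

lemma polytime_conj:
  assumes "polytime E enc_bool f" "polytime E enc_bool g"
  shows "polytime E enc_bool (\<lambda>e. f e \<and> g e)"
  using polytime_if[OF assms polytime_const[of E enc_bool False]] by (rule polytime_recode) simp

lemma polytime_disj:
  assumes "polytime E enc_bool f" "polytime E enc_bool g"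
  shows "polytime E enc_bool (\<lambda>e. f e \<or> g e)"
  using polytime_not[OF polytime_conj[OF assms[THEN polytime_not]]] by simp

lemma polytime_imp:
  assumes "polytime E enc_bool f" "polytime E enc_bool g"
  shows "polytime E enc_bool (\<lambda>e. f e \<longrightarrow> g e)"
  using polytime_disj[OF polytime_not[OF assms(1)] assms(2)] unfolding imp_conv_disj .

lemma dsize_le_enc_list: "x \<in> set l \<Longrightarrow> dsize (A x) \<le> dsize (enc_list A l)"
  by (induction l) auto

lemma length_le_enc_list: "length l \<le> dsize (enc_list A l)"
  by (induction l) auto

text \<open>A step that runs in polynomial time may still double the accumulator, so the sizes of
  all intermediate accumulators must be bounded separately, by \<open>T\<close>. Each use of the
  rule has to supply such a bound.\<close>

lemma polytime_foldl:
  assumes l: "polytime E (enc_list A) l" and b: "polytime E B b"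
    and g: "polytime (E \<otimes> A \<otimes> B) B (\<lambda>p. g (fst p) (snd (snd p)) (fst (snd p)))"
    and T: "poly_bounded E T" "\<And>e i. dsize (B (foldl (g e) (b e) (take i (l e)))) \<le> T e"
  shows "polytime E B (\<lambda>e. foldl (g e) (b e) (l e))"
proof -
  obtain Tg where "poly_bounded (E \<otimes> A \<otimes> B) Tg" and
    Tg: "computed_in (E \<otimes> A \<otimes> B) B (\<lambda>p. g (fst p) (snd (snd p)) (fst (snd p))) Tg"
    using g unfolding polytime_def by blast
  then obtain d where d: "\<And>x. Tg x \<le> d * dsize ((E \<otimes> A \<otimes> B) x) ^ d" unfolding poly_bounded_def by blast
  obtain P c where P: "\<forall>e l b M \<tau>. (\<forall>i\<le>length l. dsize (B (foldl (g e) b (take i l))) \<le> M) \<longrightarrow>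
      (\<forall>i<length l. Tg (e, l ! i, foldl (g e) b (take i l)) \<le> \<tau>) \<longrightarrow>
      dsize (E e) \<le> M \<longrightarrow> dsize (enc_list A l) \<le> M \<longrightarrow>
      (\<exists>t \<le> c * ((length l + 1) * (M + \<tau>)).
         runs P ((E \<otimes> enc_list A \<otimes> B) (e, l, b)) t (B (foldl (g e) b l)))"
    using computed_in_foldl[of E A B g, OF Tg] by (elim exE)
  \<comment> \<open>The program expects the triple of parameter, list and start value. Regarding
    this triple as a second code of \<open>e\<close> makes the fold a function of \<open>e\<close>
    alone; moving from \<open>E\<close> to \<open>A'\<close> is then a recoded pairing.\<close>
  define A' where "A' = (\<lambda>e. (E \<otimes> enc_list A \<otimes> B) (e, l e, b e))"
  define M where "M = (\<lambda>e. dsize (E e) + dsize (enc_list A (l e)) + T e)"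
  \<comment> \<open>The summand 2 counts the two \<open>Node\<close>s in the code of the triple that
    is handed to one step.\<close>
  define \<tau> where "\<tau> = (\<lambda>e. d * (2 + M e) ^ d)"
  have run: "\<exists>t \<le> c * ((length (l e) + 1) * (M e + \<tau> e)). runs P (A' e) t (B (foldl (g e) (b e) (l e)))" for e
    unfolding A'_def
  proof (rule P[THEN spec, THEN spec, THEN spec, THEN spec, THEN spec, THEN mp, THEN mp, THEN mp, THEN mp])
    show "\<forall>i\<le>length (l e). dsize (B (foldl (g e) (b e) (take i (l e)))) \<le> M e"
      using T(2)[of e] by (auto simp: M_def intro: trans_le_add2)
    show "\<forall>i<length (l e). Tg (e, l e ! i, foldl (g e) (b e) (take i (l e))) \<le> \<tau> e"
    proof (intro allI impI)
      fix i assume i: "i < length (l e)"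
      let ?x = "(e, l e ! i, foldl (g e) (b e) (take i (l e)))"
      have "dsize ((E \<otimes> A \<otimes> B) ?x) \<le> 2 + M e"
        using dsize_le_enc_list[OF nth_mem[OF i], of A] T(2)[of e i] by (simp add: enc_pair_def M_def)
      then have "d * dsize ((E \<otimes> A \<otimes> B) ?x) ^ d \<le> \<tau> e"
        unfolding \<tau>_def by (intro mult_left_mono power_mono) auto
      then show "Tg ?x \<le> \<tau> e" using d order_trans by blast
    qed
  qed (auto simp: M_def)
  have "poly_bounded E (\<lambda>e. c * ((length (l e) + 1) * (M e + \<tau> e)))"
    unfolding M_def \<tau>_def
    by (intro poly_bounded_intros T polytime_size[OF l] poly_bounded_mono[OF polytime_size[OF l] length_le_enc_list])
  then have "poly_bounded A' (\<lambda>e. c * ((length (l e) + 1) * (M e + \<tau> e)))"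
    by (rule poly_bounded_dom) (simp add: A'_def enc_pair_def)
  moreover have "computed_in A' B (\<lambda>e. foldl (g e) (b e) (l e)) (\<lambda>e. c * ((length (l e) + 1) * (M e + \<tau> e)))"
    unfolding computed_in_def using run by blast
  ultimately have "polytime A' B (\<lambda>e. foldl (g e) (b e) (l e))" unfolding polytime_def by blast
  moreover have "polytime E A' (\<lambda>e. e)"
    using polytime_pair[OF polytime_id polytime_pair[OF l b]] by (rule polytime_recode) (simp add: A'_def)
  ultimately show ?thesis by (rule polytime_comp[rotated])
qed

section \<open>Lists and unary numbers in polynomial time\<close>

lemma dsize_enc_list: "dsize (enc_list A l) = Suc (\<Sum>x\<leftarrow>l. Suc (dsize (A x)))"
  by (induction l) auto

lemma dsize_enc_nat: "dsize (enc_nat n) = Suc (2 * n)"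
  by (induction n) auto

lemma dsize_enc_bool: "dsize (enc_bool b) \<le> 3"
  by (cases b) auto

lemma dsize_enc_list_take: "dsize (enc_list A (take i l)) \<le> dsize (enc_list A l)"
proof (induction l arbitrary: i)
  case (Cons a l)
  then show ?case by (cases i) (auto simp: le_SucI)
qed simp

lemma dsize_enc_list_drop: "dsize (enc_list A (drop i l)) \<le> dsize (enc_list A l)"
proof (induction l arbitrary: i)
  case (Cons a l)
  then show ?case by (cases i) (auto simp: le_SucI trans_le_add2)
qed simp

lemma dsize_enc_list_rev: "dsize (enc_list A (rev l)) = dsize (enc_list A l)"
  by (simp add: dsize_enc_list rev_map[symmetric] sum_list_rev)

lemma dsize_enc_list_append: "dsize (enc_list A (l @ l')) = dsize (enc_list A l) + dsize (enc_list A l') - 1"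
  by (simp add: dsize_enc_list)

lemma polytime_Cons:
  assumes "polytime E A f" "polytime E (enc_list A) g"
  shows "polytime E (enc_list A) (\<lambda>e. f e # g e)"
  using polytime_pair[OF assms] by (rule polytime_recode) (simp add: enc_pair_def)

lemma foldl_flip_Cons: "foldl (\<lambda>acc a. f a # acc) b l = rev (map f l) @ b"
  by (induction l arbitrary: b) auto

lemma foldl_flip_Cons_id: "foldl (\<lambda>acc a. a # acc) b l = rev l @ b"
  by (induction l arbitrary: b) auto

lemma polytime_rev:
  assumes "polytime E (enc_list A) l"
  shows "polytime E (enc_list A) (\<lambda>e. rev (l e))"
proof -
  have "polytime E (enc_list A) (\<lambda>e. foldl (\<lambda>acc a. a # acc) [] (l e))"
  proof (rule polytime_foldl[OF assms polytime_const, where T = "\<lambda>e. dsize (enc_list A (l e))"])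
    show "dsize (enc_list A (foldl (\<lambda>acc a. a # acc) [] (take i (l e)))) \<le> dsize (enc_list A (l e))" for e i
      using dsize_enc_list_take[of A i "l e"]
      by (simp add: foldl_flip_Cons_id dsize_enc_list_rev dsize_enc_list_append)
  qed (rule polytime_Cons polytime_fst polytime_snd polytime_id polytime_size[OF assms])+
  then show ?thesis by (simp add: foldl_flip_Cons_id)
qed

lemma polytime_append:
  assumes f: "polytime E (enc_list A) f" and g: "polytime E (enc_list A) g"
  shows "polytime E (enc_list A) (\<lambda>e. f e @ g e)"
proof -
  have "polytime E (enc_list A) (\<lambda>e. foldl (\<lambda>acc a. a # acc) (g e) (rev (f e)))"
  proof (rule polytime_foldl[OF polytime_rev[OF f] g, where T = "\<lambda>e. dsize (enc_list A (rev (f e))) + dsize (enc_list A (g e))"])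
    show "dsize (enc_list A (foldl (\<lambda>acc a. a # acc) (g e) (take i (rev (f e)))))
      \<le> dsize (enc_list A (rev (f e))) + dsize (enc_list A (g e))" for e i
      using dsize_enc_list_take[of A i "rev (f e)"]
      by (simp add: foldl_flip_Cons_id dsize_enc_list_rev dsize_enc_list_append)
  qed (rule polytime_Cons polytime_fst polytime_snd polytime_id polytime_size f g polytime_rev poly_bounded_intros)+
  then show ?thesis by (simp add: foldl_flip_Cons_id)
qed

text \<open>The fold prepends the images, so it builds the reversed list, which a final reversal
  corrects. The accumulator stays polynomial because each image is polynomially bounded in
  \<open>e\<close> and the list, and there are at most as many images as the code of the list is
  large.\<close>

lemma polytime_map:
  assumes l: "polytime E (enc_list A) l" and f: "polytime (E \<otimes> A) B (\<lambda>p. f (fst p) (snd p))"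
  shows "polytime E (enc_list B) (\<lambda>e. map (f e) (l e))"
proof -
  obtain c where c: "\<And>x. dsize (B (f (fst x) (snd x))) \<le> c * dsize ((E \<otimes> A) x) ^ c"
    using polytime_size[OF f] unfolding poly_bounded_def by blast
  define T where "T = (\<lambda>e. 1 + dsize (enc_list A (l e)) * (1 + c * (1 + dsize (E e) + dsize (enc_list A (l e))) ^ c))"
  have "polytime E (enc_list B) (\<lambda>e. foldl (\<lambda>acc a. f e a # acc) [] (l e))"
  proof (rule polytime_foldl[OF l polytime_const])
    show "poly_bounded E T" unfolding T_def by (intro poly_bounded_intros polytime_size l)
    show "dsize (enc_list B (foldl (\<lambda>acc a. f e a # acc) [] (take i (l e)))) \<le> T e" for e i
    proof -
      let ?S = "\<lambda>l. (\<Sum>x\<leftarrow>l. Suc (dsize (B (f e x))))"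
      let ?m = "1 + c * (1 + dsize (E e) + dsize (enc_list A (l e))) ^ c"
      have "dsize (enc_list B (foldl (\<lambda>acc a. f e a # acc) [] (take i (l e)))) = Suc (?S (take i (l e)))"
        by (simp only: foldl_flip_Cons append_Nil2 dsize_enc_list_rev) (simp add: dsize_enc_list o_def)
      also have "?S (take i (l e)) \<le> (\<Sum>x\<leftarrow>take i (l e). ?m)"
      proof (rule sum_list_mono)
        fix a assume "a \<in> set (take i (l e))"
        then have "dsize (A a) \<le> dsize (enc_list A (l e))"
          using dsize_le_enc_list in_set_takeD by fast
        then have "dsize ((E \<otimes> A) (e, a)) \<le> 1 + dsize (E e) + dsize (enc_list A (l e))"
          by (simp add: enc_pair_def)
        then have "c * dsize ((E \<otimes> A) (e, a)) ^ c \<le> c * (1 + dsize (E e) + dsize (enc_list A (l e))) ^ c"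
          by (intro mult_left_mono power_mono) auto
        then show "Suc (dsize (B (f e a))) \<le> ?m" using c[of "(e, a)"] by (simp only: fst_conv snd_conv)
      qed
      also have "\<dots> = length (take i (l e)) * ?m" by (simp add: sum_list_triv)
      also have "\<dots> \<le> dsize (enc_list A (l e)) * ?m"
        using length_le_enc_list[of "l e" A] by (intro mult_right_mono) auto
      finally show ?thesis unfolding T_def by simp
    qed
    show "polytime (E \<otimes> A \<otimes> enc_list B) (enc_list B) (\<lambda>p. f (fst p) (fst (snd p)) # snd (snd p))"
      by (rule polytime_Cons polytime_call2[where F = f, OF f] polytime_fst polytime_snd polytime_id)+
  qed
  from polytime_rev[OF this] show ?thesis by (simp add: foldl_flip_Cons)
qed

lemma polytime_concat:
  assumes "polytime E (enc_list (enc_list A)) l"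
  shows "polytime E (enc_list A) (\<lambda>e. concat (l e))"
proof -
  have *: "foldl (@) xs ls = xs @ concat ls" for xs :: "'b list" and ls
    by (induction ls arbitrary: xs) auto
  have sz: "dsize (enc_list A (concat (take i ls))) \<le> dsize (enc_list (enc_list A) ls)" for i ls
  proof (induction ls arbitrary: i)
    case (Cons a ls)
    show ?case
      using Cons[of "i - 1"] by (cases i) (auto simp: dsize_enc_list)
  qed simp
  have "polytime E (enc_list A) (\<lambda>e. foldl (@) [] (l e))"
  proof (rule polytime_foldl[OF assms polytime_const, where T = "\<lambda>e. dsize (enc_list (enc_list A) (l e))"])
    show "dsize (enc_list A (foldl (@) [] (take i (l e)))) \<le> dsize (enc_list (enc_list A) (l e))" for e i
      using sz by (simp add: *)
  qed (rule polytime_append polytime_fst polytime_snd polytime_id polytime_size[OF assms])+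
  then show ?thesis by (simp add: *)
qed

lemma polytime_filter:
  assumes l: "polytime E (enc_list A) l" and f: "polytime (E \<otimes> A) enc_bool (\<lambda>p. f (fst p) (snd p))"
  shows "polytime E (enc_list A) (\<lambda>e. filter (f e) (l e))"
proof -
  have "polytime E (enc_list A) (\<lambda>e. concat (map (\<lambda>a. if f e a then [a] else []) (l e)))"
    by (rule polytime_concat polytime_map l polytime_if f polytime_Cons polytime_snd polytime_id polytime_const)+
  moreover have "concat (map (\<lambda>a. if P a then [a] else []) xs) = filter P xs" for P and xs :: "'b list"
    by (induction xs) auto
  ultimately show ?thesis by simp
qed

lemma polytime_Ball:
  assumes l: "polytime E (enc_list A) l" and f: "polytime (E \<otimes> A) enc_bool (\<lambda>p. f (fst p) (snd p))"
  shows "polytime E enc_bool (\<lambda>e. \<forall>x\<in>set (l e). f e x)"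
proof -
  have "polytime E enc_bool (\<lambda>e. foldl (\<lambda>acc a. acc \<and> f e a) True (l e))"
    by (rule polytime_foldl[OF l polytime_const, where T = "\<lambda>_. 3"])
      (rule polytime_conj polytime_call2[where F = f, OF f] polytime_fst polytime_snd polytime_id poly_bounded_intros dsize_enc_bool)+
  moreover have "foldl (\<lambda>acc a. acc \<and> P a) b xs = (b \<and> (\<forall>x\<in>set xs. P x))" for P b and xs :: "'b list"
    by (induction xs arbitrary: b) auto
  ultimately show ?thesis by simp
qed

lemma polytime_Bex:
  assumes l: "polytime E (enc_list A) l" and f: "polytime (E \<otimes> A) enc_bool (\<lambda>p. f (fst p) (snd p))"
  shows "polytime E enc_bool (\<lambda>e. \<exists>x\<in>set (l e). f e x)"
  using polytime_not[OF polytime_Ball[OF l polytime_not[OF f]]] by simp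

lemma polytime_Suc:
  assumes "polytime E enc_nat f"
  shows "polytime E enc_nat (\<lambda>e. Suc (f e))"
  using polytime_pair[OF polytime_const[of _ "\<lambda>_. Leaf" "()"] assms] by (rule polytime_recode) (simp add: enc_pair_def)

lemma polytime_length:
  assumes "polytime E (enc_list A) l"
  shows "polytime E enc_nat (\<lambda>e. length (l e))"
proof -
  have *: "foldl (\<lambda>n _. Suc n) b xs = b + length xs" for b and xs :: "'b list"
    by (induction xs arbitrary: b) auto
  have "polytime E enc_nat (\<lambda>e. foldl (\<lambda>n _. Suc n) 0 (l e))"
  proof (rule polytime_foldl[OF assms polytime_const, where T = "\<lambda>e. 1 + 2 * dsize (enc_list A (l e))"])
    show "dsize (enc_nat (foldl (\<lambda>n _. Suc n) 0 (take i (l e)))) \<le> 1 + 2 * dsize (enc_list A (l e))" for e i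
      using length_le_enc_list[of "l e" A] by (simp add: * dsize_enc_nat)
  qed (rule polytime_Suc polytime_fst polytime_snd polytime_id polytime_size[OF assms] poly_bounded_intros)+
  then show ?thesis by (simp add: *)
qed

text \<open>A unary number is a list of dummies. Bounded iteration over a number thereby becomes a
  fold, without any new program.\<close>

lemma enc_nat_eq_enc_list: "enc_nat n = enc_list (\<lambda>_::unit. Leaf) (replicate n ())"
  by (induction n) auto

lemma polytime_replicate_unit:
  assumes "polytime E enc_nat f"
  shows "polytime E (enc_list (\<lambda>_::unit. Leaf)) (\<lambda>e. replicate (f e) ())"
  using assms by (rule polytime_recode) (rule enc_nat_eq_enc_list)

text \<open>Passing from \<open>[0..<m]\<close> to \<open>[0..<Suc m]\<close> by shifting and
  prepending 0 needs no counter beside the accumulator.\<close>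

lemma polytime_upt:
  assumes "polytime E enc_nat f"
  shows "polytime E (enc_list enc_nat) (\<lambda>e. [0..<f e])"
proof -
  have "foldl (\<lambda>acc _. 0 # map Suc acc) [0..<m] us = [0..<m + length us]" for m and us :: "unit list"
  proof (induction us arbitrary: m)
    case (Cons u us)
    have "0 # map Suc [0..<m] = [0..<Suc m]" by (simp add: map_Suc_upt upt_conv_Cons del: upt_Suc)
    then show ?case using Cons[of "Suc m"] by simp
  qed simp
  from this[of 0] have *: "foldl (\<lambda>acc _. 0 # map Suc acc) [] us = [0..<length us]" for us :: "unit list"
    by simp
  have sz: "dsize (enc_list enc_nat [0..<i]) \<le> 1 + n * (2 + 2 * n)" if "i \<le> n" for i n
  proof -
    have "(\<Sum>x\<leftarrow>[0..<i]. Suc (dsize (enc_nat x))) \<le> (\<Sum>x\<leftarrow>[0..<i]. 2 + 2 * n)"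
      using that by (intro sum_list_mono) (auto simp: dsize_enc_nat)
    also have "\<dots> \<le> n * (2 + 2 * n)" using that by (simp add: sum_list_triv add_mono mult_mono)
    finally show ?thesis by (simp add: dsize_enc_list)
  qed
  let ?D = "\<lambda>e. dsize (enc_nat (f e))"
  have "polytime E (enc_list enc_nat) (\<lambda>e. foldl (\<lambda>acc _. 0 # map Suc acc) [] (replicate (f e) ()))"
  proof (rule polytime_foldl[OF polytime_replicate_unit[OF assms] polytime_const, where T = "\<lambda>e. 1 + ?D e * (2 + 2 * ?D e)"])
    show "dsize (enc_list enc_nat (foldl (\<lambda>acc _. 0 # map Suc acc) [] (take i (replicate (f e) ()))))
      \<le> 1 + ?D e * (2 + 2 * ?D e)" for e i
      unfolding * by (rule sz) (simp add: dsize_enc_nat)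
  qed (rule polytime_Cons polytime_map polytime_const polytime_Suc polytime_fst polytime_snd polytime_id polytime_size[OF assms] poly_bounded_intros)+
  then show ?thesis by (simp add: *)
qed

lemma polytime_less:
  assumes "polytime E enc_nat f" "polytime E enc_nat g"
  shows "polytime E enc_bool (\<lambda>e. f e < g e)"
proof -
  \<comment> \<open>Comparison of numbers is reduced to a search for \<open>f e\<close> among the
    numbers below \<open>g e\<close>.\<close>
  have "polytime E enc_bool (\<lambda>e. \<exists>x\<in>set [0..<g e]. x = f e)"
    by (rule polytime_Bex polytime_eq_nat polytime_upt assms polytime_snd polytime_id polytime_comp[OF _ assms(1)] polytime_fst)+
  then show ?thesis by simp
qed

lemma polytime_le:
  assumes "polytime E enc_nat f" "polytime E enc_nat g"
  shows "polytime E enc_bool (\<lambda>e. f e \<le> g e)"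
  using polytime_less[OF assms(1) polytime_Suc[OF assms(2)]] by (simp add: less_Suc_eq_le)

text \<open>A program has to compute the function on every argument of its type, so heads and
  entries that do not exist need a prescribed value.\<close>

definition hd_default :: "'a \<Rightarrow> 'a list \<Rightarrow> 'a" where
  "hd_default d l = (case l of [] \<Rightarrow> d | x # _ \<Rightarrow> x)"

definition nth_default :: "'a \<Rightarrow> 'a list \<Rightarrow> nat \<Rightarrow> 'a" where
  "nth_default d l i = hd_default d (drop i l)"

lemma nth_default_nth: "i < length l \<Longrightarrow> nth_default d l i = l ! i"
  by (simp add: nth_default_def hd_default_def Cons_nth_drop_Suc[symmetric])

text \<open>The test compares the code with \<open>Leaf\<close> as a tree, so the code
  \<open>A\<close> of the elements may be arbitrary.\<close>

lemma polytime_Nil_test: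
  assumes "polytime E (enc_list A) l"
  shows "polytime E enc_bool (\<lambda>e. l e = [])"
proof -
  have "polytime E (\<lambda>x. x) (\<lambda>e. enc_list A (l e))" using assms by (rule polytime_recode) simp
  from polytime_eq_dat[OF this polytime_const[of _ _ Leaf]] show ?thesis
    by (rule polytime_recode) (case_tac "l x"; simp)
qed

lemma polytime_hd_default:
  assumes "polytime E (enc_list A) l"
  shows "polytime E A (\<lambda>e. hd_default d (l e))"
proof -
  have "polytime E (\<lambda>x. x) (\<lambda>e. dfst (enc_list A (l e)))"
    by (rule polytime_comp[OF assms, of _ "\<lambda>l. dfst (enc_list A l)"], rule polytime_expr[of "EFst (EVar 0)"]) simp
  moreover have "polytime E (\<lambda>x. x) (\<lambda>_. A d)" by (rule polytime_const)
  ultimately have "polytime E (\<lambda>x. x) (\<lambda>e. if l e = [] then A d else dfst (enc_list A (l e)))"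
    using polytime_if[OF polytime_Nil_test[OF assms]] by blast
  then show ?thesis by (rule polytime_recode) (auto simp: hd_default_def split: list.split)
qed

lemma polytime_nth_default:
  assumes f: "polytime E (enc_list A) f" and g: "polytime E enc_nat g"
  shows "polytime E A (\<lambda>e. nth_default d (f e) (g e))"
proof -
  have "foldl (\<lambda>xs _. tl xs) (drop k l) us = drop (k + length us) l" for k l and us :: "unit list"
  proof (induction us arbitrary: k)
    case (Cons u us)
    have "tl (drop k l) = drop (Suc k) l" by (simp add: drop_Suc tl_drop)
    then show ?case using Cons[of "Suc k"] by simp
  qed simp
  from this[of 0] have *: "foldl (\<lambda>xs _. tl xs) l us = drop (length us) l" for l and us :: "unit list"
    by simp
  have "polytime E (enc_list A) (\<lambda>e. foldl (\<lambda>xs _. tl xs) (f e) (replicate (g e) ()))"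
  proof (rule polytime_foldl[OF polytime_replicate_unit[OF g] f, where T = "\<lambda>e. dsize (enc_list A (f e))"])
    show "dsize (enc_list A (foldl (\<lambda>xs _. tl xs) (f e) (take i (replicate (g e) ()))))
      \<le> dsize (enc_list A (f e))" for e i
      unfolding * by (rule dsize_enc_list_drop)
    show "polytime (E \<otimes> (\<lambda>_. Leaf) \<otimes> enc_list A) (enc_list A) (\<lambda>p. tl (snd (snd p)))"
    proof (rule polytime_comp[of _ "enc_list A" _ _ tl])
      show "polytime (E \<otimes> (\<lambda>_. Leaf) \<otimes> enc_list A) (enc_list A) (\<lambda>p. snd (snd p))"
        by (rule polytime_snd polytime_id)+
      show "polytime (enc_list A) (enc_list A) tl"
        by (rule polytime_expr[of "ESnd (EVar 0)"]) (case_tac x; simp)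
    qed
  qed (rule polytime_size[OF f])+
  from polytime_hd_default[OF this] show ?thesis by (simp add: * nth_default_def)
qed

text \<open>The length \<open>n\<close> is fixed outside the input. The induction builds one program
  for each \<open>n\<close>, and the degree of its time bound may depend on
  \<open>n\<close>.\<close>

lemma polytime_n_lists:
  assumes "polytime E (enc_list A) l"
  shows "polytime E (enc_list (enc_list A)) (\<lambda>e. List.n_lists n (l e))"
proof (induction n)
  case 0
  then show ?case by (simp add: polytime_const)
next
  case (Suc n)
  show ?case unfolding List.n_lists.simps
    by (rule polytime_concat polytime_map Suc polytime_Cons polytime_fst polytime_snd polytime_id polytime_comp[OF _ assms])+
qed

lemmas polytime_intros = polytime_id polytime_const polytime_fst polytime_snd polytime_pair polytime_if polytime_eq_nat polytime_eq_bool polytime_not polytime_conj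
  polytime_disj polytime_imp polytime_Cons polytime_rev polytime_append polytime_map polytime_concat polytime_filter polytime_Ball polytime_Bex polytime_Suc polytime_length
  polytime_upt polytime_less polytime_le polytime_hd_default polytime_nth_default polytime_n_lists polytime_Nil_test

section \<open>Computable functions\<close>

definition enc_computable :: "('a \<Rightarrow> dat) \<Rightarrow> ('b \<Rightarrow> dat) \<Rightarrow> ('a \<Rightarrow> 'b) \<Rightarrow> bool" where
  "enc_computable A B f \<longleftrightarrow> (\<exists>T. computed_in A B f T)"

lemma enc_computable_iff: "enc_computable A B f \<longleftrightarrow> (\<exists>P. \<forall>x. \<exists>t. runs P (A x) t (B (f x)))"
proof
  assume "\<exists>P. \<forall>x. \<exists>t. runs P (A x) t (B (f x))"
  then obtain P T where "\<forall>x. runs P (A x) (T x) (B (f x))" by metis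
  then have "computed_in A B f T" unfolding computed_in_def by blast
  then show "enc_computable A B f" unfolding enc_computable_def by blast
qed (unfold enc_computable_def computed_in_def, blast)

lemma computable_iff_enc_computable: "computable f \<longleftrightarrow> enc_computable enc_nat enc_nat f"
  unfolding computable_def enc_computable_iff by simp

lemma polytime_imp_enc_computable: "polytime A B f \<Longrightarrow> enc_computable A B f"
  unfolding polytime_def enc_computable_def by blast

lemma enc_computable_comp: "enc_computable A B f \<Longrightarrow> enc_computable B C g \<Longrightarrow> enc_computable A C (\<lambda>x. g (f x))"
  unfolding enc_computable_def using computed_in_comp by blast

lemma enc_computable_pair: "enc_computable A B f \<Longrightarrow> enc_computable A C g \<Longrightarrow> enc_computable A (B \<otimes> C) (\<lambda>x. (f x, g x))"
  unfolding enc_computable_def using computed_in_pair by blast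

lemma enc_computable_recode: "enc_computable A B f \<Longrightarrow> (\<And>x. B (f x) = C (g x)) \<Longrightarrow> enc_computable A C g"
  unfolding enc_computable_iff by simp

text \<open>A fold always terminates if its step does. The bounds demanded by the loop are the sums
  of all sizes and of all step times in the run at hand.\<close>

lemma enc_computable_foldl:
  assumes l: "enc_computable E (enc_list A) l" and b: "enc_computable E B b"
    and g: "enc_computable (E \<otimes> A \<otimes> B) B (\<lambda>p. g (fst p) (snd (snd p)) (fst (snd p)))"
  shows "enc_computable E B (\<lambda>e. foldl (g e) (b e) (l e))"
proof -
  obtain Tg where Tg: "computed_in (E \<otimes> A \<otimes> B) B (\<lambda>p. g (fst p) (snd (snd p)) (fst (snd p))) Tg"
    using g unfolding enc_computable_def by blast
  obtain P c where P: "\<forall>e l b M \<tau>. (\<forall>i\<le>length l. dsize (B (foldl (g e) b (take i l))) \<le> M) \<longrightarrow>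
      (\<forall>i<length l. Tg (e, l ! i, foldl (g e) b (take i l)) \<le> \<tau>) \<longrightarrow>
      dsize (E e) \<le> M \<longrightarrow> dsize (enc_list A l) \<le> M \<longrightarrow>
      (\<exists>t \<le> c * ((length l + 1) * (M + \<tau>)).
         runs P ((E \<otimes> enc_list A \<otimes> B) (e, l, b)) t (B (foldl (g e) b l)))"
    using computed_in_foldl[of E A B g, OF Tg] by (elim exE)
  define A' where "A' = (\<lambda>e. (E \<otimes> enc_list A \<otimes> B) (e, l e, b e))"
  have "\<exists>t. runs P (A' e) t (B (foldl (g e) (b e) (l e)))" for e
  proof -
    let ?S = "\<Sum>i\<le>length (l e). dsize (B (foldl (g e) (b e) (take i (l e))))"
    let ?M = "?S + dsize (E e) + dsize (enc_list A (l e))"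
    let ?\<tau> = "\<Sum>i<length (l e). Tg (e, l e ! i, foldl (g e) (b e) (take i (l e)))"
    have "\<exists>t \<le> c * ((length (l e) + 1) * (?M + ?\<tau>)). runs P (A' e) t (B (foldl (g e) (b e) (l e)))"
      unfolding A'_def
    proof (rule P[THEN spec, THEN spec, THEN spec, THEN spec, THEN spec, THEN mp, THEN mp, THEN mp, THEN mp])
      show "\<forall>i\<le>length (l e). dsize (B (foldl (g e) (b e) (take i (l e)))) \<le> ?M"
        by (auto intro!: trans_le_add1 member_le_sum)
      show "\<forall>i<length (l e). Tg (e, l e ! i, foldl (g e) (b e) (take i (l e))) \<le> ?\<tau>"
        by (intro allI impI, rule member_le_sum) auto
    qed auto
    then show ?thesis by blast
  qed
  then have "enc_computable A' B (\<lambda>e. foldl (g e) (b e) (l e))" unfolding enc_computable_iff by blast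
  moreover have "enc_computable E A' (\<lambda>e. e)"
    using enc_computable_pair[OF polytime_imp_enc_computable[OF polytime_id] enc_computable_pair[OF l b]] by (rule enc_computable_recode) (simp add: A'_def)
  ultimately show ?thesis by (rule enc_computable_comp[rotated])
qed

lemma computable_const: "computable (\<lambda>_. n)"
  unfolding computable_iff_enc_computable by (rule polytime_imp_enc_computable[OF polytime_const])

lemma computable_id: "computable (\<lambda>k. k)"
  unfolding computable_iff_enc_computable by (rule polytime_imp_enc_computable[OF polytime_id])

lemma enc_computable_upt: "enc_computable E enc_nat f \<Longrightarrow> enc_computable E (enc_list enc_nat) (\<lambda>e. [0..<f e])"
  by (rule enc_computable_comp[of _ enc_nat], assumption, rule polytime_imp_enc_computable, rule polytime_upt, rule polytime_id)

lemma enc_computable_add: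
  assumes "enc_computable E enc_nat f" "enc_computable E enc_nat g"
  shows "enc_computable E enc_nat (\<lambda>e. f e + g e)"
proof -
  have "enc_computable E enc_nat (\<lambda>e. foldl (\<lambda>n _. Suc n) (f e) [0..<g e])"
    by (rule enc_computable_foldl[OF enc_computable_upt[OF assms(2)] assms(1)], rule polytime_imp_enc_computable) (rule polytime_intros)+
  moreover have "foldl (\<lambda>n _. Suc n) b xs = b + length xs" for b and xs :: "nat list"
    by (induction xs arbitrary: b) auto
  ultimately show ?thesis by simp
qed

lemma enc_computable_sum:
  assumes "enc_computable E enc_nat f" "enc_computable (E \<otimes> enc_nat) enc_nat (\<lambda>p. g (fst p) (snd p))"
  shows "enc_computable E enc_nat (\<lambda>e. \<Sum>j<f e. g e j)"
proof -
  have "enc_computable E enc_nat (\<lambda>e. foldl (\<lambda>n j. n + g e j) 0 [0..<f e])"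
  proof (rule enc_computable_foldl[OF enc_computable_upt[OF assms(1)]])
    show "enc_computable E enc_nat (\<lambda>e. 0)" by (rule polytime_imp_enc_computable[OF polytime_const])
    have "enc_computable (E \<otimes> enc_nat \<otimes> enc_nat) (E \<otimes> enc_nat) (\<lambda>p. (fst p, fst (snd p)))"
      by (rule polytime_imp_enc_computable) (rule polytime_intros)+
    from enc_computable_comp[OF this assms(2)]
    have "enc_computable (E \<otimes> enc_nat \<otimes> enc_nat) enc_nat (\<lambda>p. g (fst p) (fst (snd p)))" by simp
    then show "enc_computable (E \<otimes> enc_nat \<otimes> enc_nat) enc_nat (\<lambda>p. snd (snd p) + g (fst p) (fst (snd p)))"
      by (intro enc_computable_add) (rule polytime_imp_enc_computable, (rule polytime_intros)+)
  qed
  moreover have "foldl (\<lambda>n j. n + h j) b [0..<m] = b + (\<Sum>j<m. h j)" for h :: "nat \<Rightarrow> nat" and b m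
    by (induction m) auto
  ultimately show ?thesis by simp
qed

lemma computable_add: "computable f \<Longrightarrow> computable g \<Longrightarrow> computable (\<lambda>k. f k + g k)"
  unfolding computable_iff_enc_computable by (rule enc_computable_add)

lemma computable_sum:
  assumes "computable f" "computable g"
  shows "computable (\<lambda>k. \<Sum>j<f k. g j)"
  using assms unfolding computable_iff_enc_computable
  by (intro enc_computable_sum enc_computable_comp[of _ enc_nat snd _ g]) (auto intro!: polytime_imp_enc_computable polytime_snd polytime_id)

lemma computable_mult:
  assumes "computable f" "computable g"
  shows "computable (\<lambda>k. f k * g k)"
proof -
  have "enc_computable enc_nat enc_nat (\<lambda>k. \<Sum>j<f k. g k)"
    using assms unfolding computable_iff_enc_computable
    by (intro enc_computable_sum enc_computable_comp[of _ enc_nat fst _ g]) (auto intro!: polytime_imp_enc_computable polytime_fst polytime_id)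
  then show ?thesis unfolding computable_iff_enc_computable by simp
qed

lemma computable_power: "computable f \<Longrightarrow> computable (\<lambda>k. f k ^ n)"
  by (induction n) (auto intro: computable_const computable_mult)

lemmas computable_intros = computable_const computable_id computable_add computable_mult computable_power

section \<open>Fixed-parameter tractable functions\<close>

definition enc_param' :: "dat \<times> nat \<Rightarrow> dat" where
  "enc_param' = (\<lambda>(x, k). enc_param x k)"

definition fpt_computable :: "('b \<Rightarrow> dat) \<Rightarrow> (dat \<times> nat \<Rightarrow> 'b) \<Rightarrow> bool" where
  "fpt_computable B g \<longleftrightarrow> (\<exists>f c. computable f \<and> computed_in enc_param' B g (\<lambda>p. f (snd p) * dsize (enc_param' p) ^ c))"

text \<open>The intermediate result has size at most \<open>(1 + f k) * n ^ (c + 1)\<close>, and a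
  power of this splits again into a function of \<open>k\<close> and a power of \<open>n\<close>.
  The time bound on \<open>h\<close> is required only at values of \<open>g\<close>, and in terms of
  the original parameter \<open>snd p\<close>.\<close>

lemma fpt_computable_compose:
  assumes g: "fpt_computable B g" and h: "computed_in B C h Th" and f2: "computable f2"
    and Th: "\<And>p. Th (g p) \<le> f2 (snd p) * dsize (B (g p)) ^ c2"
  shows "fpt_computable C (\<lambda>p. h (g p))"
proof -
  obtain f c where f: "computable f" and cm: "computed_in enc_param' B g (\<lambda>p. f (snd p) * dsize (enc_param' p) ^ c)"
    using g unfolding fpt_computable_def by blast
  from computed_in_comp[OF cm h] obtain d where
    d: "computed_in enc_param' C (\<lambda>p. h (g p)) (\<lambda>p. f (snd p) * dsize (enc_param' p) ^ c + Th (g p) + d)" by blast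
  \<comment> \<open>The summands pay for the first program, for the second one on the enlarged
    intermediate result, and for the overhead \<open>d\<close> of composing them; the exponent
    \<open>e\<close> below exceeds both exponents involved.\<close>
  define F where "F = (\<lambda>k. f k + f2 k * (1 + f k) ^ c2 + d)"
  define e where "e = c + (c + 1) * c2"
  have "f (snd p) * dsize (enc_param' p) ^ c + Th (g p) + d \<le> F (snd p) * dsize (enc_param' p) ^ e" for p
  proof -
    let ?n = "dsize (enc_param' p)" and ?k = "snd p"
    have n: "1 \<le> ?n" by (rule dsize_pos)
    have "dsize (B (g p)) \<le> ?n + f ?k * ?n ^ c" using computed_in_size[OF cm] .
    also have "\<dots> \<le> ?n ^ (c + 1) + f ?k * ?n ^ (c + 1)"
      using n power_increasing[of 1 "c + 1" ?n] by (intro add_mono mult_left_mono power_increasing) auto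
    also have "\<dots> = (1 + f ?k) * ?n ^ (c + 1)" by (simp add: algebra_simps)
    finally have "dsize (B (g p)) ^ c2 \<le> ((1 + f ?k) * ?n ^ (c + 1)) ^ c2" by (rule power_mono) simp
    also have "\<dots> = (1 + f ?k) ^ c2 * ?n ^ ((c + 1) * c2)" by (simp only: power_mult_distrib power_mult)
    also have "\<dots> \<le> (1 + f ?k) ^ c2 * ?n ^ e"
      using n unfolding e_def by (intro mult_left_mono power_increasing) auto
    finally have "f2 ?k * dsize (B (g p)) ^ c2 \<le> f2 ?k * ((1 + f ?k) ^ c2 * ?n ^ e)"
      by (rule mult_left_mono) simp
    with Th[of p] have "Th (g p) \<le> f2 ?k * ((1 + f ?k) ^ c2 * ?n ^ e)" by (rule order_trans)
    then have "Th (g p) \<le> f2 ?k * (1 + f ?k) ^ c2 * ?n ^ e" by (simp only: mult.assoc)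
    moreover have "f ?k * ?n ^ c \<le> f ?k * ?n ^ e"
      using n unfolding e_def by (intro mult_left_mono power_increasing) auto
    moreover have "d \<le> d * ?n ^ e" using n by simp
    ultimately show ?thesis unfolding F_def by (simp only: add_mult_distrib)
  qed
  with d have "computed_in enc_param' C (\<lambda>p. h (g p)) (\<lambda>p. F (snd p) * dsize (enc_param' p) ^ e)"
    by (rule computed_in_mono)
  moreover have "computable F" unfolding F_def by (intro computable_intros f f2)
  ultimately show ?thesis unfolding fpt_computable_def by blast
qed

lemma fpt_computable_polytime:
  assumes "fpt_computable B g" "polytime B C h"
  shows "fpt_computable C (\<lambda>p. h (g p))"
proof -
  obtain T c where "computed_in B C h T" "\<And>x. T x \<le> c * dsize (B x) ^ c"
    using assms(2) unfolding polytime_def poly_bounded_def by blast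
  then show ?thesis using fpt_computable_compose[OF assms(1) _ computable_const] by blast
qed

text \<open>Selecting one output per instance turns a decision program into a function, to which the
  composition rules apply.\<close>

lemma FPT_iff: "L \<in> FPT \<longleftrightarrow> (\<exists>g. fpt_computable (\<lambda>y. y) g \<and> L = {p. g p \<noteq> Leaf})"
proof
  assume "L \<in> FPT"
  then obtain P f c where f: "computable f" and H: "\<forall>x k. \<exists>t y. runs P (enc_param x k) t y
        \<and> t \<le> f k * dsize (enc_param x k) ^ c \<and> (y \<noteq> Leaf \<longleftrightarrow> (x, k) \<in> L)"
    unfolding FPT_def by blast
  have "\<exists>y t. t \<le> f (snd p) * dsize (enc_param' p) ^ c \<and> runs P (enc_param' p) t y \<and> (y \<noteq> Leaf \<longleftrightarrow> p \<in> L)" for p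
    using H[rule_format, of "fst p" "snd p"] by (cases p) (auto simp: enc_param'_def)
  then obtain g where
    g: "\<forall>p. \<exists>t. t \<le> f (snd p) * dsize (enc_param' p) ^ c \<and> runs P (enc_param' p) t (g p) \<and> (g p \<noteq> Leaf \<longleftrightarrow> p \<in> L)"
    by metis
  then have "computed_in enc_param' (\<lambda>y. y) g (\<lambda>p. f (snd p) * dsize (enc_param' p) ^ c)"
    unfolding computed_in_def by blast
  with f have "fpt_computable (\<lambda>y. y) g" unfolding fpt_computable_def by blast
  then show "\<exists>g. fpt_computable (\<lambda>y. y) g \<and> L = {p. g p \<noteq> Leaf}" using g by (intro exI[of _ g]) auto
next
  assume "\<exists>g. fpt_computable (\<lambda>y. y) g \<and> L = {p. g p \<noteq> Leaf}"
  then obtain g f c where f: "computable f"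
    and g: "computed_in enc_param' (\<lambda>y. y) g (\<lambda>p. f (snd p) * dsize (enc_param' p) ^ c)"
    and L: "L = {p. g p \<noteq> Leaf}" unfolding fpt_computable_def by blast
  then obtain P where P: "\<forall>p. \<exists>t\<le>f (snd p) * dsize (enc_param' p) ^ c. runs P (enc_param' p) t (g p)"
    unfolding computed_in_def by blast
  have "\<exists>t y. runs P (enc_param x k) t y \<and> t \<le> f k * dsize (enc_param x k) ^ c \<and> (y \<noteq> Leaf \<longleftrightarrow> (x, k) \<in> L)" for x k
    using P[rule_format, of "(x, k)"] by (auto simp: L enc_param'_def)
  then show "L \<in> FPT" unfolding FPT_def using f by blast
qed

lemma fpt_reducible_iff:
  "fpt_reducible L M \<longleftrightarrow> (\<exists>r g. fpt_computable enc_param' r \<and> computable g \<and>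
     (\<forall>p. snd (r p) \<le> g (snd p) \<and> (p \<in> L \<longleftrightarrow> r p \<in> M)))"
proof
  assume "fpt_reducible L M"
  then obtain P f g c where fg: "computable f" "computable g" and
    H: "\<forall>x k. \<exists>t x' k'. runs P (enc_param x k) t (enc_param x' k')
        \<and> t \<le> f k * dsize (enc_param x k) ^ c \<and> k' \<le> g k \<and> ((x, k) \<in> L \<longleftrightarrow> (x', k') \<in> M)"
    unfolding fpt_reducible_def by blast
  have "\<exists>q t. t \<le> f (snd p) * dsize (enc_param' p) ^ c \<and> runs P (enc_param' p) t (enc_param' q) \<and>
       snd q \<le> g (snd p) \<and> (p \<in> L \<longleftrightarrow> q \<in> M)" for p
    using H[rule_format, of "fst p" "snd p"] by (cases p) (auto simp: enc_param'_def)
  then obtain r where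
    r: "\<forall>p. \<exists>t. t \<le> f (snd p) * dsize (enc_param' p) ^ c \<and> runs P (enc_param' p) t (enc_param' (r p)) \<and>
       snd (r p) \<le> g (snd p) \<and> (p \<in> L \<longleftrightarrow> r p \<in> M)"
    by metis
  then have "computed_in enc_param' enc_param' r (\<lambda>p. f (snd p) * dsize (enc_param' p) ^ c)"
    unfolding computed_in_def by blast
  with fg have "fpt_computable enc_param' r" unfolding fpt_computable_def by blast
  then show "\<exists>r g. fpt_computable enc_param' r \<and> computable g \<and>
     (\<forall>p. snd (r p) \<le> g (snd p) \<and> (p \<in> L \<longleftrightarrow> r p \<in> M))" using r fg by blast
next
  assume "\<exists>r g. fpt_computable enc_param' r \<and> computable g \<and>
     (\<forall>p. snd (r p) \<le> g (snd p) \<and> (p \<in> L \<longleftrightarrow> r p \<in> M))"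
  then obtain r g f c where f: "computable f" "computable g"
    and r: "computed_in enc_param' enc_param' r (\<lambda>p. f (snd p) * dsize (enc_param' p) ^ c)"
    and L: "\<forall>p. snd (r p) \<le> g (snd p) \<and> (p \<in> L \<longleftrightarrow> r p \<in> M)" unfolding fpt_computable_def by blast
  then obtain P where P: "\<forall>p. \<exists>t\<le>f (snd p) * dsize (enc_param' p) ^ c. runs P (enc_param' p) t (enc_param' (r p))"
    unfolding computed_in_def by blast
  have "\<exists>t x' k'. runs P (enc_param x k) t (enc_param x' k') \<and> t \<le> f k * dsize (enc_param x k) ^ c
        \<and> k' \<le> g k \<and> ((x, k) \<in> L \<longleftrightarrow> (x', k') \<in> M)" for x k
    using P[rule_format, of "(x, k)"] L[rule_format, of "(x, k)"]
    by (cases "r (x, k)") (auto simp: enc_param'_def)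
  then show "fpt_reducible L M" unfolding fpt_reducible_def using f by blast
qed

lemma circuit_Input: "circuit [Input]" "circuit_weft [Input] = 0" "circuit_depth [Input] = 0"
  "inputs [Input] = {0}" "circuit_value [Input] S \<longleftrightarrow> 0 \<in> S"
  by (auto simp: circuit_def circuit_weft_def circuit_depth_def inputs_def circuit_value_def
      scan_gates_def gate_weft_def gate_depth_def)

lemma enc_param'_eq: "enc_param' = (\<lambda>x. x) \<otimes> enc_nat"
  by (auto simp: enc_param'_def enc_param_def enc_pair_def)

lemma inj_enc_gate: "inj enc_gate"
proof (rule injI)
  fix a b assume "enc_gate a = enc_gate b"
  then show "a = b"
    by (cases a; cases b) (auto simp: inj_eq[OF inj_enc_nat] inj_eq[OF inj_enc_list[OF inj_enc_nat]]
        numeral_2_eq_2 numeral_3_eq_3)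
qed

text \<open>The circuit consisting of a single input gate has exactly one satisfying assignment, of
  weight one. The verdict of the decision program can therefore be handed over as the parameter 1 or
  0.\<close>

lemma FPT_subset_W1: "FPT \<subseteq> W 1"
proof
  fix L assume "L \<in> FPT"
  then obtain g where g: "fpt_computable (\<lambda>y. y) g" and L: "L = {p. g p \<noteq> Leaf}" unfolding FPT_iff by blast
  let ?c = "enc_list enc_gate [Input]"
  define h where "h = (\<lambda>y. (?c, if y \<noteq> Leaf then 1 else 0 :: nat))"
  have "polytime (\<lambda>y. y) enc_param' h" unfolding h_def enc_param'_eq
    by (rule polytime_intros polytime_eq_dat)+
  from fpt_computable_polytime[OF g this] have r: "fpt_computable enc_param' (\<lambda>p. h (g p))" .
  have "(?c, k) \<in> WCS 1 0 \<longleftrightarrow> k = 1" for k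
  proof -
    have "?c = enc_list enc_gate C \<longleftrightarrow> C = [Input]" for C
      using inj_eq[OF inj_enc_list[OF inj_enc_gate], of "[Input]" C] by auto
    then have "(?c, k) \<in> WCS 1 0 \<longleftrightarrow> (\<exists>S \<subseteq> {0::nat}. card S = k \<and> 0 \<in> S)"
      unfolding WCS_def mem_Collect_eq prod.case by (simp add: circuit_Input del: enc_list.simps)
    also have "\<dots> \<longleftrightarrow> k = 1" by (auto simp: subset_singleton_iff intro!: exI[of _ "{0}"])
    finally show ?thesis .
  qed
  then have "snd (h (g p)) \<le> 1 \<and> (p \<in> L \<longleftrightarrow> h (g p) \<in> WCS 1 0)" for p
    by (simp add: h_def L)
  then have "fpt_reducible L (WCS 1 0)" unfolding fpt_reducible_iff
    using r computable_const[of 1] by (intro exI[of _ "\<lambda>p. h (g p)"] exI[of _ "\<lambda>_. 1"]) blast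
  then show "L \<in> W 1" unfolding W_def by blast
qed

section \<open>Circuits of weft one\<close>

primrec gate_kind :: "gate \<Rightarrow> nat" where
  "gate_kind Input = 0"
| "gate_kind (NotG j) = 1"
| "gate_kind (AndG js) = 2"
| "gate_kind (OrG js) = 3"

definition kind_at :: "gate list \<Rightarrow> nat \<Rightarrow> nat" where
  "kind_at C i = gate_kind (nth_default Input C i)"

definition preds_at :: "gate list \<Rightarrow> nat \<Rightarrow> nat list" where
  "preds_at C i = preds (nth_default Input C i)"

text \<open>Recursion on the bound rather than on the position of the gate: \<open>h\<close> is a
  constant of the reduction, so predicates of this form are shown to be polynomial-time computable
  by induction on \<open>h\<close>.\<close>

primrec depth_le :: "nat \<Rightarrow> gate list \<Rightarrow> nat \<Rightarrow> bool" where
  "depth_le 0 C i \<longleftrightarrow> preds_at C i = []"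
| "depth_le (Suc h) C i \<longleftrightarrow> (\<forall>j\<in>set (preds_at C i). depth_le h C j)"

text \<open>For gates of depth at most \<open>h\<close>, weft zero and weft at most one.\<close>

primrec weft0 :: "nat \<Rightarrow> gate list \<Rightarrow> nat \<Rightarrow> bool" where
  "weft0 0 C i \<longleftrightarrow> True"
| "weft0 (Suc h) C i \<longleftrightarrow> length (preds_at C i) \<le> 2 \<and> (\<forall>j\<in>set (preds_at C i). weft0 h C j)"

primrec weft1 :: "nat \<Rightarrow> gate list \<Rightarrow> nat \<Rightarrow> bool" where
  "weft1 0 C i \<longleftrightarrow> True"
| "weft1 (Suc h) C i \<longleftrightarrow>
    (\<forall>j\<in>set (preds_at C i). if length (preds_at C i) \<le> 2 then weft1 h C j else weft0 h C j)"

section \<open>Depth, weft and value of single gates\<close>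

lemma scan_gates_snoc: "scan_gates step (C @ [g]) = scan_gates step C @ [step (scan_gates step C) g]"
  by (simp add: scan_gates_def)

lemma length_scan_gates [simp]: "length (scan_gates step C) = length C"
proof (induction C rule: rev_induct)
  case Nil
  then show ?case by (simp add: scan_gates_def)
qed (simp add: scan_gates_snoc)

lemma scan_gates_nth:
  "i < length C \<Longrightarrow> scan_gates step C ! i = step (take i (scan_gates step C)) (C ! i)"
proof (induction C rule: rev_induct)
  case (snoc g C)
  then show ?case
    by (cases "i = length C") (auto simp: scan_gates_snoc nth_append)
qed simp

lemma last_scan_gates: "C \<noteq> [] \<Longrightarrow> last (scan_gates step C) = scan_gates step C ! (length C - 1)"
proof -
  assume "C \<noteq> []"
  then have "scan_gates step C \<noteq> []" by (metis length_0_conv length_scan_gates)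
  then show ?thesis by (simp add: last_conv_nth)
qed

definition depth_at :: "gate list \<Rightarrow> nat \<Rightarrow> nat" where
  "depth_at C i = scan_gates gate_depth C ! i"

definition weft_at :: "gate list \<Rightarrow> nat \<Rightarrow> nat" where
  "weft_at C i = scan_gates gate_weft C ! i"

definition value_at :: "gate list \<Rightarrow> nat set \<Rightarrow> nat \<Rightarrow> bool" where
  "value_at C S i = scan_gates (gate_value S) C ! i"

context
  fixes C :: "gate list"
  assumes C: "circuit C"
begin

lemma preds_at_less: "i < length C \<Longrightarrow> j \<in> set (preds_at C i) \<Longrightarrow> j < i"
  using C by (auto simp: circuit_def preds_at_def nth_default_nth)

lemma preds_at_less_length: "i < length C \<Longrightarrow> j \<in> set (preds_at C i) \<Longrightarrow> j < length C"
  using preds_at_less by fastforce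

lemma preds_at_eq_Nil: "i < length C \<Longrightarrow> preds_at C i = [] \<longleftrightarrow> kind_at C i = 0"
  using C unfolding circuit_def preds_at_def kind_at_def
  by (cases "C ! i") (auto simp: nth_default_nth dest: spec[of _ i])

lemma gate_depth_rec:
  assumes i: "i < length C"
  shows "depth_at C i = (if preds_at C i = [] then 0 else Suc (Max (depth_at C ` set (preds_at C i))))"
proof -
  \<comment> \<open>Predecessors have smaller positions, so truncating the list of results at
    \<open>i\<close> hides none of the entries that are looked up.\<close>
  have "(\<lambda>j. take i (scan_gates gate_depth C) ! j) ` set (preds_at C i) = depth_at C ` set (preds_at C i)"
    using preds_at_less[OF i] by (auto simp: depth_at_def intro!: image_cong)
  then show ?thesis using i
    unfolding depth_at_def[of C i] by (simp add: scan_gates_nth gate_depth_def preds_at_def nth_default_nth)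
qed

lemma gate_weft_rec:
  assumes i: "i < length C"
  shows "weft_at C i = (if preds_at C i = [] then 0
     else (if length (preds_at C i) > 2 then 1 else 0) + Max (weft_at C ` set (preds_at C i)))"
proof -
  have "(\<lambda>j. take i (scan_gates gate_weft C) ! j) ` set (preds_at C i) = weft_at C ` set (preds_at C i)"
    using preds_at_less[OF i] by (auto simp: weft_at_def intro!: image_cong)
  then show ?thesis using i
    unfolding weft_at_def[of C i] by (simp add: scan_gates_nth gate_weft_def preds_at_def nth_default_nth)
qed

lemma depth_le_iff: "i < length C \<Longrightarrow> depth_le h C i \<longleftrightarrow> depth_at C i \<le> h"
proof (induction h arbitrary: i)
  case 0
  then show ?case by (simp add: gate_depth_rec)
next
  case (Suc h)
  have "depth_le h C j \<longleftrightarrow> depth_at C j \<le> h" if "j \<in> set (preds_at C i)" for j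
    using Suc preds_at_less_length that by blast
  then show ?case using gate_depth_rec[OF Suc.prems] by auto
qed

text \<open>\<open>weft0 h\<close> inspects only \<open>h\<close> levels; the depth bound ensures
  that nothing lies below them.\<close>

lemma weft0_iff: "i < length C \<Longrightarrow> depth_le h C i \<Longrightarrow> weft0 h C i \<longleftrightarrow> weft_at C i = 0"
proof (induction h arbitrary: i)
  case 0
  then show ?case by (simp add: gate_weft_rec)
next
  case (Suc h)
  have "weft0 h C j \<longleftrightarrow> weft_at C j = 0" if "j \<in> set (preds_at C i)" for j
    using Suc preds_at_less_length that by auto
  moreover have "Max (weft_at C ` set (preds_at C i)) = 0 \<longleftrightarrow> (\<forall>j\<in>set (preds_at C i). weft_at C j = 0)" if "preds_at C i \<noteq> []"
    using Max_le_iff[of "weft_at C ` set (preds_at C i)" 0] that by auto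
  ultimately show ?case using gate_weft_rec[OF Suc.prems(1)] by (cases "preds_at C i = []") auto
qed

text \<open>A large gate spends the only unit of weft, so the gates that feed it must have weft
  zero.\<close>

lemma weft1_iff: "i < length C \<Longrightarrow> depth_le h C i \<Longrightarrow> weft1 h C i \<longleftrightarrow> weft_at C i \<le> 1"
proof (induction h arbitrary: i)
  case 0
  then show ?case by (simp add: gate_weft_rec)
next
  case (Suc h)
  have 1: "weft1 h C j \<longleftrightarrow> weft_at C j \<le> 1" "weft0 h C j \<longleftrightarrow> weft_at C j = 0" if "j \<in> set (preds_at C i)" for j
    using Suc preds_at_less_length weft0_iff that by auto
  show ?case
  proof (cases "preds_at C i = []")
    case False
    have "Max (weft_at C ` set (preds_at C i)) \<le> n \<longleftrightarrow> (\<forall>j\<in>set (preds_at C i). weft_at C j \<le> n)" for n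
      using False by (subst Max_le_iff) auto
    from this[of 0] this[of 1] show ?thesis
      using gate_weft_rec[OF Suc.prems(1)] False 1 by auto
  qed (use gate_weft_rec[OF Suc.prems(1)] in auto)
qed

lemma value_at_Input: "i < length C \<Longrightarrow> kind_at C i = 0 \<Longrightarrow> value_at C S i \<longleftrightarrow> i \<in> S"
  unfolding value_at_def kind_at_def by (cases "C ! i") (auto simp: scan_gates_nth nth_default_nth)

lemma value_at_Not: "i < length C \<Longrightarrow> kind_at C i = 1 \<Longrightarrow> \<exists>j. preds_at C i = [j] \<and> value_at C S i = (\<not> value_at C S j)"
  using preds_at_less[of i] unfolding value_at_def kind_at_def preds_at_def
  by (cases "C ! i") (auto simp: scan_gates_nth nth_default_nth)

text \<open>A true conjunction and a false disjunction are both universal statements about the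
  predecessors, the two other combinations are existential ones. The test
  \<open>(kind_at C i = 2) = b\<close> separates the two kinds and makes a treatment of De Morgan
  duals unnecessary.\<close>

lemma value_at_AndOr:
  assumes i: "i < length C" "kind_at C i \<noteq> 0" "kind_at C i \<noteq> 1"
  shows "value_at C S i = b \<longleftrightarrow>
    (if (kind_at C i = 2) = b then \<forall>j\<in>set (preds_at C i). value_at C S j = b else \<exists>j\<in>set (preds_at C i). value_at C S j = b)"
proof (cases "C ! i")
  case (AndG js)
  then have "preds_at C i = js" "kind_at C i = 2" using i by (auto simp: preds_at_def kind_at_def nth_default_nth)
  moreover have "value_at C S i \<longleftrightarrow> (\<forall>j\<in>set js. value_at C S j)"
    using preds_at_less[OF i(1)] \<open>preds_at C i = js\<close> AndG i unfolding value_at_def by (auto simp: scan_gates_nth)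
  ultimately show ?thesis by (cases b) auto
next
  case (OrG js)
  then have "preds_at C i = js" "kind_at C i = 3" using i by (auto simp: preds_at_def kind_at_def nth_default_nth)
  moreover have "value_at C S i \<longleftrightarrow> (\<exists>j\<in>set js. value_at C S j)"
    using preds_at_less[OF i(1)] \<open>preds_at C i = js\<close> OrG i unfolding value_at_def by (auto simp: scan_gates_nth)
  ultimately show ?thesis by (cases b) auto
qed (use i in \<open>auto simp: kind_at_def nth_default_nth\<close>)

end

text \<open>A claim \<open>(g, b)\<close> states that gate \<open>g\<close> has value \<open>b\<close>. A claim about a gate of weft at most
  one is a disjunction of conjunctions of claims about gates of weft zero. The disjunctions have
  polynomial size since conjunctions are only distributed over the small gates.\<close>

primrec alts :: "nat \<Rightarrow> gate list \<Rightarrow> nat \<Rightarrow> bool \<Rightarrow> (nat \<times> bool) list list" where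
  "alts 0 C g b = [[(g, b)]]"
| "alts (Suc h) C g b =
    (if kind_at C g = 0 then [[(g, b)]]
     else if kind_at C g = 1 then concat (map (\<lambda>j. alts h C j (\<not> b)) (preds_at C g))
     else if (kind_at C g = 2) = b then
       (if length (preds_at C g) \<le> 2 then
          concat (map (\<lambda>x. map (\<lambda>y. x @ y) (alts h C (hd_default 0 (rev (preds_at C g))) b)) (alts h C (hd_default 0 (preds_at C g)) b))
        else [map (\<lambda>j. (j, b)) (preds_at C g)])
     else concat (map (\<lambda>j. alts h C j b) (preds_at C g)))"

text \<open>First and last element exhaust a list of length at most two and coincide for a
  singleton, so the product in \<open>alts\<close> treats fan-in one and two alike.\<close>

lemma length_le_2_set:
  assumes "xs \<noteq> []" "length xs \<le> 2"
  shows "set xs = {hd_default d xs, hd_default d (rev xs)}"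
proof (cases xs)
  case (Cons x ys)
  then show ?thesis using assms by (cases ys) (auto simp: hd_default_def)
qed (use assms in simp)

lemma weft0_mono: "weft0 h C i \<Longrightarrow> weft1 h C i"
  by (induction h arbitrary: i) auto

lemma depth_le_Suc: "depth_le h C i \<Longrightarrow> depth_le (Suc h) C i"
proof (induction h arbitrary: i)
  case (Suc h)
  then show ?case by (metis depth_le.simps(2))
qed simp

lemma weft0_Suc: "depth_le h C i \<Longrightarrow> weft0 h C i \<Longrightarrow> weft0 (Suc h) C i"
proof (induction h arbitrary: i)
  case (Suc h)
  then show ?case by (metis depth_le.simps(2) weft0.simps(2))
qed simp

text \<open>The expansion stops at inputs, at level zero, or at the predecessors of a large gate
  with a universal claim. In the last case the unit of weft is spent, so these predecessors have
  weft zero.\<close>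

lemma alts_claims:
  assumes C: "circuit C"
  shows "i < length C \<Longrightarrow> depth_le h C i \<Longrightarrow> weft1 h C i \<Longrightarrow> x \<in> set (alts h C i b) \<Longrightarrow> (j, c) \<in> set x \<Longrightarrow>
    j < length C \<and> depth_le h C j \<and> weft0 h C j"
proof (induction h arbitrary: i b x)
  case 0
  then show ?case by simp
next
  case (Suc h)
  have up: "j < length C \<and> depth_le h C j \<and> weft0 h C j \<Longrightarrow> ?case"
    using depth_le_Suc weft0_Suc by blast
  have kid: "j' < length C \<and> depth_le h C j' \<and> weft1 h C j'" if "j' \<in> set (preds_at C i)" for j'
    using Suc.prems that preds_at_less_length[OF C] by (auto split: if_splits dest: weft0_mono)
  note IH = Suc.IH[OF _ _ _ _ Suc.prems(5)]
  consider "kind_at C i = 0" | "kind_at C i = 1" | "kind_at C i \<noteq> 0" "kind_at C i \<noteq> 1" "(kind_at C i = 2) \<noteq> b"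
    | "kind_at C i \<noteq> 0" "kind_at C i \<noteq> 1" "(kind_at C i = 2) = b" "length (preds_at C i) \<le> 2"
    | "kind_at C i \<noteq> 0" "kind_at C i \<noteq> 1" "(kind_at C i = 2) = b" "\<not> length (preds_at C i) \<le> 2" by blast
  then show ?case
  proof cases
    case 1
    then have "preds_at C i = []" using preds_at_eq_Nil[OF C] Suc.prems by simp
    then show ?thesis using 1 Suc.prems by auto
  next
    case 2
    then obtain j' where "j' \<in> set (preds_at C i)" "x \<in> set (alts h C j' (\<not> b))" using Suc.prems by auto
    then show ?thesis using IH kid up by blast
  next
    case 3
    then obtain j' where "j' \<in> set (preds_at C i)" "x \<in> set (alts h C j' b)" using Suc.prems by auto
    then show ?thesis using IH kid up by blast
  next
    case 4
    then have ne: "preds_at C i \<noteq> []" using preds_at_eq_Nil[OF C] Suc.prems by simp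
    let ?l = "hd_default 0 (preds_at C i)" and ?r = "hd_default 0 (rev (preds_at C i))"
    have lr: "?l \<in> set (preds_at C i)" "?r \<in> set (preds_at C i)"
      using length_le_2_set[OF ne 4(4), of 0] by auto
    obtain y z where yz: "y \<in> set (alts h C ?l b)" "z \<in> set (alts h C ?r b)" "x = y @ z"
      using 4 Suc.prems by auto
    then have "(j, c) \<in> set y \<or> (j, c) \<in> set z" using Suc.prems(5) by auto
    then show ?thesis using Suc.IH yz kid lr up by blast
  next
    case 5
    then have "j \<in> set (preds_at C i)" using Suc.prems by auto
    then show ?thesis using Suc.prems 5 kid up by auto
  qed
qed

text \<open>Existential claims collect the alternatives of all predecessors. A universal claim about
  a small gate distributes the conjunction over the alternatives of its first and last
  predecessor.\<close>

lemma alts_value_at: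
  assumes C: "circuit C"
  shows "i < length C \<Longrightarrow> depth_le h C i \<Longrightarrow>
    (value_at C S i = b) \<longleftrightarrow> (\<exists>x\<in>set (alts h C i b). \<forall>(j, c)\<in>set x. value_at C S j = c)"
proof (induction h arbitrary: i b)
  case 0
  then show ?case by simp
next
  case (Suc h)
  have IH: "(value_at C S j = c) \<longleftrightarrow> (\<exists>x\<in>set (alts h C j c). \<forall>(j, c)\<in>set x. value_at C S j = c)"
    if "j \<in> set (preds_at C i)" for j c
    using Suc preds_at_less_length[OF C] that by auto
  consider "kind_at C i = 0" | "kind_at C i = 1" | "kind_at C i \<noteq> 0" "kind_at C i \<noteq> 1" "(kind_at C i = 2) \<noteq> b"
    | "kind_at C i \<noteq> 0" "kind_at C i \<noteq> 1" "(kind_at C i = 2) = b" "length (preds_at C i) \<le> 2"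
    | "kind_at C i \<noteq> 0" "kind_at C i \<noteq> 1" "(kind_at C i = 2) = b" "\<not> length (preds_at C i) \<le> 2" by blast
  then show ?case
  proof cases
    case 1
    then show ?thesis by simp
  next
    case 2
    then obtain j where "preds_at C i = [j]" "value_at C S i = (\<not> value_at C S j)" using value_at_Not[OF C Suc.prems(1)] by blast
    then show ?thesis using IH[of j "\<not> b"] 2 by auto
  next
    case 3
    then have "value_at C S i = b \<longleftrightarrow> (\<exists>j\<in>set (preds_at C i). value_at C S j = b)"
      using value_at_AndOr[OF C Suc.prems(1), of S b] by simp
    also have "\<dots> \<longleftrightarrow> (\<exists>j\<in>set (preds_at C i). \<exists>x\<in>set (alts h C j b). \<forall>(j, c)\<in>set x. value_at C S j = c)"
      using IH by (intro bex_cong refl)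
    finally show ?thesis using 3 by auto
  next
    case 4
    then have ne: "preds_at C i \<noteq> []" using preds_at_eq_Nil[OF C] Suc.prems by simp
    let ?l = "hd_default 0 (preds_at C i)" and ?r = "hd_default 0 (rev (preds_at C i))"
    have lr: "set (preds_at C i) = {?l, ?r}" using length_le_2_set[OF ne 4(4)] .
    have "value_at C S i = b \<longleftrightarrow> (\<forall>j\<in>set (preds_at C i). value_at C S j = b)"
      using 4 value_at_AndOr[OF C Suc.prems(1), of S b] by simp
    also have "\<dots> \<longleftrightarrow> value_at C S ?l = b \<and> value_at C S ?r = b" using lr by auto
    also have "\<dots> \<longleftrightarrow> (\<exists>x\<in>set (alts h C ?l b). \<forall>(j, c)\<in>set x. value_at C S j = c) \<and>
        (\<exists>x\<in>set (alts h C ?r b). \<forall>(j, c)\<in>set x. value_at C S j = c)"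
      using IH lr by (intro arg_cong2[of _ _ _ _ "(\<and>)"]) auto
    also have "\<dots> \<longleftrightarrow> (\<exists>x\<in>set (alts h C ?l b). \<exists>y\<in>set (alts h C ?r b). \<forall>(j, c)\<in>set (x @ y). value_at C S j = c)"
      by (simp add: ball_Un)
    finally show ?thesis using 4 by simp
  next
    case 5
    then show ?thesis using value_at_AndOr[OF C Suc.prems(1), of S b] by simp
  qed
qed

section \<open>Certificates for assignments of weight \<open>k\<close>\<close>

text \<open>The list of the elements of \<open>S\<close> in increasing order, shifted by one and enclosed by the sentinels \<open>0\<close>
  and \<open>n + 1\<close>: a pair of consecutive entries witnesses that the numbers in between are not in
  \<open>S\<close>, so that also negative facts about \<open>S\<close> have certificates of constant size.\<close>

definition gapseq :: "nat \<Rightarrow> nat \<Rightarrow> (nat \<Rightarrow> nat) \<Rightarrow> nat set \<Rightarrow> bool" where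
  "gapseq n k s S \<longleftrightarrow> s 0 = 0 \<and> s (Suc k) = Suc n \<and> (\<forall>i j. i < j \<longrightarrow> j \<le> Suc k \<longrightarrow> s i < s j) \<and>
     S = {a. \<exists>i<k. s (Suc i) = Suc a}"

definition input_forced :: "(nat \<times> nat) list \<Rightarrow> nat \<Rightarrow> bool \<Rightarrow> bool" where
  "input_forced w g b \<longleftrightarrow> (if b then \<exists>p\<in>set w. snd p = Suc g
     else \<exists>p\<in>set w. \<exists>q\<in>set w. fst q = Suc (fst p) \<and> snd p < Suc g \<and> Suc g < snd q)"

text \<open>Evaluation under partial information: the entries in \<open>w\<close> may force a gate
  neither to true nor to false. Carrying the desired value \<open>b\<close> along, instead of
  negating results, keeps the recursion positive.\<close>

primrec forced :: "nat \<Rightarrow> gate list \<Rightarrow> (nat \<times> nat) list \<Rightarrow> nat \<Rightarrow> bool \<Rightarrow> bool" where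
  "forced 0 C w g b \<longleftrightarrow> input_forced w g b"
| "forced (Suc h) C w g b \<longleftrightarrow>
    (if kind_at C g = 0 then input_forced w g b
     else if kind_at C g = 1 then \<forall>j\<in>set (preds_at C g). forced h C w j (\<not> b)
     else if (kind_at C g = 2) = b then \<forall>j\<in>set (preds_at C g). forced h C w j b
     else \<exists>j\<in>set (preds_at C g). forced h C w j b)"

lemma input_forced_mono: "input_forced w g b \<Longrightarrow> set w \<subseteq> set w' \<Longrightarrow> input_forced w' g b"
  unfolding input_forced_def by (cases b) (simp_all, blast+)

text \<open>A negation gate only flips the desired value, so \<open>forced\<close> never occurs
  negatively in its own recursion. This permits padding certificates to a common length and
  concatenating them.\<close>

lemma forced_mono: "forced h C w g b \<Longrightarrow> set w \<subseteq> set w' \<Longrightarrow> forced h C w' g b"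
proof (induction h arbitrary: g b)
  case 0
  then show ?case using input_forced_mono by simp
next
  case (Suc h)
  then show ?case using input_forced_mono[of w g b w'] by (auto split: if_splits)
qed

lemma input_forced_sound:
  assumes s: "gapseq n k s S" and w: "\<forall>p\<in>set w. fst p \<le> Suc k \<and> snd p = s (fst p)"
    and g: "g < n" and input_forced: "input_forced w g b"
  shows "g \<in> S \<longleftrightarrow> b"
proof (cases b)
  case True
  then obtain p where p: "p \<in> set w" "snd p = Suc g" using input_forced by (auto simp: input_forced_def)
  then have "s (fst p) = Suc g" "fst p \<le> Suc k" using w by auto
  \<comment> \<open>The sentinel values 0 and \<open>Suc n\<close> both differ from
    \<open>Suc g\<close>, so the witness sits at one of the \<open>k\<close> inner
    positions.\<close>
  moreover have "s 0 = 0" "s (Suc k) = Suc n" using s by (auto simp: gapseq_def)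
  then have "fst p \<noteq> 0" "fst p \<noteq> Suc k" using calculation g by (metis nat.distinct(1), metis nat.inject less_irrefl)
  ultimately have "fst p - 1 < k" "s (Suc (fst p - 1)) = Suc g" by auto
  then show ?thesis using s True unfolding gapseq_def by blast
next
  case False
  then obtain p q where pq: "p \<in> set w" "q \<in> set w" "fst q = Suc (fst p)" "snd p < Suc g" "Suc g < snd q"
    using input_forced by (auto simp: input_forced_def)
  let ?i = "fst p"
  have "fst q \<le> Suc k" "snd p = s (fst p)" "snd q = s (fst q)" using pq w by auto
  then have i: "Suc ?i \<le> Suc k" "s ?i < Suc g" "Suc g < s (Suc ?i)" using pq by auto
  have mono: "i < j \<Longrightarrow> j \<le> Suc k \<Longrightarrow> s i < s j" for i j using s by (auto simp: gapseq_def)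
  \<comment> \<open>Entries up to position \<open>?i\<close> are too small and those from
    \<open>Suc ?i\<close> on are too large.\<close>
  have "s (Suc j) \<noteq> Suc g" if "j < k" for j
  proof (cases "Suc j \<le> ?i")
    case True
    then have "s (Suc j) \<le> s ?i" using mono[of "Suc j" ?i] i by (cases "Suc j = ?i") auto
    then show ?thesis using i by simp
  next
    case False
    then have "s (Suc ?i) \<le> s (Suc j)" using mono[of "Suc ?i" "Suc j"] that by (cases "Suc j = Suc ?i") auto
    then show ?thesis using i by simp
  qed
  then show ?thesis using s False by (auto simp: gapseq_def)
qed

lemma input_forced_complete:
  assumes s: "gapseq n k s S" and g: "g < n" and b: "g \<in> S \<longleftrightarrow> b"
  shows "\<exists>i j. i \<le> Suc k \<and> j \<le> Suc k \<and> input_forced [(i, s i), (j, s j)] g b"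
proof (cases b)
  case True
  then obtain i where "i < k" "s (Suc i) = Suc g" using s b by (auto simp: gapseq_def)
  then show ?thesis using True by (intro exI[of _ "Suc i"]) (auto simp: input_forced_def)
next
  case False
  \<comment> \<open>The last position whose entry is still below \<open>Suc g\<close>; together with
    its successor it encloses the missing element. The sentinel 0 guarantees that it exists, the
    upper sentinel that it has a successor.\<close>
  define i where "i = Max {i. i \<le> Suc k \<and> s i < Suc g}"
  have fin: "finite {i. i \<le> Suc k \<and> s i < Suc g}" by simp
  have "0 \<in> {i. i \<le> Suc k \<and> s i < Suc g}" using s by (simp add: gapseq_def)
  then have i: "i \<le> Suc k" "s i < Suc g" using Max_in[OF fin] unfolding i_def by blast+
  have "i \<noteq> Suc k" using i s g by (auto simp: gapseq_def)
  then have ik: "i \<le> k" using i by simp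
  have "\<not> s (Suc i) < Suc g"
    using Max_ge[OF fin, of "Suc i"] ik unfolding i_def[symmetric] by auto
  moreover have "s (Suc i) \<noteq> Suc g"
  proof (cases "i = k")
    case True
    then show ?thesis using s g by (simp add: gapseq_def)
  next
    case False
    then show ?thesis using s b \<open>\<not> b\<close> ik by (auto simp: gapseq_def)
  qed
  ultimately have "Suc g < s (Suc i)" by simp
  then show ?thesis using False i ik by (intro exI[of _ i] exI[of _ "Suc i"]) (auto simp: input_forced_def)
qed

section \<open>Gap sequences of sets of cardinality \<open>k\<close>\<close>

lemma ex_gapseq:
  assumes "S \<subseteq> {..<n}" "card S = k"
  shows "\<exists>s. gapseq n k s S"
proof -
  have fin: "finite S" using assms finite_subset by blast
  let ?l = "sorted_list_of_set S"
  have len: "length ?l = k" using assms by simp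
  have set: "set ?l = S" using fin by simp
  define s where "s = (\<lambda>i. if i = 0 then 0 else if i \<le> k then Suc (?l ! (i - 1)) else Suc n)"
  have "s i < s j" if ij: "i < j" "j \<le> Suc k" for i j
  proof -
    have lt: "?l ! a < n" if "a < k" for a using that len set assms(1) nth_mem by fastforce
    have "?l ! (i - 1) < ?l ! (j - 1)" if "0 < i" "j \<le> k"
      using strict_sorted_list_of_set[of S] ij that len unfolding sorted_wrt_iff_nth_less by auto
    then show ?thesis using ij lt[of "i - 1"] unfolding s_def by auto
  qed
  moreover have "S = {a. \<exists>i<k. s (Suc i) = Suc a}"
  proof -
    have "a \<in> S \<longleftrightarrow> (\<exists>i<k. ?l ! i = a)" for a using set len by (metis in_set_conv_nth)
    then show ?thesis by (auto simp: s_def Suc_le_eq)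
  qed
  ultimately show ?thesis unfolding gapseq_def by (intro exI[of _ s]) (auto simp: s_def)
qed

lemma gapseq_card:
  assumes "gapseq n k s S"
  shows "card S = k"
proof -
  have mono: "i < j \<Longrightarrow> j \<le> Suc k \<Longrightarrow> s i < s j" for i j using assms by (auto simp: gapseq_def)
  have pos: "i < k \<Longrightarrow> 0 < s (Suc i)" for i using mono[of 0 "Suc i"] by simp
  have "S = (\<lambda>i. s (Suc i) - 1) ` {..<k}"
  proof -
    have "S = {a. \<exists>i<k. s (Suc i) = Suc a}" using assms by (simp add: gapseq_def)
    also have "\<dots> = (\<lambda>i. s (Suc i) - 1) ` {..<k}" using pos by (force simp: image_iff)
    finally show ?thesis .
  qed
  moreover have "inj_on (\<lambda>i. s (Suc i) - 1) {..<k}"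
  proof (rule linorder_inj_onI')
    fix i j assume "i \<in> {..<k}" "j \<in> {..<k}" "i < j"
    then show "s (Suc i) - 1 \<noteq> s (Suc j) - 1"
      using mono[of "Suc i" "Suc j"] pos[of i] by auto
  qed
  ultimately show ?thesis by (simp add: card_image)
qed

section \<open>Forced values of gates of weft zero\<close>

lemma forced_sound:
  assumes C: "circuit C" and s: "gapseq (length C) k s S"
    and w: "\<forall>p\<in>set w. fst p \<le> Suc k \<and> snd p = s (fst p)"
  shows "i < length C \<Longrightarrow> depth_le h C i \<Longrightarrow> forced h C w i b \<Longrightarrow> value_at C S i = b"
proof (induction h arbitrary: i b)
  case 0
  then show ?case using input_forced_sound[OF s w] value_at_Input[OF C] preds_at_eq_Nil[OF C] by simp
next
  case (Suc h)
  have IH: "forced h C w j c \<Longrightarrow> value_at C S j = c" if "j \<in> set (preds_at C i)" for j c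
    using Suc preds_at_less_length[OF C] that by auto
  consider "kind_at C i = 0" | "kind_at C i = 1" | "kind_at C i \<noteq> 0" "kind_at C i \<noteq> 1" by blast
  then show ?case
  proof cases
    case 1
    then show ?thesis using input_forced_sound[OF s w] value_at_Input[OF C] Suc.prems by simp
  next
    case 2
    then obtain j where "preds_at C i = [j]" "value_at C S i = (\<not> value_at C S j)" using value_at_Not[OF C Suc.prems(1)] by blast
    then show ?thesis using IH[of j "\<not> b"] 2 Suc.prems by auto
  next
    case 3
    then show ?thesis using value_at_AndOr[OF C Suc.prems(1), of S b] Suc.prems(3) IH by (auto split: if_splits)
  qed
qed

text \<open>Two entries certify an input, and each level doubles the length: a universal claim about
  a small gate joins the certificates of both predecessors, every other case repeats what it has.
  The length is exact because all vertices of the reduction are tuples of one common length.\<close>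

lemma forced_complete:
  assumes C: "circuit C" and s: "gapseq (length C) k s S"
  shows "i < length C \<Longrightarrow> depth_le h C i \<Longrightarrow> weft0 h C i \<Longrightarrow> value_at C S i = b \<Longrightarrow>
    \<exists>p. length p = 2 ^ Suc h \<and> set p \<subseteq> {..Suc k} \<and> forced h C (map (\<lambda>i. (i, s i)) p) i b"
proof (induction h arbitrary: i b)
  case 0
  then have "i \<in> S \<longleftrightarrow> b" using value_at_Input[OF C] preds_at_eq_Nil[OF C] by simp
  from input_forced_complete[OF s 0(1) this] obtain a c where "a \<le> Suc k" "c \<le> Suc k" "input_forced [(a, s a), (c, s c)] i b"
    by blast
  then show ?case by (intro exI[of _ "[a, c]"]) auto
next
  case (Suc h)
  have IH: "\<exists>p. length p = 2 ^ Suc h \<and> set p \<subseteq> {..Suc k} \<and> forced h C (map (\<lambda>i. (i, s i)) p) j c"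
    if "j \<in> set (preds_at C i)" "value_at C S j = c" for j c
    using Suc that preds_at_less_length[OF C] by (intro Suc.IH) auto
  consider "kind_at C i = 0" | "kind_at C i = 1" | "kind_at C i \<noteq> 0" "kind_at C i \<noteq> 1" "(kind_at C i = 2) \<noteq> b"
    | "kind_at C i \<noteq> 0" "kind_at C i \<noteq> 1" "(kind_at C i = 2) = b" by blast
  then show ?case
  proof cases
    case 1
    then have "i \<in> S \<longleftrightarrow> b" using value_at_Input[OF C] Suc.prems by simp
    from input_forced_complete[OF s Suc.prems(1) this] obtain a c where
      ac: "a \<le> Suc k" "c \<le> Suc k" "input_forced [(a, s a), (c, s c)] i b" by blast
    let ?p = "replicate (2 ^ Suc h) a @ replicate (2 ^ Suc h) c"
    have "input_forced (map (\<lambda>i. (i, s i)) ?p) i b" by (rule input_forced_mono[OF ac(3)]) simp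
    then show ?thesis using 1 ac by (intro exI[of _ ?p]) auto
  next
    case 2
    then obtain j where j: "preds_at C i = [j]" "value_at C S i = (\<not> value_at C S j)" using value_at_Not[OF C Suc.prems(1)] by blast
    then obtain p where p: "length p = 2 ^ Suc h" "set p \<subseteq> {..Suc k}" "forced h C (map (\<lambda>i. (i, s i)) p) j (\<not> b)"
      using IH[of j "\<not> b"] Suc.prems by auto
    have "forced h C (map (\<lambda>i. (i, s i)) (p @ p)) j (\<not> b)" by (rule forced_mono[OF p(3)]) simp
    then show ?thesis using p 2 j by (intro exI[of _ "p @ p"]) auto
  next
    case 3
    then obtain j where j: "j \<in> set (preds_at C i)" "value_at C S j = b"
      using value_at_AndOr[OF C Suc.prems(1), of S b] Suc.prems by auto
    then obtain p where p: "length p = 2 ^ Suc h" "set p \<subseteq> {..Suc k}" "forced h C (map (\<lambda>i. (i, s i)) p) j b"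
      using IH[of j b] by blast
    have "forced h C (map (\<lambda>i. (i, s i)) (p @ p)) j b" by (rule forced_mono[OF p(3)]) simp
    then show ?thesis using p 3 j by (intro exI[of _ "p @ p"]) auto
  next
    case 4
    then have ne: "preds_at C i \<noteq> []" using preds_at_eq_Nil[OF C] Suc.prems by simp
    let ?l = "hd_default 0 (preds_at C i)" and ?r = "hd_default 0 (rev (preds_at C i))"
    have lr: "set (preds_at C i) = {?l, ?r}" using length_le_2_set[OF ne] Suc.prems(3) by simp
    have "\<forall>j\<in>set (preds_at C i). value_at C S j = b"
      using 4 value_at_AndOr[OF C Suc.prems(1), of S b] Suc.prems by simp
    then obtain p q where p: "length p = 2 ^ Suc h" "set p \<subseteq> {..Suc k}" "forced h C (map (\<lambda>i. (i, s i)) p) ?l b"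
      and q: "length q = 2 ^ Suc h" "set q \<subseteq> {..Suc k}" "forced h C (map (\<lambda>i. (i, s i)) q) ?r b"
      using IH[of ?l b] IH[of ?r b] lr by blast
    have "forced h C (map (\<lambda>i. (i, s i)) (p @ q)) ?l b" by (rule forced_mono[OF p(3)]) simp
    moreover have "forced h C (map (\<lambda>i. (i, s i)) (p @ q)) ?r b" by (rule forced_mono[OF q(3)]) simp
    ultimately have "\<forall>j\<in>set (preds_at C i). forced h C (map (\<lambda>i. (i, s i)) (p @ q)) j b" using lr by simp
    then show ?thesis using p q 4 by (intro exI[of _ "p @ q"]) auto
  qed
qed

section \<open>The reduction\<close>

text \<open>\<open>(i, a)\<close> states that the \<open>i\<close>-th entry of the gap sequence is \<open>a\<close>.\<close>

definition items :: "gate list \<Rightarrow> nat \<Rightarrow> (nat \<times> nat) list" where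
  "items C k = (0, 0) # (Suc k, Suc (length C)) #
     concat (map (\<lambda>i. map (\<lambda>a. (Suc i, Suc a)) (filter (\<lambda>a. kind_at C a = 0) [0..<length C])) [0..<k])"

definition out_gate :: "gate list \<Rightarrow> nat" where
  "out_gate C = hd_default 0 (rev [0..<length C])"

text \<open>The reduction has to reject malformed inputs by itself, so the conditions on the circuit
  are restated with quantifiers over lists and with predicates recursive in
  \<open>h\<close>.\<close>

definition circ_ok :: "nat \<Rightarrow> gate list \<Rightarrow> bool" where
  "circ_ok h C \<longleftrightarrow> C \<noteq> [] \<and>
     (\<forall>i\<in>set [0..<length C]. (kind_at C i \<noteq> 0 \<longrightarrow> preds_at C i \<noteq> []) \<and> (\<forall>j\<in>set (preds_at C i). j < i)) \<and>
     depth_le h C (out_gate C) \<and> weft1 h C (out_gate C)"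

text \<open>A tuple is only asked not to refute a claim, for it rarely determines one. Across all
  tuples of a solution a false claim would be refuted somewhere.\<close>

definition tuple_ok :: "nat \<Rightarrow> gate list \<Rightarrow> (nat \<times> bool) list \<Rightarrow> (nat \<times> nat) list \<Rightarrow> bool" where
  "tuple_ok h C x w \<longleftrightarrow>
     (\<forall>p\<in>set w. \<forall>q\<in>set w. (fst p < fst q \<longrightarrow> snd p < snd q) \<and> (fst p = fst q \<longrightarrow> snd p = snd q)) \<and>
     (\<forall>c\<in>set x. \<not> forced h C w (fst c) (\<not> snd c))"

type_synonym cand = "(nat \<times> bool) list \<times> (nat \<times> nat) list"

text \<open>For a malformed circuit there are no candidates, hence no solution, as
  \<open>solution_size\<close> is positive.\<close>

definition cands :: "nat \<Rightarrow> gate list \<Rightarrow> nat \<Rightarrow> cand list" where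
  "cands h C k = concat (map (\<lambda>x. map (\<lambda>w. (x, w))
       (filter (tuple_ok h C x) (List.n_lists (2 ^ Suc h) (items C k))))
     (if circ_ok h C then alts h C (out_gate C) True else []))"

text \<open>Candidates with the same positions conflict, so that the candidates in an independent set are
  determined by their positions even if the list of candidates has repetitions.\<close>

definition conflict :: "cand \<Rightarrow> cand \<Rightarrow> bool" where
  "conflict v v' \<longleftrightarrow> fst v \<noteq> fst v' \<or> map fst (snd v) = map fst (snd v') \<or>
     (\<exists>p\<in>set (snd v). \<exists>q\<in>set (snd v'). fst p = fst q \<and> snd p \<noteq> snd q)"

definition conflict_graph :: "cand list \<Rightarrow> instance_is" where
  "conflict_graph vs = ([0..<length vs], concat (map (\<lambda>i. map (\<lambda>j. ([(i, j)], True))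
     (filter (\<lambda>j. i \<noteq> j \<and> conflict (nth_default ([], []) vs i) (nth_default ([], []) vs j)) [0..<length vs])) [0..<length vs]))"

text \<open>Given as the length of a list, this number is computable with the rules for lists,
  without arithmetic.\<close>

definition solution_size :: "nat \<Rightarrow> nat \<Rightarrow> nat" where
  "solution_size h k = length (List.n_lists (2 ^ Suc h) [0..<Suc (Suc k)])"

lemma solution_size_eq: "solution_size h k = (k + 2) ^ (2 ^ Suc h)"
  by (simp add: solution_size_def length_n_lists)

section \<open>Instances given by conflict graphs\<close>

lemma samples_conflict_graph:
  "(es, l) \<in> set (samples (conflict_graph vs)) \<longleftrightarrow>
   l \<and> (\<exists>i j. es = [(i, j)] \<and> i < length vs \<and> j < length vs \<and> i \<noteq> j \<and> conflict (vs ! i) (vs ! j))"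
  (is "_ \<longleftrightarrow> ?R")
proof
  assume ?R
  then obtain i j where "l" "es = [(i, j)]" "i < length vs" "j < length vs" "i \<noteq> j" "conflict (vs ! i) (vs ! j)"
    by blast
  then show "(es, l) \<in> set (samples (conflict_graph vs))"
    unfolding samples_def conflict_graph_def
    by (auto simp: nth_default_nth intro!: bexI[of _ i] image_eqI[of _ _ j])
qed (auto simp: samples_def conflict_graph_def nth_default_nth)

lemma vertices_conflict_graph: "vertices (conflict_graph vs) = {..<length vs}"
  by (auto simp: vertices_def conflict_graph_def)

lemma valid_conflict_graph: "valid_instance 1 (conflict_graph vs)"
proof -
  have "degree {e} v \<le> 1" for e v
    unfolding degree_def by (rule order_trans[OF card_mono[of "{e}"]]) auto
  then show ?thesis
    unfolding valid_instance_def
    by (auto simp: samples_conflict_graph vertices_conflict_graph simple_graph_def edges_def)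
      (auto simp: conflict_graph_def)
qed

lemma num_negative_conflict_graph: "num_negative (conflict_graph vs) = 0"
proof -
  have "filter (\<lambda>(es, l). \<not> l) (samples (conflict_graph vs)) = []"
    by (auto simp: filter_empty_conv samples_conflict_graph)
  then show ?thesis by (simp add: num_negative_def)
qed

lemma consistent_conflict_graph:
  "consistent K (conflict_graph vs) X \<longleftrightarrow> X \<subseteq> {..<length vs} \<and> card X = K \<and>
     (\<forall>i\<in>X. \<forall>j\<in>X. i \<noteq> j \<longrightarrow> \<not> conflict (vs ! i) (vs ! j))"
proof -
  have "(\<forall>(es, l)\<in>set (samples (conflict_graph vs)). independent_set (vertices (conflict_graph vs)) (edges es) X \<longleftrightarrow> l)
    \<longleftrightarrow> (\<forall>i\<in>X. \<forall>j\<in>X. i \<noteq> j \<longrightarrow> \<not> conflict (vs ! i) (vs ! j))" (is "?L \<longleftrightarrow> ?R") if X: "X \<subseteq> {..<length vs}"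
  proof
    assume L: ?L
    show ?R
    proof (intro ballI impI notI)
      fix i j assume ij: "i \<in> X" "j \<in> X" "i \<noteq> j" "conflict (vs ! i) (vs ! j)"
      then have "([(i, j)], True) \<in> set (samples (conflict_graph vs))"
        using X by (auto simp: samples_conflict_graph)
      then have "independent_set (vertices (conflict_graph vs)) (edges [(i, j)]) X" using L by fast
      then show False using ij by (auto simp: independent_set_def edges_def)
    qed
  next
    assume R: ?R
    show ?L
    proof (clarify)
      fix es l assume "(es, l) \<in> set (samples (conflict_graph vs))"
      then obtain i j where ij: "l" "es = [(i, j)]" "i \<noteq> j" "conflict (vs ! i) (vs ! j)"
        by (auto simp: samples_conflict_graph)
      have "{u, v} \<noteq> {i, j}" if "u \<in> X" "v \<in> X" for u v
        using R ij that by (auto simp: doubleton_eq_iff)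
      then show "independent_set (vertices (conflict_graph vs)) (edges es) X \<longleftrightarrow> l"
        using ij X by (auto simp: independent_set_def edges_def vertices_conflict_graph)
    qed
  qed
  then show ?thesis unfolding consistent_def vertices_conflict_graph by blast
qed

lemma out_gate_eq: "C \<noteq> [] \<Longrightarrow> out_gate C = length C - 1"
  by (cases C rule: rev_cases) (auto simp: out_gate_def hd_default_def)

lemma circ_ok_iff:
  "circ_ok h C \<longleftrightarrow> circuit C \<and> circuit_weft C \<le> 1 \<and> circuit_depth C \<le> h"
proof -
  have eq: "C \<noteq> [] \<and> (\<forall>i\<in>set [0..<length C]. (kind_at C i \<noteq> 0 \<longrightarrow> preds_at C i \<noteq> []) \<and> (\<forall>j\<in>set (preds_at C i). j < i))
    \<longleftrightarrow> circuit C"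
  proof -
    have "kind_at C i \<noteq> 0 \<longleftrightarrow> C ! i \<noteq> Input" if "i < length C" for i
      using that by (cases "C ! i") (auto simp: kind_at_def nth_default_nth)
    then show ?thesis by (auto simp: circuit_def preds_at_def nth_default_nth)
  qed
  have "depth_le h C (out_gate C) \<and> weft1 h C (out_gate C) \<longleftrightarrow> circuit_weft C \<le> 1 \<and> circuit_depth C \<le> h"
    if C: "circuit C"
  proof -
    have ne: "C \<noteq> []" using C by (simp add: circuit_def)
    then have lt: "out_gate C < length C" by (simp add: out_gate_eq)
    have "circuit_depth C = depth_at C (out_gate C)" "circuit_weft C = weft_at C (out_gate C)"
      using ne by (auto simp: circuit_depth_def circuit_weft_def depth_at_def weft_at_def out_gate_eq last_scan_gates)
    then show ?thesis using depth_le_iff[OF C lt] weft1_iff[OF C lt] by auto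
  qed
  then show ?thesis unfolding circ_ok_def eq[symmetric] by blast
qed

section \<open>Satisfying assignments and solutions of the conflict graph\<close>

lemma mem_cands:
  "(x, w) \<in> set (cands h C k) \<longleftrightarrow> circ_ok h C \<and> x \<in> set (alts h C (out_gate C) True) \<and>
     length w = 2 ^ Suc h \<and> set w \<subseteq> set (items C k) \<and> tuple_ok h C x w"
  unfolding cands_def by (auto simp: set_n_lists simp del: power_Suc)

lemma mem_items:
  "(i, a) \<in> set (items C k) \<longleftrightarrow> (i = 0 \<and> a = 0) \<or> (i = Suc k \<and> a = Suc (length C)) \<or>
     (\<exists>j<k. \<exists>b<length C. i = Suc j \<and> a = Suc b \<and> kind_at C b = 0)"
  unfolding items_def by auto

text \<open>The solution consists of the restrictions of one gap sequence \<open>s\<close> to all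
  position lists, each paired with the same satisfied disjunct. Restrictions of one sequence never
  disagree, and different position lists give different positions.\<close>

lemma reduction_complete:
  assumes ok: "circ_ok h C" and S: "S \<subseteq> inputs C" "card S = k" "circuit_value C S"
  shows "\<exists>X. consistent (solution_size h k) (conflict_graph (cands h C k)) X"
proof -
  let ?o = "out_gate C" and ?vs = "cands h C k" and ?r = "2 ^ Suc h :: nat"
  have C: "circuit C" using ok by (simp add: circ_ok_iff)
  then have ne: "C \<noteq> []" by (simp add: circuit_def)
  then have lt: "?o < length C" by (simp add: out_gate_eq)
  have do: "depth_le h C ?o" "weft1 h C ?o" using ok by (auto simp: circ_ok_def)
  have "value_at C S ?o = True" using S(3) ne by (simp add: circuit_value_def value_at_def out_gate_eq last_scan_gates)
  then obtain x where x: "x \<in> set (alts h C ?o True)" "\<forall>(j, c)\<in>set x. value_at C S j = c"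
    using alts_value_at[OF C lt do(1), of S True] by blast
  obtain s where s: "gapseq (length C) k s S"
    using ex_gapseq[of S "length C" k] S by (auto simp: inputs_def subset_iff)
  then have mono: "i < j \<Longrightarrow> j \<le> Suc k \<Longrightarrow> s i < s j" for i j by (auto simp: gapseq_def)
  have s0: "s 0 = 0" "s (Suc k) = Suc (length C)" and memS: "a \<in> S \<longleftrightarrow> (\<exists>i<k. s (Suc i) = Suc a)" for a
    using s unfolding gapseq_def by blast+
  define P where "P = {p. set p \<subseteq> {..Suc k} \<and> length p = ?r}"
  define w where "w = map (\<lambda>i. (i, s i))"
  have fw: "map fst (w p) = p" for p by (simp add: w_def o_def)
  have mem: "(x, w p) \<in> set ?vs" if p: "p \<in> P" for p
  proof -
    have g: "\<forall>q\<in>set (w p). fst q \<le> Suc k \<and> snd q = s (fst q)" using p by (auto simp: w_def P_def)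
    have "(i, s i) \<in> set (items C k)" if "i \<le> Suc k" for i
    proof -
      have "i = 0 \<or> i = Suc k \<or> (\<exists>j. i = Suc j \<and> j < k)" using that by (cases i) auto
      then consider "i = 0" | "i = Suc k" | j where "i = Suc j" "j < k"  by blast
      then show ?thesis
      proof cases
        case 3
        then have "0 < s i" using mono[of 0 i] that by simp
        then obtain a where a: "s i = Suc a" using gr0_implies_Suc by blast
        then have "a \<in> S" using 3 by (auto simp: memS)
        then have "a < length C" "kind_at C a = 0" using S(1) by (auto simp: inputs_def kind_at_def nth_default_nth)
        then show ?thesis using 3 a by (auto simp: mem_items)
      qed (use s0 in \<open>auto simp: mem_items\<close>)
    qed
    then have sub: "set (w p) \<subseteq> set (items C k)" using p by (auto simp: w_def P_def)
    have 1: "\<not> forced h C (w p) j (\<not> c)" if jc: "(j, c) \<in> set x" for j c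
    proof
      assume "forced h C (w p) j (\<not> c)"
      then have "value_at C S j = (\<not> c)"
        using forced_sound[OF C s g] alts_claims[OF C lt do x(1) jc] by blast
      then show False using x(2) jc by auto
    qed
    have 2: "snd a < snd b" if "a \<in> set (w p)" "b \<in> set (w p)" "fst a < fst b" for a b
      using mono[OF that(3)] g that(1,2) by simp
    have 3: "snd a = snd b" if "a \<in> set (w p)" "b \<in> set (w p)" "fst a = fst b" for a b
      using g that by simp
    have "tuple_ok h C x (w p)" unfolding tuple_ok_def
      by (intro conjI ballI impI) (erule 2 3; assumption | rule 1, simp)+
    then show ?thesis
      using ok x p sub
      by (simp add: mem_cands P_def w_def del: power_Suc)
  qed
  \<comment> \<open>Vertices are indices into a list that may contain a candidate repeatedly, so one
    index is selected for each position list.\<close>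
  have "\<forall>p\<in>P. \<exists>i<length ?vs. ?vs ! i = (x, w p)" using mem by (metis in_set_conv_nth)
  then obtain f where f: "\<And>p. p \<in> P \<Longrightarrow> f p < length ?vs \<and> ?vs ! f p = (x, w p)" by metis
  have "inj_on f P"
  proof (rule inj_onI)
    fix p q assume "p \<in> P" "q \<in> P" "f p = f q"
    then have "w p = w q" using f[of p] f[of q] by simp
    then show "p = q" using fw by metis
  qed
  then have "card (f ` P) = solution_size h k"
    using card_lists_length_eq[of "{..Suc k}" ?r]
    by (simp add: card_image P_def solution_size_eq del: power_Suc)
  moreover have "\<not> conflict (?vs ! f p) (?vs ! f q)" if "p \<in> P" "q \<in> P" "f p \<noteq> f q" for p q
  proof -
    have "p \<noteq> q" using that by blast
    then show ?thesis using f[OF that(1)] f[OF that(2)] fw by (auto simp: conflict_def) (auto simp: w_def)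
  qed
  ultimately have "consistent (solution_size h k) (conflict_graph ?vs) (f ` P)"
    unfolding consistent_conflict_graph using f by auto
  then show ?thesis by blast
qed

text \<open>A counting argument: no two members of the solution have the same positions, and there
  are as many members as position lists. Hence every position list is realised, and the members are
  windows onto one common sequence.\<close>

lemma reduction_sound:
  assumes X: "consistent (solution_size h k) (conflict_graph (cands h C k)) X"
  shows "circ_ok h C \<and> (\<exists>S \<subseteq> inputs C. card S = k \<and> circuit_value C S)"
proof -
  let ?o = "out_gate C" and ?vs = "cands h C k" and ?r = "2 ^ Suc h :: nat"
  have XV: "X \<subseteq> {..<length ?vs}" and Xc: "card X = solution_size h k"
    and Xi: "\<And>i j. i \<in> X \<Longrightarrow> j \<in> X \<Longrightarrow> i \<noteq> j \<Longrightarrow> \<not> conflict (?vs ! i) (?vs ! j)"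
    using X by (auto simp: consistent_conflict_graph)
  have "X \<noteq> {}" using Xc by (auto simp: solution_size_eq)
  then obtain v0 where v0: "v0 \<in> X" by blast
  define x where "x = fst (?vs ! v0)"
  define W where "W = (\<lambda>v. snd (?vs ! v))"
  \<comment> \<open>Candidates with different disjuncts conflict, so comparison with
    \<open>v0\<close> shows that all members share the disjunct \<open>x\<close>.\<close>
  have vs: "?vs ! v = (x, W v)" if "v \<in> X" for v
    using Xi[OF that v0] by (cases "v = v0") (auto simp: conflict_def x_def W_def prod_eq_iff)
  have mem: "(x, W v) \<in> set ?vs" if "v \<in> X" for v
    using vs[OF that] XV that nth_mem[of v ?vs] by auto
  from mem[OF v0] have ok: "circ_ok h C" and x: "x \<in> set (alts h C ?o True)" by (auto simp: mem_cands)
  have W: "length (W v) = ?r" "set (W v) \<subseteq> set (items C k)" "tuple_ok h C x (W v)" if "v \<in> X" for v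
    using mem[OF that] by (auto simp: mem_cands)
  define P where "P = {p. set p \<subseteq> {..Suc k} \<and> length p = ?r}"
  have finP: "finite P" and cardP: "card P = solution_size h k"
    using finite_lists_length_eq[of "{..Suc k}" ?r] card_lists_length_eq[of "{..Suc k}" ?r]
    by (simp_all add: P_def solution_size_eq del: power_Suc)
  define pos where "pos = (\<lambda>v. map fst (W v))"
  have "pos ` X \<subseteq> P"
  proof
    fix p assume "p \<in> pos ` X"
    then obtain v where v: "v \<in> X" "p = map fst (W v)" by (auto simp: pos_def)
    have "fst q \<le> Suc k" if "q \<in> set (W v)" for q
    proof -
      have "(fst q, snd q) \<in> set (items C k)" using W(2)[OF v(1)] that by auto
      then show ?thesis unfolding mem_items by auto
    qed
    then show "p \<in> P" using v W(1) by (auto simp: P_def simp del: power_Suc)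
  qed
  moreover have inj: "inj_on pos X"
  proof (rule inj_onI, rule ccontr)
    fix u v assume "u \<in> X" "v \<in> X" "pos u = pos v" "u \<noteq> v"
    then show False using Xi[of u v] vs by (simp add: conflict_def pos_def)
  qed
  ultimately have posX: "pos ` X = P"
    using card_subset_eq[OF finP] cardP Xc card_image[OF inj] by simp
  define s where "s = (\<lambda>i. SOME a. \<exists>v\<in>X. (i, a) \<in> set (W v))"
  have s_eq: "a = s i" if "v \<in> X" "(i, a) \<in> set (W v)" for v i a
  proof -
    have "\<exists>v\<in>X. (i, s i) \<in> set (W v)" 
      unfolding s_def by (rule someI[of "\<lambda>a. \<exists>v\<in>X. (i, a) \<in> set (W v)" a]) (use that in blast)
    then obtain u where u: "u \<in> X" "(i, s i) \<in> set (W u)" by blast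
    \<comment> \<open>Within one tuple agreement is part of \<open>tuple_ok\<close>; between two
      tuples it is the absence of a conflict. So the choice made in \<open>s\<close> is the only
      possible one.\<close>
    have "\<forall>p\<in>set (W u). \<forall>q\<in>set (W v). fst p = fst q \<longrightarrow> snd p = snd q"
    proof (cases "u = v")
      case True
      then show ?thesis using W(3)[OF that(1)] unfolding tuple_ok_def by blast
    next
      case False
      then show ?thesis using Xi[OF u(1) that(1)] vs[OF u(1)] vs[OF that(1)] by (simp add: conflict_def)
    qed
    from this[rule_format, OF u(2) that(2)] show ?thesis by simp
  qed
  have PW: "\<exists>v\<in>X. W v = map (\<lambda>i. (i, s i)) p" if "p \<in> P" for p
  proof -
    obtain v where v: "v \<in> X" "p = pos v" using \<open>p \<in> P\<close> posX by blast
    have "map (\<lambda>i. (i, s i)) (pos v) = map (\<lambda>q. (fst q, s (fst q))) (W v)" by (simp add: pos_def)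
    also have "\<dots> = W v" by (rule map_idI) (use s_eq[OF v(1)] in \<open>auto simp: prod_eq_iff\<close>)
    finally show ?thesis using v by auto
  qed
  have tup: "tuple_ok h C x (map (\<lambda>i. (i, s i)) p)" "set (map (\<lambda>i. (i, s i)) p) \<subseteq> set (items C k)"
    if "p \<in> P" for p
    using PW[OF that] W by metis+
  have r2: "2 \<le> ?r" by simp
  \<comment> \<open>The constant position list shows that each single entry is an admissible item;
    this also pins down the two sentinels.\<close>
  have item: "(i, s i) \<in> set (items C k)" if "i \<le> Suc k" for i
    using tup(2)[of "replicate ?r i"] that by (auto simp: P_def)
  have mono: "s i < s j" if "i < j" "j \<le> Suc k" for i j
  proof -
    \<comment> \<open>Tuples have length at least two, so some member sees positions
      \<open>i\<close> and \<open>j\<close> together.\<close>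
    have "i # replicate (?r - 1) j \<in> P" using that by (auto simp: P_def)
    moreover have "?r - 1 \<noteq> 0" using r2 by linarith
    then have "j \<in> set (replicate (?r - 1) j)" by (simp only: in_set_replicate) simp
    ultimately show ?thesis
      using tup(1)[of "i # replicate (?r - 1) j"] that unfolding tuple_ok_def by simp
  qed
  define S where "S = {a. \<exists>i<k. s (Suc i) = Suc a}"
  have s: "gapseq (length C) k s S"
    unfolding gapseq_def
  proof (intro conjI allI impI)
    show "s 0 = 0" "s (Suc k) = Suc (length C)" using item[of 0] item[of "Suc k"] by (auto simp: mem_items)
  qed (auto simp: mono S_def)
  have C: "circuit C" using ok by (simp add: circ_ok_iff)
  then have ne: "C \<noteq> []" by (simp add: circuit_def)
  then have lt: "?o < length C" by (simp add: out_gate_eq)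
  have do: "depth_le h C ?o" "weft1 h C ?o" using ok by (auto simp: circ_ok_def)
  have sub: "S \<subseteq> inputs C"
  proof
    fix a assume "a \<in> S"
    then obtain i where i: "i < k" "s (Suc i) = Suc a" by (auto simp: S_def)
    then have "a < length C" "kind_at C a = 0" using item[of "Suc i"] by (auto simp: mem_items)
    then show "a \<in> inputs C" by (cases "C ! a") (auto simp: inputs_def kind_at_def nth_default_nth)
  qed
  have card: "card S = k" by (rule gapseq_card[OF s])
  have claims: "value_at C S j = c" if jc: "(j, c) \<in> set x" for j c
  proof (rule ccontr)
    assume "value_at C S j \<noteq> c"
    then have "value_at C S j = (\<not> c)" by blast
    \<comment> \<open>A false claim is refuted on some position list of length \<open>?r\<close>. As
      every such list is realised in the solution, its candidate would violate
      \<open>tuple_ok\<close>.\<close>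
    then obtain p where p: "length p = ?r" "set p \<subseteq> {..Suc k}" "forced h C (map (\<lambda>i. (i, s i)) p) j (\<not> c)"
      using forced_complete[OF C s, of j h "\<not> c"] alts_claims[OF C lt do x jc] by blast
    from p(1,2) have "p \<in> P" by (simp add: P_def)
    from tup(1)[OF this] have "\<forall>c\<in>set x. \<not> forced h C (map (\<lambda>i. (i, s i)) p) (fst c) (\<not> snd c)"
      unfolding tuple_ok_def by (rule conjunct2)
    from this[rule_format, OF jc] p(3) show False by simp
  qed
  have "value_at C S ?o = True" using alts_value_at[OF C lt do(1), of S True] x claims by blast
  then have "circuit_value C S" using ne by (simp add: circuit_value_def value_at_def out_gate_eq last_scan_gates)
  then show ?thesis using ok sub card by blast
qed

section \<open>The reduction is computable in polynomial time\<close>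

text \<open>Every tree is the list of the trees hanging off its right spine, so ranges of list codes
  can be tested element by element.\<close>

primrec list_of :: "dat \<Rightarrow> dat list" where
  "list_of Leaf = []"
| "list_of (Node a b) = a # list_of b"

lemma enc_list_list_of: "enc_list (\<lambda>x. x) (list_of d) = d"
  by (induction d) auto

lemma ex_enc_list_iff: "(\<exists>xs. d = enc_list A xs) \<longleftrightarrow> (\<forall>x\<in>set (list_of d). \<exists>a. x = A a)"
proof
  assume "\<exists>xs. d = enc_list A xs"
  then obtain xs where "d = enc_list A xs" by blast
  moreover have "\<forall>x\<in>set (list_of (enc_list A xs)). \<exists>a. x = A a" by (induction xs) auto
  ultimately show "\<forall>x\<in>set (list_of d). \<exists>a. x = A a" by blast
next
  show "\<forall>x\<in>set (list_of d). \<exists>a. x = A a \<Longrightarrow> \<exists>xs. d = enc_list A xs"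
  proof (induction d)
    case Leaf
    show ?case by (rule exI[of _ "[]"]) simp
  next
    case (Node a b)
    then obtain y ys where "a = A y" "b = enc_list A ys" by auto
    then show ?case by (intro exI[of _ "y # ys"]) simp
  qed
qed

definition is_nat :: "dat \<Rightarrow> bool" where
  "is_nat d \<longleftrightarrow> (\<forall>x\<in>set (list_of d). x = Leaf)"

definition is_nats :: "dat \<Rightarrow> bool" where
  "is_nats d \<longleftrightarrow> (\<forall>x\<in>set (list_of d). is_nat x)"

text \<open>\<open>Leaf\<close> is excluded explicitly: both projections of \<open>Leaf\<close> are
  \<open>Leaf\<close>, so it would otherwise pass for the code of \<open>Input\<close>.\<close>

definition is_gate :: "dat \<Rightarrow> bool" where
  "is_gate d \<longleftrightarrow> d \<noteq> Leaf \<and>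
    (dfst d = enc_nat 0 \<and> dsnd d = Leaf \<or> dfst d = enc_nat 1 \<and> is_nat (dsnd d) \<or>
     dfst d = enc_nat 2 \<and> is_nats (dsnd d) \<or> dfst d = enc_nat 3 \<and> is_nats (dsnd d))"

definition is_gates :: "dat \<Rightarrow> bool" where
  "is_gates d \<longleftrightarrow> (\<forall>x\<in>set (list_of d). is_gate x)"

text \<open>Trees that code no circuit are sent to the empty list, which \<open>circ_ok\<close>
  rejects. On the level of codes this is the identity or the constant \<open>Leaf\<close>, so a
  program has to perform the test only.\<close>

definition decode :: "dat \<Rightarrow> gate list" where
  "decode d = (if is_gates d then SOME C. d = enc_list enc_gate C else [])"

lemma is_nat_iff: "is_nat d \<longleftrightarrow> (\<exists>n. d = enc_nat n)"
proof -
  have "is_nat d \<longleftrightarrow> (\<exists>us. d = enc_list (\<lambda>_::unit. Leaf) us)"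
    unfolding ex_enc_list_iff is_nat_def by simp
  also have "\<dots> \<longleftrightarrow> (\<exists>n. d = enc_nat n)"
    unfolding enc_nat_eq_enc_list by (metis (full_types) replicate_length_same old.unit.exhaust)
  finally show ?thesis .
qed

lemma is_nats_iff: "is_nats d \<longleftrightarrow> (\<exists>ns. d = enc_list enc_nat ns)"
  unfolding ex_enc_list_iff is_nats_def is_nat_iff ..

lemma is_gate_iff: "is_gate d \<longleftrightarrow> (\<exists>g. d = enc_gate g)"
proof
  assume "is_gate d"
  then obtain a b where d: "d = Node a b" unfolding is_gate_def by (cases d) auto
  from \<open>is_gate d\<close> consider "a = enc_nat 0" "b = Leaf" | n where "a = enc_nat 1" "b = enc_nat n"
    | ns where "a = enc_nat 2" "b = enc_list enc_nat ns" | ns where "a = enc_nat 3" "b = enc_list enc_nat ns"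
    unfolding is_gate_def is_nat_iff is_nats_iff d by auto
  then show "\<exists>g. d = enc_gate g"
    unfolding d by cases (metis enc_gate.simps)+
next
  assume "\<exists>g. d = enc_gate g"
  then obtain g where "d = enc_gate g" by blast
  then show "is_gate d" by (cases g) (auto simp: is_gate_def is_nat_iff is_nats_iff)
qed

lemma is_gates_iff: "is_gates d \<longleftrightarrow> (\<exists>C. d = enc_list enc_gate C)"
  unfolding ex_enc_list_iff is_gates_def is_gate_iff ..

lemma enc_decode: "enc_list enc_gate (decode d) = (if is_gates d then d else Leaf)"
proof (cases "is_gates d")
  case True
  then have "d = enc_list enc_gate (SOME C. d = enc_list enc_gate C)"
    unfolding is_gates_iff by (rule someI_ex)
  then show ?thesis using True by (simp add: decode_def)
qed (simp add: decode_def)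

section \<open>Decoding and access to gates in polynomial time\<close>

lemma polytime_list_of: "polytime E (\<lambda>x. x) f \<Longrightarrow> polytime E (enc_list (\<lambda>x. x)) (\<lambda>e. list_of (f e))"
  by (erule polytime_recode) (simp add: enc_list_list_of)

lemma polytime_dfst: "polytime E (\<lambda>x. x) f \<Longrightarrow> polytime E (\<lambda>x. x) (\<lambda>e. dfst (f e))"
  by (erule polytime_comp[where g = dfst]) (rule polytime_expr[of "EFst (EVar 0)"], simp)

lemma polytime_dsnd: "polytime E (\<lambda>x. x) f \<Longrightarrow> polytime E (\<lambda>x. x) (\<lambda>e. dsnd (f e))"
  by (erule polytime_comp[where g = dsnd]) (rule polytime_expr[of "ESnd (EVar 0)"], simp)

lemma polytime_is_nat: "polytime E (\<lambda>x. x) f \<Longrightarrow> polytime E enc_bool (\<lambda>e. is_nat (f e))"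
  unfolding is_nat_def by (rule polytime_Ball polytime_list_of polytime_eq_dat polytime_snd polytime_id polytime_const | assumption)+

lemma polytime_is_nats: "polytime E (\<lambda>x. x) f \<Longrightarrow> polytime E enc_bool (\<lambda>e. is_nats (f e))"
  unfolding is_nats_def by (rule polytime_Ball polytime_list_of polytime_is_nat polytime_snd polytime_id | assumption)+

lemma polytime_is_gate: "polytime E (\<lambda>x. x) f \<Longrightarrow> polytime E enc_bool (\<lambda>e. is_gate (f e))"
  unfolding is_gate_def
  by (rule polytime_conj polytime_disj polytime_not polytime_eq_dat polytime_const polytime_dfst polytime_dsnd polytime_is_nat polytime_is_nats | assumption)+

lemma polytime_is_gates: "polytime E (\<lambda>x. x) f \<Longrightarrow> polytime E enc_bool (\<lambda>e. is_gates (f e))"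
  unfolding is_gates_def by (rule polytime_Ball polytime_list_of polytime_is_gate polytime_snd polytime_id | assumption)+

lemma polytime_decode:
  assumes "polytime E (\<lambda>x. x) f"
  shows "polytime E (enc_list enc_gate) (\<lambda>e. decode (f e))"
proof -
  have "polytime E (\<lambda>x. x) (\<lambda>e. if is_gates (f e) then f e else Leaf)"
    by (rule polytime_if polytime_is_gates assms polytime_const)+
  then show ?thesis by (rule polytime_recode) (simp add: enc_decode)
qed

lemma polytime_gate_kind: "polytime E enc_gate f \<Longrightarrow> polytime E enc_nat (\<lambda>e. gate_kind (f e))"
  by (erule polytime_comp[where g = gate_kind], rule polytime_expr[of "EFst (EVar 0)"]) (case_tac x; simp)

lemma polytime_preds:
  assumes "polytime E enc_gate f"
  shows "polytime E (enc_list enc_nat) (\<lambda>e. preds (f e))"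
proof -
  have d: "polytime E (\<lambda>x. x) (\<lambda>e. enc_gate (f e))" using assms by (rule polytime_recode) simp
  \<comment> \<open>A negation gate stores a number where the other gates store a list; wrapping it
    makes the code of a singleton. For \<open>Input\<close> the second component \<open>Leaf\<close>
    already codes the empty list.\<close>
  have p: "polytime E (\<lambda>x. x) (\<lambda>e. Node (dsnd (enc_gate (f e))) Leaf)"
    using polytime_pair[OF polytime_dsnd[OF d] polytime_const[of E "\<lambda>x. x" Leaf]] by (rule polytime_recode) (simp add: enc_pair_def)
  have "polytime E (\<lambda>x. x) (\<lambda>e. if gate_kind (f e) = 1 then Node (dsnd (enc_gate (f e))) Leaf else dsnd (enc_gate (f e)))"
    by (rule polytime_if polytime_eq_nat polytime_gate_kind assms polytime_const p polytime_dsnd d)+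
  then show ?thesis by (rule polytime_recode) (case_tac "f x"; simp)
qed

section \<open>Programs for the ingredients of the reduction\<close>

abbreviation enc_circuit :: "gate list \<Rightarrow> dat" where
  "enc_circuit \<equiv> enc_list enc_gate"

abbreviation enc_claims :: "(nat \<times> bool) list \<Rightarrow> dat" where
  "enc_claims \<equiv> enc_list (enc_nat \<otimes> enc_bool)"

abbreviation enc_tuple :: "(nat \<times> nat) list \<Rightarrow> dat" where
  "enc_tuple \<equiv> enc_list (enc_nat \<otimes> enc_nat)"

lemma polytime_kind_at: "polytime E enc_circuit C \<Longrightarrow> polytime E enc_nat i \<Longrightarrow> polytime E enc_nat (\<lambda>e. kind_at (C e) (i e))"
  unfolding kind_at_def by (rule polytime_gate_kind polytime_nth_default | assumption)+

lemma polytime_preds_at: "polytime E enc_circuit C \<Longrightarrow> polytime E enc_nat i \<Longrightarrow> polytime E (enc_list enc_nat) (\<lambda>e. preds_at (C e) (i e))"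
  unfolding preds_at_def by (rule polytime_preds polytime_nth_default | assumption)+

lemma polytime_depth_le_aux: "polytime (enc_circuit \<otimes> enc_nat) enc_bool (\<lambda>p. depth_le h (fst p) (snd p))"
proof (induction h)
  case 0
  show ?case unfolding depth_le.simps by (rule polytime_intros polytime_preds_at)+
next
  case (Suc h)
  show ?case unfolding depth_le.simps
    by (rule polytime_call2[where F = "depth_le h", OF Suc] polytime_intros polytime_preds_at)+
qed

lemmas polytime_depth_le = polytime_call2[where F = "depth_le h" for h, OF polytime_depth_le_aux]

lemma polytime_weft0_aux: "polytime (enc_circuit \<otimes> enc_nat) enc_bool (\<lambda>p. weft0 h (fst p) (snd p))"
proof (induction h)
  case 0
  show ?case unfolding weft0.simps by (rule polytime_const)
next
  case (Suc h)
  show ?case unfolding weft0.simps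
    by (rule polytime_call2[where F = "weft0 h", OF Suc] polytime_intros polytime_preds_at)+
qed

lemmas polytime_weft0 = polytime_call2[where F = "weft0 h" for h, OF polytime_weft0_aux]

lemma polytime_weft1_aux: "polytime (enc_circuit \<otimes> enc_nat) enc_bool (\<lambda>p. weft1 h (fst p) (snd p))"
proof (induction h)
  case 0
  show ?case unfolding weft1.simps by (rule polytime_const)
next
  case (Suc h)
  show ?case unfolding weft1.simps
    by (rule polytime_call2[where F = "weft1 h", OF Suc] polytime_weft0 polytime_intros polytime_preds_at)+
qed

lemmas polytime_weft1 = polytime_call2[where F = "weft1 h" for h, OF polytime_weft1_aux]

lemma polytime_alts_aux:
  "polytime (enc_circuit \<otimes> enc_nat \<otimes> enc_bool) (enc_list enc_claims) (\<lambda>p. alts h (fst p) (fst (snd p)) (snd (snd p)))"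
proof (induction h)
  case 0
  show ?case unfolding alts.simps by (rule polytime_intros)+
next
  case (Suc h)
  show ?case unfolding alts.simps
    by (rule polytime_call3[where F = "alts h", OF Suc] polytime_kind_at polytime_preds_at polytime_intros)+
qed

lemmas polytime_alts = polytime_call3[where F = "alts h" for h, OF polytime_alts_aux]

lemma polytime_input_forced:
  "polytime E enc_tuple w \<Longrightarrow> polytime E enc_nat g \<Longrightarrow> polytime E enc_bool b \<Longrightarrow> polytime E enc_bool (\<lambda>e. input_forced (w e) (g e) (b e))"
proof (rule polytime_call3[where F = input_forced])
  show "polytime (enc_tuple \<otimes> enc_nat \<otimes> enc_bool) enc_bool (\<lambda>p. input_forced (fst p) (fst (snd p)) (snd (snd p)))"
    unfolding input_forced_def by (rule polytime_intros)+
qed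

lemma polytime_forced_aux:
  "polytime (enc_circuit \<otimes> enc_tuple \<otimes> enc_nat \<otimes> enc_bool) enc_bool
     (\<lambda>p. forced h (fst p) (fst (snd p)) (fst (snd (snd p))) (snd (snd (snd p))))"
proof (induction h)
  case 0
  show ?case unfolding forced.simps by (rule polytime_input_forced polytime_intros)+
next
  case (Suc h)
  show ?case unfolding forced.simps
    by (rule polytime_call4[where F = "forced h", OF Suc] polytime_input_forced polytime_kind_at polytime_preds_at polytime_intros)+
qed

lemmas polytime_forced = polytime_call4[where F = "forced h" for h, OF polytime_forced_aux]

lemma polytime_tuple_ok_aux:
  "polytime (enc_circuit \<otimes> enc_claims \<otimes> enc_tuple) enc_bool (\<lambda>p. tuple_ok h (fst p) (fst (snd p)) (snd (snd p)))"
  unfolding tuple_ok_def by (rule polytime_forced polytime_intros)+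

lemmas polytime_tuple_ok = polytime_call3[where F = "tuple_ok h" for h, OF polytime_tuple_ok_aux]

lemma polytime_items_aux: "polytime (enc_circuit \<otimes> enc_nat) enc_tuple (\<lambda>p. items (fst p) (snd p))"
  unfolding items_def by (rule polytime_kind_at polytime_intros)+

lemmas polytime_items = polytime_call2[where F = items, OF polytime_items_aux]

lemma polytime_out_gate: "polytime E enc_circuit C \<Longrightarrow> polytime E enc_nat (\<lambda>e. out_gate (C e))"
  unfolding out_gate_def by (rule polytime_hd_default polytime_rev polytime_upt polytime_length | assumption)+

lemma polytime_circ_ok_aux: "polytime enc_circuit enc_bool (circ_ok h)"
  unfolding circ_ok_def by (rule polytime_depth_le polytime_weft1 polytime_out_gate polytime_kind_at polytime_preds_at polytime_intros)+

lemmas polytime_circ_ok = polytime_comp[OF _ polytime_circ_ok_aux]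

lemma polytime_cands_aux: "polytime (enc_circuit \<otimes> enc_nat) (enc_list (enc_claims \<otimes> enc_tuple)) (\<lambda>p. cands h (fst p) (snd p))"
  unfolding cands_def by (rule polytime_tuple_ok polytime_circ_ok polytime_items polytime_alts polytime_out_gate polytime_intros)+

lemmas polytime_cands = polytime_call2[where F = "cands h" for h, OF polytime_cands_aux]

lemma polytime_conflict_aux:
  "polytime ((enc_claims \<otimes> enc_tuple) \<otimes> (enc_claims \<otimes> enc_tuple)) enc_bool (\<lambda>p. conflict (fst p) (snd p))"
  unfolding conflict_def
  by (rule polytime_eq[OF inj_enc_list[OF inj_enc_pair[OF inj_enc_nat inj_enc_bool]]]
      polytime_eq[OF inj_enc_list[OF inj_enc_nat]] polytime_intros)+

lemmas polytime_conflict = polytime_call2[where F = conflict, OF polytime_conflict_aux]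

lemma enc_instance_eq: "enc_instance = enc_list enc_nat \<otimes> enc_list (enc_list (enc_nat \<otimes> enc_nat) \<otimes> enc_bool)"
proof -
  have e: "enc_edge = enc_nat \<otimes> enc_nat" by (auto simp: enc_edge_def enc_pair_def fun_eq_iff)
  have s: "enc_sample = enc_list enc_edge \<otimes> enc_bool" by (auto simp: enc_sample_def enc_pair_def fun_eq_iff)
  show ?thesis by (auto simp: enc_instance_def enc_pair_def fun_eq_iff samples_def s e)
qed

lemma polytime_conflict_graph_aux: "polytime (enc_list (enc_claims \<otimes> enc_tuple)) enc_instance conflict_graph"
  unfolding conflict_graph_def enc_instance_eq by (rule polytime_conflict polytime_intros)+

lemmas polytime_conflict_graph = polytime_comp[OF _ polytime_conflict_graph_aux]

section \<open>Using a consistency checker as a subroutine\<close>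

definition enc_reduced :: "nat \<Rightarrow> dat \<times> nat \<Rightarrow> dat" where
  "enc_reduced h p = Node (enc_nat (solution_size h (snd p)))
     (Node (enc_nat 1) (enc_instance (conflict_graph (cands h (decode (fst p)) (snd p)))))"

text \<open>The reduced instance is treated as another code of the pair of circuit and weight, so
  the reduction is a change of code. The checker then becomes a program on a code all of whose words
  are valid instances.\<close>

lemma polytime_enc_reduced: "polytime enc_param' (enc_reduced h) (\<lambda>p. p)"
proof -
  have "polytime enc_param' (enc_nat \<otimes> enc_nat \<otimes> enc_instance)
    (\<lambda>p. (solution_size h (snd p), 1, conflict_graph (cands h (decode (fst p)) (snd p))))"
    unfolding enc_param'_eq solution_size_def by (rule polytime_conflict_graph polytime_cands polytime_decode polytime_intros)+
  then show ?thesis by (rule polytime_recode) (simp add: enc_reduced_def enc_pair_def)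
qed

lemma WCS_iff_consistent:
  "p \<in> WCS 1 h \<longleftrightarrow> (\<exists>X. consistent (solution_size h (snd p)) (conflict_graph (cands h (decode (fst p)) (snd p))) X)"
proof -
  obtain x k where p: "p = (x, k)" by fastforce
  show ?thesis
  proof (cases "is_gates x")
    case True
    then have x: "x = enc_list enc_gate (decode x)" using enc_decode[of x] by simp
    have "x = enc_list enc_gate C \<longleftrightarrow> C = decode x" for C
      using x inj_eq[OF inj_enc_list[OF inj_enc_gate]] by metis
    then have "p \<in> WCS 1 h \<longleftrightarrow> circ_ok h (decode x) \<and>
        (\<exists>S \<subseteq> inputs (decode x). card S = k \<and> circuit_value (decode x) S)"
      unfolding WCS_def p circ_ok_iff by auto
    also have "\<dots> \<longleftrightarrow> (\<exists>X. consistent (solution_size h k) (conflict_graph (cands h (decode x) k)) X)"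
      using reduction_complete reduction_sound by meson
    finally show ?thesis by (simp add: p)
  next
    case False
    then have "decode x = []" by (simp add: decode_def)
    then have "\<not> circ_ok h (decode x)" by (simp add: circ_ok_def)
    moreover have "p \<notin> WCS 1 h" using False unfolding WCS_def p is_gates_iff by auto
    ultimately show ?thesis using reduction_sound unfolding p by fastforce
  qed
qed

lemma W1_subset_FPT:
  assumes "fpt_algorithm_ConsCheck_IS P"
  shows "W 1 \<subseteq> FPT"
proof
  fix L assume "L \<in> W 1"
  then obtain h where "fpt_reducible L (WCS 1 h)" unfolding W_def by blast
  then obtain r g where r: "fpt_computable enc_param' r" and g: "computable g"
    and rg: "\<And>p. snd (r p) \<le> g (snd p)" "\<And>p. p \<in> L \<longleftrightarrow> r p \<in> WCS 1 h"
    unfolding fpt_reducible_iff by blast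
  obtain f c where f: "computable f" and
    P: "\<And>k d I. valid_instance d I \<Longrightarrow> \<exists>t y. runs P (Node (enc_nat k) (Node (enc_nat d) (enc_instance I))) t y
           \<and> t \<le> f (k + d + num_negative I) * dsize (enc_instance I) ^ c \<and> correct_output k I y"
    using assms unfolding fpt_algorithm_ConsCheck_IS_def by blast
  let ?I = "\<lambda>q. conflict_graph (cands h (decode (fst q)) (snd q))" and ?K = "\<lambda>q. solution_size h (snd q)"
  \<comment> \<open>The instances have degree bound 1 and no negative sample, so the parameter
    \<open>k + d + t^-\<close> is \<open>?K q + 1\<close>.\<close>
  let ?T = "\<lambda>q. f (?K q + 1) * dsize (enc_instance (?I q)) ^ c"
  have "\<exists>y t. t \<le> ?T q \<and> runs P (enc_reduced h q) t y \<and> correct_output (?K q) (?I q) y" for q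
    using P[OF valid_conflict_graph, of "?K q" "cands h (decode (fst q)) (snd q)"]
    by (auto simp: enc_reduced_def num_negative_conflict_graph)
  then obtain out where
    out: "\<And>q. \<exists>t. t \<le> ?T q \<and> runs P (enc_reduced h q) t (out q) \<and> correct_output (?K q) (?I q) (out q)"
    by metis
  then have computed_in: "computed_in (enc_reduced h) (\<lambda>y. y) out ?T" unfolding computed_in_def by blast
  \<comment> \<open>The time factor \<open>f\<close> need not be monotone, so a value at a bounded
    argument is dominated by the sum of all values up to the bound. The summand 2 covers the
    \<open>+ 1\<close> in the argument and the strict upper limit of the sum.\<close>
  define F where "F = (\<lambda>k. \<Sum>j<(g k + 2) ^ (2 ^ Suc h) + 2. f j)"
  have F: "computable F" unfolding F_def
    by (intro computable_sum computable_intros g f)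
  have "fpt_computable (\<lambda>y. y) (\<lambda>p. out (r p))"
  proof (rule fpt_computable_compose[OF fpt_computable_polytime[OF r polytime_enc_reduced] computed_in F])
    fix p
    have "?K (r p) + 1 < (g (snd p) + 2) ^ (2 ^ Suc h) + 2"
    proof -
      have "(snd (r p) + 2) ^ (2 ^ Suc h) \<le> (g (snd p) + 2) ^ (2 ^ Suc h)"
        using rg(1)[of p] by (intro power_mono) auto
      then show ?thesis unfolding solution_size_eq by linarith
    qed
    then have "f (?K (r p) + 1) \<le> F (snd p)" unfolding F_def by (intro member_le_sum) auto
    moreover have "dsize (enc_instance (?I (r p))) \<le> dsize (enc_reduced h (r p))"
      by (simp add: enc_reduced_def)
    ultimately show "?T (r p) \<le> F (snd p) * dsize (enc_reduced h (r p)) ^ c"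
      by (intro mult_mono power_mono) auto
  qed
  \<comment> \<open>A solution is coded by a \<open>Node\<close> and its absence by
    \<open>Leaf\<close>, so the output of the search algorithm already answers the decision
    problem.\<close>
  moreover have "p \<in> L \<longleftrightarrow> out (r p) \<noteq> Leaf" for p
    using out[of "r p"] unfolding rg(2) WCS_iff_consistent correct_output_def by auto
  ultimately show "L \<in> FPT" unfolding FPT_iff by blast
qed

theorem theorem13:
  assumes "FPT \<noteq> W 1"
  shows "\<nexists>P. fpt_algorithm_ConsCheck_IS P"
  using assms FPT_subset_W1 W1_subset_FPT by blast

end
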